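(* Let $1\le p<\infty$, $0<r<\infty$, $0<q\le\infty$, $\frac1s:=\left(\frac1r-\frac1p\right)_+$. Let $u,v,w\in\mathfrak M^+$ with $0<\int_t^\infty u<\infty$ for all $t>0$, and let $k$ be an Oinarov kernel with constant $D$. Let $C_{\mathfrak T}\in[0,\infty]$ be the least constant such that $\|\mathfrak Tf\|_{L^r_u}\le C_{\mathfrak T}\|f\|_{L^p_v}$ for all $f\in\mathfrak M^+$, where $$(\mathfrak Tf)(x)=\left(\int_0^x k(x,y)w(y)\left(\int_y^\infty f(z)\,dz\right)^q dy\right)^{1/q}\ (q<\infty),\qquad (\mathfrak Tf)(x)=\operatorname*{ess\,sup}_{y\in(0,x)} k(x,y)w(y)\int_y^\infty f(z)\,dz\ (q=\infty).$$ If $q<\infty$, let $\mathcal B_0,\mathcal B_1\in[0,\infty]$ be the least constants such that for all $f\in\mathfrak M^+$ $$\left(\int_0^\infty u(x)\left(\int_0^x k(x,y)w(y)\,dy\right)^{\frac rq}\left(\int_x^\infty f\right)^r dx\right)^{\frac1r}\le \mathcal B_0\|f\|_{L^p_v},$$ $$\left(\int_0^\infty u(x)[k(x,\zeta^{-2}(x))]^{\frac rq}\left(\int_0^{\zeta^{-2}(x)} w(y)\left(\int_y^\infty f\right)^q dy\right)^{\frac rq} dx\right)^{\frac1r}\le \mathcal B_1\|f\|_{L^p_v};$$ if $q=\infty$, let $\mathcal B_0,\mathcal B_1\in[0,\infty]$ be the least constants such that for all $f\in\mathfrak M^+$ $$\left(\int_0^\infty u(x)\left[\operatorname*{ess\,sup}_{y\in(0,x)}k(x,y)w(y)\right]^r\left(\int_x^\infty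 f\right)^r dx\right)^{\frac1r}\le \mathcal B_0\|f\|_{L^p_v},$$ $$\left(\int_0^\infty u(x)[k(x,\zeta^{-2}(x))]^r\left(\operatorname*{ess\,sup}_{y\in(0,\zeta^{-2}(x))}w(y)\int_y^\infty f\right)^r dx\right)^{\frac1r}\le \mathcal B_1\|f\|_{L^p_v}.$$ Let $$\mathcal B_2:=\begin{cases}\displaystyle\sup_{t\in(0,\infty)}\left(\int_t^\infty u\right)^{\frac1r}\|\mathfrak H_t\|_{L^p_v\to L^q_{w(\cdot)k(t,\cdot)}},& p\le r,\\[2mm] \displaystyle\left(\int_0^\infty u(x)\left(\int_x^\infty u\right)^{\frac sp}\|\mathfrak H_{\zeta^{-1}(x),\zeta^2(x)}\|^s_{L^p_v\to L^q_{w(\cdot)k(\zeta^2(x),\cdot)}}\,dx\right)^{\frac1s},& r<p.\end{cases}$$ Then $C_{\mathfrak T}<\infty$ if and only if $\mathcal B_0$, $\mathcal B_1$ and $\mathcal B_2$ are all finite. Moreover, $C_{\mathfrak T}\approx \mathcal B_0+\mathcal B_1+\mathcal B_2$, i.e. each side is bounded by the other times a positive constant depending only on $p,q,r,D$.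
   Context: $\mathfrak M$ is the set of measurable functions on $[0,\infty)$, $\mathfrak M^+\subset\mathfrak M$ the non-negative ones. For $0<p<\infty$, $v\in\mathfrak M^+$: $\|f\|_{L^p_v}:=\left(\int_0^\infty|f|^pv\right)^{1/p}$; for $p=\infty$: $\|f\|_{L^\infty_v}:=\operatorname{ess\,sup}_{x\ge0}v(x)|f(x)|$. $L^q_{w(\cdot)k(t,\cdot)}$ is the weighted space with weight $y\mapsto w(y)k(t,y)$. For a positive operator $H$ on $\mathfrak M^+$ and a weight $\omega$, $\|H\|_{L^p_v\to L^q_\omega}\in[0,\infty]$ is the least $C$ with $\|Hf\|_{L^q_\omega}\le C\|f\|_{L^p_v}$ for all $f\in\mathfrak M^+$. Expressions $0\cdot\infty$, $\frac\infty\infty$, $\frac00$ are taken to be $0$; an essential supremum over an empty set is $0$. $(a)_+=\max(a,0)$ ($s$ is used only when $r<p$). Oinarov kernel with constant $D\ge1$: a Borel function $k(x,y)\ge0$ on $[0,\infty)^2$ with $k(x,y)=0$ if $x<y$ and $\frac1D(k(x,z)+k(z,y))\le k(x,y)\le D(k(x,z)+k(z,y))$ for all $x\ge z\ge y\ge0$. The functions $\zeta,\zeta^{-1}:[0,\infty)\to[0,\infty)$ are defined (with $\sup\varnothing=0$) by $$\zeta(x):=\sup\left\{y>0:\int_y^\infty u\ge\tfrac12\int_x^\infty u\right\},\qquad \zeta^{-1}(x):=\sup\left\{y>0:\int_y^\infty u\ge2\int_x^\infty u\right\},$$ $\zeta^2:=\zeta\circ\zeta$, $\zeta^{-2}:=\zeta^{-1}\circ\zeta^{-1}$.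 For $0\le c<d<\infty$ and $f\in\mathfrak M^+$: $$(\mathfrak H_{c,d}f)(x):=\chi_{(c,d]}(x)\int_x^{\zeta(d)} f(z)\,dz,\qquad (\mathfrak H_df)(x):=\chi_{(0,d]}(x)\int_x^\infty f(z)\,dz.$$ *)

theory Defs
  imports "HOL-Analysis.Analysis" "HOL-Probability.Essential_Supremum"
begin

text \<open>
  A function on \<open>[0,\<infinity>)\<close> is modelled as a function on \<open>real\<close>, of which only the values on
  \<open>{0..}\<close> are ever used. Non-negative measurable functions take values in \<open>[0,\<infinity>]\<close> (type
  \<open>ennreal\<close>), since the operators considered below map into this class and may produce infinite
  values. Multiplication on \<open>ennreal\<close> satisfies \<open>0 * \<infinity> = 0\<close>.
\<close>

text \<open>Real powers on \<open>[0,\<infinity>]\<close>; meaningful for positive exponents only.\<close>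

definition powe :: "ennreal \<Rightarrow> real \<Rightarrow> ennreal" (infixr "powe" 80) where
  "x powe a = (if x = top then top else ennreal (enn2real x powr a))"

definition Mplus :: "(real \<Rightarrow> ennreal) set" where
  "Mplus = borel_measurable (lebesgue_on {0..})"

definition tail :: "(real \<Rightarrow> ennreal) \<Rightarrow> real \<Rightarrow> ennreal" where
  "tail f x = (\<integral>\<^sup>+z\<in>{x..}. f z \<partial>lebesgue)"

text \<open>
  The library's essential supremum over a null set (in particular over the empty set) is the
  bottom element, i.e. \<open>0\<close>.
\<close>

definition ess_sup_on :: "real set \<Rightarrow> (real \<Rightarrow> ennreal) \<Rightarrow> ennreal" where
  "ess_sup_on A g = esssup (lebesgue_on A) g"

definition wnorm :: "ennreal \<Rightarrow> (real \<Rightarrow> ennreal) \<Rightarrow> (real \<Rightarrow> ennreal) \<Rightarrow> ennreal" where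
  "wnorm p v f =
     (if p = top then ess_sup_on {0..} (\<lambda>x. v x * f x)
      else (\<integral>\<^sup>+x\<in>{0..}. (f x powe enn2real p) * v x \<partial>lebesgue) powe (1 / enn2real p))"

text \<open>
  The least \<open>C \<in> [0,\<infinity>]\<close> with \<open>N f \<le> C \<parallel>f\<parallel>\<close> (weighted \<open>L\<^sup>p\<close> norm on the right) for all \<open>f\<close>.
  It is taken as an infimum: because of \<open>\<infinity> * 0 = 0\<close> the set of admissible constants is empty
  when \<open>\<parallel>f\<parallel> = 0 < N f\<close> for some \<open>f\<close>, and its infimum is then \<open>\<infinity>\<close>.
\<close>

definition least_const ::
  "((real \<Rightarrow> ennreal) \<Rightarrow> ennreal) \<Rightarrow> ennreal \<Rightarrow> (real \<Rightarrow> ennreal) \<Rightarrow> ennreal" where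
  "least_const N p v = Inf {C. \<forall>f\<in>Mplus. N f \<le> C * wnorm p v f}"

definition op_norm ::
  "ennreal \<Rightarrow> (real \<Rightarrow> ennreal) \<Rightarrow> ennreal \<Rightarrow> (real \<Rightarrow> ennreal)
    \<Rightarrow> ((real \<Rightarrow> ennreal) \<Rightarrow> real \<Rightarrow> ennreal) \<Rightarrow> ennreal" where
  "op_norm p v q \<omega> H = least_const (\<lambda>f. wnorm q \<omega> (H f)) p v"

definition oinarov_kernel :: "real \<Rightarrow> (real \<Rightarrow> real \<Rightarrow> real) \<Rightarrow> bool" where
  "oinarov_kernel D k \<longleftrightarrow>
     (\<lambda>(x, y). k x y) \<in> borel_measurable (restrict_space borel ({0..} \<times> {0..})) \<and>
     (\<forall>x\<ge>0. \<forall>y\<ge>0. 0 \<le> k x y) \<and>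
     (\<forall>x\<ge>0. \<forall>y\<ge>0. x < y \<longrightarrow> k x y = 0) \<and>
     (\<forall>x y z. 0 \<le> y \<and> y \<le> z \<and> z \<le> x \<longrightarrow>
        1 / D * (k x z + k z y) \<le> k x y \<and> k x y \<le> D * (k x z + k z y))"

definition Sup0 :: "real set \<Rightarrow> real" where
  "Sup0 S = (if S = {} then 0 else Sup S)"

definition zeta :: "(real \<Rightarrow> ennreal) \<Rightarrow> real \<Rightarrow> real" where
  "zeta u x = Sup0 {y. 0 < y \<and> tail u y \<ge> tail u x / 2}"

text \<open>\<open>zeta_inv\<close> is a generalised inverse, not the inverse function of \<open>zeta\<close>.\<close>

definition zeta_inv :: "(real \<Rightarrow> ennreal) \<Rightarrow> real \<Rightarrow> real" where
  "zeta_inv u x = Sup0 {y. 0 < y \<and> tail u y \<ge> 2 * tail u x}"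

definition H_block ::
  "(real \<Rightarrow> ennreal) \<Rightarrow> real \<Rightarrow> real \<Rightarrow> (real \<Rightarrow> ennreal) \<Rightarrow> real \<Rightarrow> ennreal" where
  "H_block u c d f x = indicator {c<..d} x * (\<integral>\<^sup>+z\<in>{x..zeta u d}. f z \<partial>lebesgue)"

definition H_tail :: "real \<Rightarrow> (real \<Rightarrow> ennreal) \<Rightarrow> real \<Rightarrow> ennreal" where
  "H_tail d f x = indicator {0<..d} x * tail f x"

definition T_op ::
  "ennreal \<Rightarrow> (real \<Rightarrow> real \<Rightarrow> real) \<Rightarrow> (real \<Rightarrow> ennreal) \<Rightarrow> (real \<Rightarrow> ennreal) \<Rightarrow> real \<Rightarrow> ennreal" where
  "T_op q k w f x =
     (if q = top then ess_sup_on {0<..<x} (\<lambda>y. ennreal (k x y) * w y * tail f y)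
      else (\<integral>\<^sup>+y\<in>{0<..<x}. ennreal (k x y) * w y * (tail f y powe enn2real q) \<partial>lebesgue)
             powe (1 / enn2real q))"

definition C_T ::
  "real \<Rightarrow> ennreal \<Rightarrow> real \<Rightarrow> (real \<Rightarrow> ennreal) \<Rightarrow> (real \<Rightarrow> ennreal) \<Rightarrow> (real \<Rightarrow> ennreal)
    \<Rightarrow> (real \<Rightarrow> real \<Rightarrow> real) \<Rightarrow> ennreal" where
  "C_T p q r u v w k = least_const (\<lambda>f. wnorm (ennreal r) u (T_op q k w f)) (ennreal p) v"

definition B0 ::
  "real \<Rightarrow> ennreal \<Rightarrow> real \<Rightarrow> (real \<Rightarrow> ennreal) \<Rightarrow> (real \<Rightarrow> ennreal) \<Rightarrow> (real \<Rightarrow> ennreal)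
    \<Rightarrow> (real \<Rightarrow> real \<Rightarrow> real) \<Rightarrow> ennreal" where
  "B0 p q r u v w k =
     (if q = top then
        least_const (\<lambda>f. (\<integral>\<^sup>+x\<in>{0..}.
            u x * (ess_sup_on {0<..<x} (\<lambda>y. ennreal (k x y) * w y) powe r)
                * (tail f x powe r) \<partial>lebesgue) powe (1 / r)) (ennreal p) v
      else
        least_const (\<lambda>f. (\<integral>\<^sup>+x\<in>{0..}.
            u x * ((\<integral>\<^sup>+y\<in>{0<..<x}. ennreal (k x y) * w y \<partial>lebesgue) powe (r / enn2real q))
                * (tail f x powe r) \<partial>lebesgue) powe (1 / r)) (ennreal p) v)"

definition B1 ::
  "real \<Rightarrow> ennreal \<Rightarrow> real \<Rightarrow> (real \<Rightarrow> ennreal) \<Rightarrow> (real \<Rightarrow> ennreal) \<Rightarrow> (real \<Rightarrow> ennreal)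
    \<Rightarrow> (real \<Rightarrow> real \<Rightarrow> real) \<Rightarrow> ennreal" where
  "B1 p q r u v w k =
     (let \<zeta>m2 = zeta_inv u \<circ> zeta_inv u in
      if q = top then
        least_const (\<lambda>f. (\<integral>\<^sup>+x\<in>{0..}.
            u x * (ennreal (k x (\<zeta>m2 x)) powe r)
                * (ess_sup_on {0<..<\<zeta>m2 x} (\<lambda>y. w y * tail f y) powe r) \<partial>lebesgue)
            powe (1 / r)) (ennreal p) v
      else
        least_const (\<lambda>f. (\<integral>\<^sup>+x\<in>{0..}.
            u x * (ennreal (k x (\<zeta>m2 x)) powe (r / enn2real q))
                * ((\<integral>\<^sup>+y\<in>{0<..<\<zeta>m2 x}. w y * (tail f y powe enn2real q) \<partial>lebesgue)
                     powe (r / enn2real q)) \<partial>lebesgue)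
            powe (1 / r)) (ennreal p) v)"

definition B2 ::
  "real \<Rightarrow> ennreal \<Rightarrow> real \<Rightarrow> (real \<Rightarrow> ennreal) \<Rightarrow> (real \<Rightarrow> ennreal) \<Rightarrow> (real \<Rightarrow> ennreal)
    \<Rightarrow> (real \<Rightarrow> real \<Rightarrow> real) \<Rightarrow> ennreal" where
  "B2 p q r u v w k =
     (let s = 1 / max (1 / r - 1 / p) 0; \<zeta>2 = zeta u \<circ> zeta u in
      if p \<le> r then
        (SUP t\<in>{0<..}. (tail u t powe (1 / r))
            * op_norm (ennreal p) v q (\<lambda>y. w y * ennreal (k t y)) (H_tail t))
      else
        (\<integral>\<^sup>+x\<in>{0..}. u x * (tail u x powe (s / p))
            * (op_norm (ennreal p) v q (\<lambda>y. w y * ennreal (k (\<zeta>2 x) y))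
                 (H_block u (zeta_inv u x) (\<zeta>2 x)) powe s) \<partial>lebesgue) powe (1 / s))"

end

theory Submission
  imports Defs
begin

text \<open>
  Cut the half-line at the points where the tail \<open>U x = \<integral>\<^sub>x\<^sup>\<infinity> u\<close> takes the values \<open>\<lambda> 2\<^sup>-\<^sup>k\<close>; then \<open>\<zeta>\<close> and
  \<open>\<zeta>\<^sup>-\<^sup>1\<close> move every point by exactly one block. The bounds for \<open>B0\<close>, \<open>B1\<close> and, if \<open>p \<le> r\<close>, \<open>B2\<close> by the
  norm of the operator are pointwise. If \<open>r < p\<close>, near-extremal functions of the blocks are superposed with
  coefficients given by the duality of sequence spaces.

  Conversely, the operator is quasi-monotone in \<open>x\<close> and hence determined by its values at the cut points.
  Splitting the kernel \<open>M\<close> blocks below the current one by the Oinarov condition yields a recursion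
  for these values which is contractive for large \<open>M\<close>. Its inhomogeneous term reduces to one-step terms:
  the far part is controlled by \<open>B1\<close>; in the local part, \<open>\<integral>\<^sub>y\<^sup>\<infinity> f\<close> is the sum of an integral up to the
  next cut point, controlled by \<open>B2\<close> and Hoelder's inequality (or the inclusion of sequence spaces if
  \<open>p \<le> r\<close>), and of a constant, controlled by \<open>B0\<close>.

  Integrals in the outer variable are compared with step functions only, so that it does not matter whether
  the integrands in \<open>B0\<close>, \<open>B1\<close>, \<open>B2\<close> are measurable there.
\<close>

subsection \<open>Real powers of extended non-negative numbers\<close>

text \<open>Absorbing part of a sum into the left side presupposes that the sum is finite. The
  operator is therefore first replaced by its truncation \<open>S f m\<close> to (X m, X k], which
  vanishes for k at most m; the bound does not depend on m, and monotone convergence removes the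
  truncation. A recursion over a single block need not be contractive: the levels gain only a factor
  2, whereas the kernel and the quasi-triangle inequality cost factors depending on D, q and r.
  Reducing the inhomogeneous term of the longer recursion to one-step terms costs a constant
  depending on M, which is harmless since M is chosen from q, r and D alone. If \<open>U 0\<close>
  is finite, the cut points collapse to 0 from some index downwards. Such blocks are empty although
  their levels are positive, so sums over levels can be compared with integrals only for terms that
  vanish there. For small q and r there are only quasi-norms; all basic inequalities are therefore
  crude ones, based on the maximum and valid for every positive exponent. \<open>zeta\<close> and
  \<open>zeta_inv\<close> locate points only up to a block. The resulting widening of intervals is
  paid for with powers of 2 and with the kernel constant.\<close>

lemma powe_ennreal: "0 \<le> c \<Longrightarrow> ennreal c powe a = ennreal (c powr a)"
  by (simp add: powe_def)

lemma powe_top [simp]: "top powe a = top"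
  by (simp add: powe_def)

lemma powe_0 [simp]: "0 powe a = 0"
  by (simp add: powe_def)

lemma powe_1 [simp]: "x powe 1 = x"
  by (cases x) (auto simp: powe_def)

lemma one_powe [simp]: "1 powe a = 1"
  by (simp add: powe_def)

lemma powe_mono: "0 < a \<Longrightarrow> x \<le> y \<Longrightarrow> x powe a \<le> y powe a"
  by (cases x; cases y) (auto simp: powe_ennreal powr_mono2 ennreal_leI top_unique)

lemma powe_mult: "(x * y) powe a = x powe a * y powe a"
proof (cases x; cases y)
  fix r s assume "x = ennreal r" "0 \<le> r" "y = ennreal s" "0 \<le> s"
  then show ?thesis
    by (simp add: powe_ennreal ennreal_mult[symmetric] powr_mult)
next
  fix s assume "x = top" "y = ennreal s" "0 \<le> s"
  then show ?thesis
    by (cases "s = 0") (auto simp: powe_ennreal ennreal_top_mult)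
next
  fix s assume "x = ennreal s" "y = top" "0 \<le> s"
  then show ?thesis
    by (cases "s = 0") (auto simp: powe_ennreal ennreal_mult_top)
qed auto

lemma powe_powe: "(x powe a) powe b = x powe (a * b)"
  by (cases x) (auto simp: powe_ennreal powr_powr)

lemma powe_inverse_cancel [simp]: "0 < a \<Longrightarrow> (x powe a) powe (1 / a) = x"
  by (simp add: powe_powe)

lemma powe_inverse_cancel' [simp]: "0 < a \<Longrightarrow> (x powe (1 / a)) powe a = x"
  by (simp add: powe_powe)

lemma powe_add_exponent: "x powe (a + b) = x powe a * x powe b"
proof (cases x)
  case (real r)
  then show ?thesis by (simp add: powe_ennreal powr_add ennreal_mult)
qed simp

lemma powe_le_iff: "0 < a \<Longrightarrow> x powe a \<le> y powe a \<longleftrightarrow> x \<le> y"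
  by (metis powe_inverse_cancel powe_mono zero_less_divide_1_iff)

lemma powe_le_of_le_powe: "0 < a \<Longrightarrow> x powe a \<le> y \<Longrightarrow> x \<le> y powe (1 / a)"
  by (metis powe_inverse_cancel' powe_le_iff)

lemma powe_le_of_le_root: "0 < a \<Longrightarrow> x \<le> y powe (1 / a) \<Longrightarrow> x powe a \<le> y"
  by (metis powe_inverse_cancel' powe_le_iff)

lemma powe_eq_0_iff [simp]: "x powe a = 0 \<longleftrightarrow> x = 0"
  by (cases x) (auto simp: powe_ennreal)

lemma powe_eq_top_iff [simp]: "x powe a = top \<longleftrightarrow> x = top"
  by (cases x) (auto simp: powe_ennreal)

lemma powe_less_top_iff [simp]: "x powe a < top \<longleftrightarrow> x < top"
  by (metis less_top powe_eq_top_iff)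

text \<open>Bounding both summands by the maximum works for every positive exponent, below and above
  1 alike, so norms and quasi-norms need not be separated.\<close>

lemma powe_add_le:
  assumes "0 < a"
  shows "(x + y) powe a \<le> ennreal (2 powr a) * (x powe a + y powe a)"
proof -
  have "(x + y) powe a \<le> (2 * max x y) powe a"
    using assms by (intro powe_mono) (auto simp: mult_2 intro: add_mono)
  also have "\<dots> = ennreal (2 powr a) * (max x y) powe a"
    using powe_ennreal[of 2 a] by (simp add: powe_mult)
  also have "\<dots> \<le> ennreal (2 powr a) * (x powe a + y powe a)"
    by (intro mult_left_mono) (auto simp: max_def)
  finally show ?thesis .
qed

lemma borel_measurable_powe [measurable]:
  assumes [measurable]: "f \<in> borel_measurable M"
  shows "(\<lambda>x. f x powe a) \<in> borel_measurable M"
  unfolding powe_def by measurable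

text \<open>A positive power is an order isomorphism whose inverse is the reciprocal power, and
  therefore commutes with suprema.\<close>

lemma powe_SUP:
  assumes "0 < a" "I \<noteq> {}"
  shows "(SUP i\<in>I. f i) powe a = (SUP i\<in>I. f i powe a)"
proof (rule antisym)
  have "(SUP i\<in>I. f i) \<le> (SUP i\<in>I. f i powe a) powe (1 / a)"
    using assms by (intro SUP_least powe_le_of_le_powe SUP_upper) auto
  then show "(SUP i\<in>I. f i) powe a \<le> (SUP i\<in>I. f i powe a)"
    using assms by (metis powe_le_of_le_root)
  show "(SUP i\<in>I. f i powe a) \<le> (SUP i\<in>I. f i) powe a"
    using assms by (intro SUP_least powe_mono SUP_upper) auto
qed

text \<open>A crude Young inequality: both factors are bounded by powers of the maximum. It yields
  Hoelder's inequality up to a factor 2.\<close>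

lemma powe_mult_le_add:
  assumes "0 < a" "0 < b" "a + b = 1"
  shows "x powe a * y powe b \<le> x + y"
proof -
  have "x powe a * y powe b \<le> max x y powe a * max x y powe b"
    using assms by (intro mult_mono powe_mono) auto
  also have "\<dots> = max x y"
    by (simp add: powe_add_exponent[symmetric] assms)
  also have "\<dots> \<le> x + y" by (auto simp: max_def)
  finally show ?thesis .
qed

subsection \<open>Least constants\<close>

text \<open>Functions of infinite norm are delicate only for \<open>C = 0\<close>, because 0 * top =
  0. Adding a positive \<open>e\<close> makes the right side infinite for them, and \<open>e\<close>
  is arbitrary.\<close>

lemma least_const_le:
  assumes "\<And>f. f \<in> Mplus \<Longrightarrow> wnorm p v f < top \<Longrightarrow> N f \<le> C * wnorm p v f"
  shows "least_const N p v \<le> C"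
proof (cases "C = top")
  case False
  show ?thesis
  proof (rule ennreal_le_epsilon)
    fix e :: real assume e: "0 < e"
    have "N f \<le> (C + ennreal e) * wnorm p v f" if "f \<in> Mplus" for f
    proof (cases "wnorm p v f = top")
      case True
      then show ?thesis using e by (simp add: ennreal_mult_top)
    next
      case False
      then have "N f \<le> C * wnorm p v f" using assms that by (simp add: less_top)
      also have "\<dots> \<le> (C + ennreal e) * wnorm p v f" by (intro mult_right_mono) auto
      finally show ?thesis .
    qed
    then show "least_const N p v \<le> C + ennreal e"
      unfolding least_const_def by (intro Inf_lower) auto
  qed
qed simp

text \<open>The infimum is attained on functions of finite norm. At norm 0 any admissible constant
  forces \<open>N f = 0\<close>, and finiteness of the infimum supplies one; otherwise one divides
  by the norm.\<close>

lemma least_const_bound: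
  assumes fin: "least_const N p v < top" and f: "f \<in> Mplus" "wnorm p v f < top"
  shows "N f \<le> least_const N p v * wnorm p v f"
proof (cases "wnorm p v f = 0")
  case True
  obtain C where "\<forall>f\<in>Mplus. N f \<le> C * wnorm p v f"
    using fin unfolding least_const_def by (auto simp: Inf_less_iff)
  then show ?thesis using f True by force
next
  case False
  have "N f / wnorm p v f \<le> least_const N p v"
    unfolding least_const_def
  proof (rule Inf_greatest)
    fix C assume "C \<in> {C. \<forall>f\<in>Mplus. N f \<le> C * wnorm p v f}"
    then have "N f \<le> C * wnorm p v f" using f by auto
    then have "N f / wnorm p v f \<le> C * wnorm p v f / wnorm p v f"
      by (rule divide_right_mono_ennreal)
    also have "\<dots> = C"
      using False f by (simp add: ennreal_mult_divide_eq)
    finally show "N f / wnorm p v f \<le> C" .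
  qed
  then have "N f / wnorm p v f * wnorm p v f \<le> least_const N p v * wnorm p v f"
    by (rule mult_right_mono) simp
  then show ?thesis
    using False f by (simp add: ennreal_divide_times ennreal_divide_self)
qed

lemma least_const_mono:
  assumes "\<And>f. f \<in> Mplus \<Longrightarrow> N f \<le> ennreal c * N' f" "0 < c"
  shows "least_const N p v \<le> ennreal c * least_const N' p v"
proof (cases "least_const N' p v = top")
  case True
  then show ?thesis using assms(2) by (simp add: ennreal_mult_top)
next
  case False
  show ?thesis
  proof (rule least_const_le)
    fix f assume f: "f \<in> Mplus" "wnorm p v f < top"
    have "N f \<le> ennreal c * N' f" using assms f by blast
    also have "\<dots> \<le> ennreal c * (least_const N' p v * wnorm p v f)"
      using f False by (intro mult_left_mono least_const_bound) (auto simp: less_top)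
    finally show "N f \<le> ennreal c * least_const N' p v * wnorm p v f"
      by (simp add: mult.assoc)
  qed
qed

text \<open>Half of a positive finite least constant is strictly smaller, hence not admissible; a
  function witnessing this can have neither norm 0 nor norm top.\<close>

lemma least_const_near_extremal:
  assumes "0 < least_const N p v" "least_const N p v < top"
  obtains f where "f \<in> Mplus" "0 < wnorm p v f" "wnorm p v f < top"
    "least_const N p v / 2 * wnorm p v f \<le> N f"
proof -
  let ?L = "least_const N p v"
  have "?L / 2 < ?L"
    using assms by (cases ?L) (auto simp: ennreal_divide_numeral ennreal_less_iff)
  then have "?L / 2 \<notin> {C. \<forall>f\<in>Mplus. N f \<le> C * wnorm p v f}"
    unfolding least_const_def by (meson Inf_lower not_less)
  then obtain f where f: "f \<in> Mplus" "\<not> N f \<le> ?L / 2 * wnorm p v f" by auto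
  have pos: "?L / 2 \<noteq> 0" using assms by (auto simp: ennreal_divide_eq_0_iff)
  have fin: "wnorm p v f < top"
    using f pos by (auto simp: less_top[symmetric] ennreal_mult_top)
  have "wnorm p v f \<noteq> 0"
    using least_const_bound[OF assms(2) f(1) fin] f(2) by auto
  with f fin show ?thesis by (intro that[of f]) (auto simp: zero_less_iff_neq_zero)
qed

subsection \<open>The unweighted \<open>L\<^sup>q\<close> functional\<close>

text \<open>Kernel, weight and indicator of the domain will all be put into the argument, so that
  one functional covers finite q and q = top.\<close>

definition Lq :: "ennreal \<Rightarrow> (real \<Rightarrow> ennreal) \<Rightarrow> ennreal" where
  "Lq q g = (if q = top then esssup lebesgue g
     else (\<integral>\<^sup>+y. g y powe enn2real q \<partial>lebesgue) powe (1 / enn2real q))"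

text \<open>The factor 2 is the q-th root of the constant of \<open>powe_add_le\<close> at exponent
  q; the other factor is the constant at exponent 1 / q.\<close>

definition quasi_const :: "ennreal \<Rightarrow> real" where
  "quasi_const q = (if q = top then 1 else 2 * 2 powr (1 / enn2real q))"

definition qroot :: "ennreal \<Rightarrow> ennreal \<Rightarrow> ennreal" where
  "qroot q x = (if q = top then x else x powe (1 / enn2real q))"

lemma enn2real_pos: "0 < q \<Longrightarrow> q \<noteq> top \<Longrightarrow> 0 < enn2real q"
  by (simp add: enn2real_positive_iff less_top)

lemma quasi_const_ge_1: "1 \<le> quasi_const q"
proof -
  have "1 \<le> 2 powr (1 / enn2real q)" by (intro ge_one_powr_ge_zero) auto
  then show ?thesis by (auto simp: quasi_const_def)
qed

lemma Lq_mono_AE: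
  assumes "0 < q" "g \<in> borel_measurable lebesgue" "AE y in lebesgue. g y \<le> h y"
  shows "Lq q g \<le> Lq q h"
proof (cases "q = top")
  case True
  then show ?thesis using assms by (simp add: Lq_def esssup_AE_mono)
next
  case False
  have "0 < enn2real q" by (rule enn2real_pos[OF assms(1) False])
  then show ?thesis using assms False
    by (auto simp: Lq_def intro!: powe_mono nn_integral_mono_AE)
qed

lemma Lq_mono:
  assumes "0 < q" "g \<in> borel_measurable lebesgue" "\<And>y. g y \<le> h y"
  shows "Lq q g \<le> Lq q h"
  using assms by (intro Lq_mono_AE) auto

lemma Lq_cmult:
  assumes q: "0 < q" and g [measurable]: "g \<in> borel_measurable lebesgue"
  shows "Lq q (\<lambda>y. c * g y) = c * Lq q g"
proof (cases "q = top")
  case True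
  have le: "esssup lebesgue (\<lambda>y. c * h y) \<le> c * esssup lebesgue h"
    if [measurable]: "h \<in> borel_measurable lebesgue" for c and h :: "real \<Rightarrow> ennreal"
    using esssup_AE[of h lebesgue]
    by (intro esssup_I) (auto elim!: eventually_mono intro: mult_left_mono)
  consider "c = 0" | "c \<noteq> 0" "c \<noteq> top" | "c = top" by blast
  then have "c * esssup lebesgue g \<le> esssup lebesgue (\<lambda>y. c * g y)"
  proof cases
    case 2
    have eq: "(\<lambda>y. inverse c * (c * g y)) = g"
      using 2 by (auto simp: fun_eq_iff mult.assoc[symmetric] ennreal_inverse_mult
          divide_ennreal_def[symmetric] ennreal_divide_self less_top mult.commute)
    have "c * esssup lebesgue g \<le> c * (inverse c * esssup lebesgue (\<lambda>y. c * g y))"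
      using le[of "\<lambda>y. c * g y" "inverse c"] eq by (intro mult_left_mono) auto
    also have "\<dots> = esssup lebesgue (\<lambda>y. c * g y)"
      using 2 by (simp add: mult.assoc[symmetric] divide_ennreal_def[symmetric] ennreal_divide_self less_top)
    finally show ?thesis .
  next
    case 3
    show ?thesis
    proof (cases "esssup lebesgue (\<lambda>y. c * g y) = top")
      case False
      \<comment> \<open>With c = top, a finite essential supremum of the product forces g to vanish
        almost everywhere, since top times any positive value is top.\<close>
      have "AE y in lebesgue. c * g y \<le> esssup lebesgue (\<lambda>y. c * g y)"
        by (rule esssup_AE)
      then have "AE y in lebesgue. g y \<le> 0"
      proof eventually_elim
        case (elim y)
        then have "c * g y \<noteq> top" using False by (auto simp: top_unique)
        then show ?case using 3 by (auto simp: ennreal_top_mult split: if_splits)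
      qed
      then have "esssup lebesgue g \<le> 0" by (intro esssup_I) auto
      then show ?thesis by simp
    qed simp
  qed simp
  with le[of g c] True show ?thesis by (simp add: Lq_def antisym)
next
  case False
  have a: "0 < enn2real q" by (rule enn2real_pos[OF q False])
  have "(\<integral>\<^sup>+y. (c * g y) powe enn2real q \<partial>lebesgue)
      = c powe enn2real q * (\<integral>\<^sup>+y. g y powe enn2real q \<partial>lebesgue)"
    by (simp add: powe_mult nn_integral_cmult)
  then show ?thesis using a False by (simp add: Lq_def powe_mult)
qed

lemma Lq_0 [simp]: "0 < q \<Longrightarrow> Lq q (\<lambda>y. 0) = 0"
  using Lq_cmult[of q "\<lambda>y. 0" 0] by simp

lemma Lq_add:
  assumes q: "0 < q" and [measurable]: "g \<in> borel_measurable lebesgue" "h \<in> borel_measurable lebesgue"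
  shows "Lq q (\<lambda>y. g y + h y) \<le> ennreal (quasi_const q) * (Lq q g + Lq q h)"
proof (cases "q = top")
  case True
  have "esssup lebesgue (\<lambda>y. g y + h y) \<le> esssup lebesgue g + esssup lebesgue h"
    using esssup_AE[of g lebesgue] esssup_AE[of h lebesgue]
    by (intro esssup_I) (auto intro: add_mono)
  then show ?thesis using True by (simp add: Lq_def quasi_const_def)
next
  case False
  let ?a = "enn2real q"
  have a: "0 < ?a" by (rule enn2real_pos[OF q False])
  let ?G = "\<integral>\<^sup>+y. g y powe ?a \<partial>lebesgue" and ?H = "\<integral>\<^sup>+y. h y powe ?a \<partial>lebesgue"
  have "(\<integral>\<^sup>+y. (g y + h y) powe ?a \<partial>lebesgue)
      \<le> (\<integral>\<^sup>+y. ennreal (2 powr ?a) * (g y powe ?a + h y powe ?a) \<partial>lebesgue)"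
    by (intro nn_integral_mono powe_add_le a)
  also have "\<dots> = ennreal (2 powr ?a) * (?G + ?H)"
    by (simp add: nn_integral_cmult nn_integral_add)
  finally have "Lq q (\<lambda>y. g y + h y) \<le> (ennreal (2 powr ?a) * (?G + ?H)) powe (1 / ?a)"
    using a False by (simp add: Lq_def powe_mono)
  also have "\<dots> = 2 * (?G + ?H) powe (1 / ?a)"
    using a by (simp add: powe_mult powe_ennreal powr_powr)
  also have "\<dots> \<le> 2 * (ennreal (2 powr (1 / ?a)) * (?G powe (1 / ?a) + ?H powe (1 / ?a)))"
    using a by (intro mult_left_mono powe_add_le) auto
  also have "\<dots> = ennreal (quasi_const q) * (Lq q g + Lq q h)"
    using False by (simp add: Lq_def quasi_const_def ennreal_mult mult.assoc)
  finally show ?thesis .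
qed

text \<open>Monotone convergence for finite q; for q = top the countably many exceptional null sets
  are united.\<close>

lemma Lq_SUP_le:
  assumes q: "0 < q" and [measurable]: "\<And>n::nat. f n \<in> borel_measurable lebesgue" and inc: "incseq f"
  shows "Lq q (\<lambda>y. SUP n. f n y) \<le> (SUP n. Lq q (f n))"
proof (cases "q = top")
  case True
  have "AE y in lebesgue. \<forall>n. f n y \<le> esssup lebesgue (f n)"
    by (simp add: AE_all_countable esssup_AE)
  then have "AE y in lebesgue. (SUP n. f n y) \<le> (SUP n. esssup lebesgue (f n))"
    by eventually_elim (auto intro!: SUP_mono)
  then have "esssup lebesgue (\<lambda>y. SUP n. f n y) \<le> (SUP n. esssup lebesgue (f n))"
    by (intro esssup_I) auto
  then show ?thesis using True by (simp add: Lq_def)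
next
  case False
  have a: "0 < enn2real q" by (rule enn2real_pos[OF q False])
  have "(\<integral>\<^sup>+y. (SUP n. f n y) powe enn2real q \<partial>lebesgue)
      = (\<integral>\<^sup>+y. (SUP n. f n y powe enn2real q) \<partial>lebesgue)"
    using a by (simp add: powe_SUP)
  also have "\<dots> = (SUP n. \<integral>\<^sup>+y. f n y powe enn2real q \<partial>lebesgue)"
    using a inc by (intro nn_integral_monotone_convergence_SUP)
      (auto simp: incseq_def le_fun_def intro!: powe_mono)
  finally show ?thesis using a False by (simp add: Lq_def powe_SUP)
qed

lemma qroot_mono: "0 < q \<Longrightarrow> x \<le> y \<Longrightarrow> qroot q x \<le> qroot q y"
  by (simp add: qroot_def powe_mono enn2real_pos)

lemma qroot_powe: "0 < q \<Longrightarrow> q \<noteq> top \<Longrightarrow> qroot q x powe enn2real q = x"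
  by (simp add: qroot_def enn2real_pos)

lemma borel_measurable_qroot [measurable]:
  "f \<in> borel_measurable M \<Longrightarrow> (\<lambda>x. qroot q (f x)) \<in> borel_measurable M"
  unfolding qroot_def by (cases "q = top") auto

lemma powe_indicator: "(indicator A x * y) powe a = indicator A x * y powe a"
  by (auto split: split_indicator)

text \<open>Extension by 0 is harmless because 0 is the bottom element. If g is not measurable on A,
  neither is its extension, and both sides are top by convention.\<close>

lemma esssup_lebesgue_on:
  assumes A: "A \<in> sets lebesgue"
  shows "esssup (lebesgue_on A) g = esssup lebesgue (\<lambda>x. indicator A x * g x :: ennreal)"
proof (cases "g \<in> borel_measurable (lebesgue_on A)")
  case True
  then have m: "(\<lambda>x. indicator A x * g x) \<in> borel_measurable lebesgue"
    using A by (simp add: borel_measurable_restrict_space_iff_ennreal mult.commute)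
  have "(AE x in lebesgue_on A. g x \<le> z) \<longleftrightarrow> (AE x in lebesgue. indicator A x * g x \<le> z)" for z
    using A by (auto simp: AE_restrict_space_iff split: split_indicator intro!: AE_cong)
  then show ?thesis using True m by (simp add: esssup_eq_AE)
next
  case False
  then have "(\<lambda>x. indicator A x * g x) \<notin> borel_measurable lebesgue"
    using A by (simp add: borel_measurable_restrict_space_iff_ennreal mult.commute)
  with False show ?thesis by (simp add: esssup_non_measurable)
qed

lemma qroot_integral_eq_Lq:
  assumes "0 < q" "q \<noteq> top"
    and "\<And>y. y \<in> A \<Longrightarrow> g y = indicator B y * h y powe enn2real q"
    and "\<And>y. y \<in> B \<Longrightarrow> y \<in> A"
  shows "(\<integral>\<^sup>+y\<in>A. g y \<partial>lebesgue) powe (1 / enn2real q) = Lq q (\<lambda>y. indicator B y * h y)"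
proof -
  have "(\<integral>\<^sup>+y\<in>A. g y \<partial>lebesgue) = (\<integral>\<^sup>+y. (indicator B y * h y) powe enn2real q \<partial>lebesgue)"
    using assms by (intro nn_integral_cong) (auto simp: powe_indicator split: split_indicator)
  then show ?thesis using assms by (simp add: Lq_def)
qed

lemma ess_sup_on_eq_Lq:
  assumes "A \<in> sets lebesgue"
    and "\<And>y. y \<in> A \<Longrightarrow> g y = indicator B y * h y"
    and "\<And>y. y \<in> B \<Longrightarrow> y \<in> A"
  shows "ess_sup_on A g = Lq top (\<lambda>y. indicator B y * h y)"
proof -
  have "(\<lambda>x. indicator A x * g x) = (\<lambda>y. indicator B y * h y)"
    using assms by (auto simp: fun_eq_iff split: split_indicator)
  then show ?thesis
    using assms by (simp add: ess_sup_on_def esssup_lebesgue_on Lq_def)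
qed

subsection \<open>Tails\<close>

lemma Mplus_iff: "f \<in> Mplus \<longleftrightarrow> (\<lambda>x. indicator {0..} x * f x) \<in> borel_measurable lebesgue"
  by (simp add: Mplus_def borel_measurable_restrict_space_iff_ennreal mult.commute)

lemma tail_antimono: "x \<le> y \<Longrightarrow> tail f y \<le> tail f x"
  unfolding tail_def by (intro nn_integral_mono) (auto split: split_indicator)

lemma tail_mono: "(\<And>z. f z \<le> g z) \<Longrightarrow> tail f x \<le> tail g x"
  unfolding tail_def by (intro nn_integral_mono mult_right_mono) auto

lemma borel_measurable_antimono_ennreal:
  fixes F :: "real \<Rightarrow> ennreal"
  assumes "\<And>x y. x \<le> y \<Longrightarrow> F y \<le> F x"
  shows "F \<in> borel_measurable borel"
proof (rule borel_measurableI_greater)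
  fix c :: ennreal
  have "is_interval {x. c < F x}"
    unfolding is_interval_1 using assms less_le_trans by blast
  then have "{x. c < F x} \<in> sets borel"
    by (rule real_interval_borel_measurable)
  then show "{x \<in> space borel. c < F x} \<in> sets borel" by simp
qed

text \<open>Tails are antitone, and superlevel sets of antitone functions are intervals; f itself
  may be arbitrary.\<close>

lemma borel_measurable_tail [measurable]: "tail f \<in> borel_measurable lebesgue"
proof -
  have "tail f \<in> borel_measurable borel"
    by (rule borel_measurable_antimono_ennreal) (rule tail_antimono)
  then show ?thesis by (simp add: measurable_completion)
qed

lemma tail_split_le:
  assumes f: "f \<in> Mplus" and "0 \<le> y" "y \<le> c"
  shows "tail f y \<le> tail (\<lambda>z. f z * indicator {..c} z) y + tail f c"
proof -
  define F where "F = (\<lambda>x. indicator {0..} x * f x)"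
  have [measurable]: "F \<in> borel_measurable lebesgue"
    using f by (simp add: Mplus_iff F_def)
  have eq: "tail g x = (\<integral>\<^sup>+z. (indicator {0..} z * g z) * indicator {x..} z \<partial>lebesgue)"
    if "0 \<le> x" for x g
    unfolding tail_def using that by (intro nn_integral_cong) (auto split: split_indicator)
  have "tail f y \<le> (\<integral>\<^sup>+z. F z * indicator {..c} z * indicator {y..} z + F z * indicator {c..} z \<partial>lebesgue)"
    unfolding eq[OF assms(2)] F_def using assms
    by (intro nn_integral_mono) (auto split: split_indicator)
  also have "\<dots> = (\<integral>\<^sup>+z. F z * indicator {..c} z * indicator {y..} z \<partial>lebesgue)
     + (\<integral>\<^sup>+z. F z * indicator {c..} z \<partial>lebesgue)"
    by (intro nn_integral_add borel_measurable_times_ennreal borel_measurable_indicator) auto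
  also have "\<dots> = tail (\<lambda>z. f z * indicator {..c} z) y + tail f c"
    using assms by (subst (1 2) eq) (auto simp: mult.assoc F_def)
  finally show ?thesis .
qed

lemma tail_truncate:
  assumes "a < y"
  shows "tail (\<lambda>z. f z * indicator {a<..c} z) y = tail (\<lambda>z. f z * indicator {..c} z) y"
  unfolding tail_def using assms by (intro nn_integral_cong) (auto split: split_indicator)

lemma half_ennreal_le: "x / 2 \<le> y \<longleftrightarrow> x \<le> 2 * (y::ennreal)"
  by (cases x; cases y) (auto simp: ennreal_divide_numeral numeral_mult_ennreal ennreal_top_divide top_unique ennreal_mult_top)

lemma less_half_ennreal: "y < x / 2 \<longleftrightarrow> 2 * y < (x::ennreal)"
  using half_ennreal_le[of x y] by (simp add: not_less[symmetric])

lemma AE_neq_0: "AE x in lebesgue. x \<noteq> (0::real)"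
  by (rule AE_I[where N="{0}"]) auto

subsection \<open>Dyadic discretisation of a weight\<close>

locale tail_weight =
  fixes u :: "real \<Rightarrow> ennreal"
  assumes u_Mplus: "u \<in> Mplus"
    and tail_pos: "\<And>t. 0 < t \<Longrightarrow> 0 < tail u t"
    and tail_fin: "\<And>t. 0 < t \<Longrightarrow> tail u t < top"
begin

abbreviation "U \<equiv> tail u"

text \<open>The values of u at negative points are arbitrary; cutting them off gives a function that
  is measurable on the whole line.\<close>

definition u0 :: "real \<Rightarrow> ennreal" where "u0 x = indicator {0..} x * u x"

lemma u0_measurable [measurable]: "u0 \<in> borel_measurable lebesgue"
  using u_Mplus by (simp add: Mplus_iff u0_def[abs_def])

lemma U_eq: "0 \<le> x \<Longrightarrow> U x = (\<integral>\<^sup>+z. u0 z * indicator {x..} z \<partial>lebesgue)"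
  unfolding tail_def u0_def by (intro nn_integral_cong) (auto split: split_indicator)

lemma set_integral_measurable:
  "A \<in> sets lebesgue \<Longrightarrow> (\<lambda>z. u0 z * indicator A z) \<in> borel_measurable lebesgue"
  by (intro borel_measurable_times_ennreal borel_measurable_indicator) auto

text \<open>Dominated convergence, with the integrand on [x / 2, top) as majorant; the tail from 0
  may be infinite and cannot serve.\<close>

lemma U_tendsto:
  assumes x: "0 < x" and y: "(y \<longlongrightarrow> x) sequentially"
  shows "((\<lambda>n. U (y n)) \<longlongrightarrow> U x) sequentially"
proof -
  obtain N where N: "\<And>n. N \<le> n \<Longrightarrow> x / 2 < y n"
    using order_tendstoD(1)[OF y, of "x / 2"] x by (auto simp: eventually_sequentially)
  have "(\<lambda>n. \<integral>\<^sup>+z. u0 z * indicator {y (n + N)..} z \<partial>lebesgue)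
      \<longlonglongrightarrow> (\<integral>\<^sup>+z. u0 z * indicator {x..} z \<partial>lebesgue)"
  proof (rule nn_integral_dominated_convergence)
    show "(\<integral>\<^sup>+z. u0 z * indicator {x/2..} z \<partial>lebesgue) < \<infinity>"
      using U_eq[of "x/2"] tail_fin[of "x/2"] x by simp
    show "AE z in lebesgue. u0 z * indicator {y (n + N)..} z \<le> u0 z * indicator {x/2..} z" for n
      using N[of "n + N"] by (intro AE_I2 mult_left_mono) (auto split: split_indicator)
    have "AE z in lebesgue. z \<noteq> x"
      by (rule AE_I[where N="{x}"]) auto
    then show "AE z in lebesgue. (\<lambda>n. u0 z * indicator {y (n + N)..} z) \<longlonglongrightarrow> u0 z * indicator {x..} z"
    proof eventually_elim
      case (elim z)
      have y': "(\<lambda>n. y (n + N)) \<longlonglongrightarrow> x" using y by (rule LIMSEQ_ignore_initial_segment)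
      have "eventually (\<lambda>n. indicator {y (n + N)..} z = (indicator {x..} z :: ennreal)) sequentially"
      proof (cases "z < x")
        case True
        then show ?thesis using order_tendstoD(1)[OF y' True]
          by (auto elim!: eventually_mono split: split_indicator)
      next
        case False
        then have "x < z" using elim by auto
        then show ?thesis using order_tendstoD(2)[OF y', of z]
          by (auto elim!: eventually_mono split: split_indicator)
      qed
      then show ?case
        by (intro tendsto_eventually) (auto elim!: eventually_mono)
    qed
  qed (auto intro!: set_integral_measurable)
  moreover have "U (y (n + N)) = (\<integral>\<^sup>+z. u0 z * indicator {y (n + N)..} z \<partial>lebesgue)" for n
    using N[of "n + N"] x by (intro U_eq) auto
  ultimately have "(\<lambda>n. U (y (n + N))) \<longlonglongrightarrow> U x" using U_eq[of x] x by simp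
  then show ?thesis by (rule LIMSEQ_offset)
qed

lemma U_cont: "0 < x \<Longrightarrow> (U \<longlongrightarrow> U x) (at x)"
  unfolding tendsto_at_iff_sequentially comp_def by (auto intro: U_tendsto)

lemma U_small:
  assumes "0 < c"
  obtains z where "0 < z" "\<And>y. z \<le> y \<Longrightarrow> U y < c"
proof -
  have "(\<lambda>n. \<integral>\<^sup>+z. u0 z * indicator {real (Suc n)..} z \<partial>lebesgue) \<longlonglongrightarrow> (\<integral>\<^sup>+z. 0 \<partial>(lebesgue :: real measure))"
  proof (rule nn_integral_dominated_convergence)
    show "(\<integral>\<^sup>+z. u0 z * indicator {1..} z \<partial>lebesgue) < \<infinity>"
      using U_eq[of 1] tail_fin[of 1] by simp
    show "AE z in lebesgue. u0 z * indicator {real (Suc n)..} z \<le> u0 z * indicator {1..} z" for n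
      by (intro AE_I2 mult_left_mono) (auto split: split_indicator)
    show "AE z in lebesgue. (\<lambda>n. u0 z * indicator {real (Suc n)..} z) \<longlonglongrightarrow> 0"
    proof (rule AE_I2)
      fix z :: real
      obtain n0 where "z < real n0" using reals_Archimedean2 by auto
      then have "eventually (\<lambda>n. u0 z * indicator {real (Suc n)..} z = 0) sequentially"
        unfolding eventually_sequentially by (intro exI[of _ n0]) (auto split: split_indicator)
      then show "(\<lambda>n. u0 z * indicator {real (Suc n)..} z) \<longlonglongrightarrow> 0"
        by (rule tendsto_eventually)
    qed
  qed (auto intro!: set_integral_measurable)
  then have "(\<lambda>n. U (real (Suc n))) \<longlonglongrightarrow> 0"
    by (simp add: U_eq)
  from order_tendstoD(2)[OF this assms] obtain n where n: "U (real (Suc n)) < c"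
    by (auto simp: eventually_sequentially)
  show ?thesis
  proof (rule that)
    show "0 < real (Suc n)" by simp
    show "U y < c" if "real (Suc n) \<le> y" for y
      using tail_antimono[OF that] n by (rule le_less_trans)
  qed
qed

text \<open>The set is bounded because U tends to 0, and continuity of U at positive points forces
  the supremum to attain the level. Both \<open>zeta\<close> and \<open>zeta_inv\<close> are suprema
  of this kind.\<close>

lemma superlevel_Sup:
  assumes c: "0 < c" "c < top" and ne: "0 < x" "c \<le> U x"
  shows "x \<le> Sup0 {y. 0 < y \<and> c \<le> U y}" "U (Sup0 {y. 0 < y \<and> c \<le> U y}) = c"
proof -
  let ?S = "{y. 0 < y \<and> c \<le> U y}"
  obtain b where b: "0 < b" "\<And>y. b \<le> y \<Longrightarrow> U y < c" using U_small[OF c(1)] by blast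
  have bdd: "bdd_above ?S"
    using b by (intro bdd_aboveI[of _ b]) (auto simp: not_less[symmetric] intro: ccontr)
  have S0: "Sup0 ?S = Sup ?S" using ne by (auto simp: Sup0_def)
  let ?z = "Sup ?S"
  have xz: "x \<le> ?z" using ne bdd by (intro cSup_upper) auto
  then show "x \<le> Sup0 ?S" using S0 by simp
  have z: "0 < ?z" using xz ne by simp
  have "c \<le> U ?z"
  proof (rule ccontr)
    assume "\<not> c \<le> U ?z"
    then have "eventually (\<lambda>y. U y < c) (at ?z)"
      using U_cont[OF z] by (intro order_tendstoD) auto
    then obtain d where d: "0 < d" "\<And>y. y \<noteq> ?z \<Longrightarrow> dist y ?z < d \<Longrightarrow> U y < c"
      by (auto simp: eventually_at)
    obtain y where y: "y \<in> ?S" "?z - d < y"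
      using less_cSupE[of "?z - d" ?S] d(1) ne by auto
    have "y \<le> ?z" using y bdd by (intro cSup_upper) auto
    then show False using y d(2)[of y] \<open>\<not> c \<le> U ?z\<close> by (cases "y = ?z") (auto simp: dist_real_def)
  qed
  moreover have "U ?z \<le> c"
  proof (rule ccontr)
    assume "\<not> U ?z \<le> c"
    then have "eventually (\<lambda>y. c < U y) (at ?z)"
      using U_cont[OF z] by (intro order_tendstoD) auto
    then obtain d where d: "0 < d" "\<And>y. y \<noteq> ?z \<Longrightarrow> dist y ?z < d \<Longrightarrow> c < U y"
      by (auto simp: eventually_at)
    have "c < U (?z + d / 2)" using d by (intro d(2)) (auto simp: dist_real_def)
    then have "?z + d / 2 \<le> ?z" using z d bdd by (intro cSup_upper) auto
    then show False using d by simp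
  qed
  ultimately show "U (Sup0 ?S) = c" using S0 by simp
qed

lemma le_zeta: assumes "0 < x" shows "x \<le> zeta u x" and tail_zeta: "U (zeta u x) = U x / 2"
proof -
  have "U x / 2 \<le> U x"
    using tail_fin[OF assms] by (cases "U x") (auto simp: ennreal_divide_numeral)
  moreover have "0 < U x / 2" "U x / 2 < top"
    using tail_pos[OF assms] tail_fin[OF assms]
    by (auto simp: ennreal_zero_less_divide ennreal_divide_eq_top_iff less_top[symmetric])
  ultimately show "x \<le> zeta u x" "U (zeta u x) = U x / 2"
    using superlevel_Sup[of "U x / 2" x] assms unfolding zeta_def by auto
qed

text \<open>The second alternative, with the default value 0, occurs when the total mass is too
  small for the tail to double.\<close>

lemma zeta_inv_cases:
  assumes x: "0 < x"
  obtains "0 < zeta_inv u x" "U (zeta_inv u x) = 2 * U x"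
    | "zeta_inv u x = 0" "\<And>y. 0 < y \<Longrightarrow> U y < 2 * U x"
proof (cases "\<exists>y. 0 < y \<and> 2 * U x \<le> U y")
  case True
  then obtain y where y: "0 < y" "2 * U x \<le> U y" by auto
  have "0 < 2 * U x" "2 * U x < top"
    using tail_pos[OF x] tail_fin[OF x] by (auto simp: ennreal_mult_less_top ennreal_zero_less_mult_iff)
  from superlevel_Sup[OF this y] y show ?thesis
    by (intro that(1)) (auto simp: zeta_inv_def)
next
  case False
  then have "{y. 0 < y \<and> 2 * U x \<le> U y} = {}" by auto
  with False show ?thesis
    by (intro that(2)) (auto simp: zeta_inv_def Sup0_def not_le)
qed

lemma U_0_pos: "0 < U 0"
  using tail_pos[of 1] tail_antimono[of 0 1 u] by auto

lemma zeta_inv_0 [simp]: "zeta_inv u 0 = 0"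
proof -
  have "\<not> 2 * U 0 \<le> U y" if "0 < y" for y
  proof
    assume *: "2 * U 0 \<le> U y"
    then have "U 0 < top" using tail_fin[OF that] by (auto simp: less_top[symmetric] ennreal_mult_top top_unique)
    moreover have "2 * U 0 \<le> U 0" using * tail_antimono[of 0 y u] that by auto
    ultimately show False using U_0_pos
      by (cases "U 0") (auto simp: numeral_mult_ennreal)
  qed
  then show ?thesis by (auto simp: zeta_inv_def Sup0_def)
qed

text \<open>
  The levels are scaled by \<open>\<integral>\<^sub>0\<^sup>\<infinity> u\<close> if that is finite, so that every non-degenerate block carries
  the full dyadic mass, including the first one.
\<close>

definition lam :: real where "lam = (if U 0 = top then 1 else enn2real (U 0))"

definition lev :: "int \<Rightarrow> ennreal" where "lev k = ennreal (lam * 2 powr (- of_int k))"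

text \<open>The strict inequality makes \<open>X k\<close> the first point at which U has dropped to
  \<open>lev k\<close>. Thus \<open>blk k\<close> is exactly the set of positive points where U lies
  above \<open>lev (k + 1)\<close> and not above \<open>lev k\<close>, with flat pieces of U never
  divided between blocks.\<close>

definition X :: "int \<Rightarrow> real" where "X k = Sup0 {y. 0 < y \<and> lev k < U y}"

definition blk :: "int \<Rightarrow> real set" where "blk k = {x. 0 < x \<and> X k \<le> x \<and> x < X (k + 1)}"

lemma lam_pos: "0 < lam"
  using U_0_pos by (auto simp: lam_def enn2real_positive_iff less_top)

lemma lev_pos [simp]: "0 < lev k" and lev_fin [simp]: "lev k < top"
  using lam_pos by (auto simp: lev_def)

lemma lev_ne [simp]: "lev k \<noteq> 0" "lev k \<noteq> top"
  using lev_pos[of k] lev_fin[of k] by (auto simp del: lev_pos lev_fin)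

lemma lev_shift: "lev (k - int i) = 2 ^ i * lev k"
proof -
  have "2 powr (- of_int (k - int i)) = 2 ^ i * 2 powr (- of_int k :: real)"
    by (simp add: powr_diff powr_minus powr_realpow[symmetric] field_simps powr_add[symmetric])
  moreover have "(2::ennreal) ^ i = ennreal (2 ^ i)"
    by (simp add: ennreal_power[symmetric])
  ultimately show ?thesis
    using lam_pos by (simp add: lev_def ennreal_mult[symmetric] mult.left_commute mult.commute)
qed

lemma lev_Suc: "lev k = 2 * lev (k + 1)"
  using lev_shift[of "k + 1" 1] by simp

lemma lev_antimono: "j \<le> k \<Longrightarrow> lev k \<le> lev j"
  using lam_pos by (auto simp: lev_def intro!: ennreal_leI mult_left_mono)

lemma X_bdd: "bdd_above {y. 0 < y \<and> lev k < U y}"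
proof -
  obtain b where b: "0 < b" "\<And>y. b \<le> y \<Longrightarrow> U y < lev k" using U_small[OF lev_pos] by blast
  then show ?thesis
    by (intro bdd_aboveI[of _ b]) (metis (mono_tags, lifting) mem_Collect_eq nle_le order_less_asym)
qed

lemma X_nonneg [simp]: "0 \<le> X k"
proof (cases "{y. 0 < y \<and> lev k < U y} = {}")
  case False
  then obtain y where "0 < y" "lev k < U y" by auto
  then have "y \<le> Sup {y. 0 < y \<and> lev k < U y}" by (intro cSup_upper X_bdd) auto
  with \<open>0 < y\<close> False show ?thesis by (simp add: X_def Sup0_def)
qed (auto simp: X_def Sup0_def)

text \<open>For the converse direction, continuity preserves the strict inequality slightly to the
  right of x, which puts x strictly below the supremum.\<close>

lemma less_X_iff:
  assumes x: "0 < x"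
  shows "x < X k \<longleftrightarrow> lev k < U x"
proof
  assume *: "x < X k"
  have ne: "{y. 0 < y \<and> lev k < U y} \<noteq> {}"
  proof
    assume "{y. 0 < y \<and> lev k < U y} = {}"
    then have "X k = 0" by (simp only: X_def Sup0_def if_True simp_thms)
    then show False using * x by simp
  qed
  have "x < Sup {y. 0 < y \<and> lev k < U y}"
    using * ne by (simp only: X_def Sup0_def if_False)
  with ne obtain y where "0 < y" "lev k < U y" "x < y"
    using less_cSupE by blast
  then show "lev k < U x" using tail_antimono[of x y u] by auto
next
  assume *: "lev k < U x"
  then have "eventually (\<lambda>y. lev k < U y) (at x)"
    using U_cont[OF x] by (intro order_tendstoD) auto
  then obtain d where d: "0 < d" "\<And>y. y \<noteq> x \<Longrightarrow> dist y x < d \<Longrightarrow> lev k < U y"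
    by (auto simp: eventually_at)
  have y: "lev k < U (x + d / 2)" using d by (intro d(2)) (auto simp: dist_real_def)
  then have "x + d / 2 \<le> Sup {y. 0 < y \<and> lev k < U y}" using d x by (intro cSup_upper X_bdd) auto
  moreover have "X k = Sup {y. 0 < y \<and> lev k < U y}" using * x by (auto simp: X_def Sup0_def)
  ultimately show "x < X k" using d by simp
qed

lemma X_le_iff: "0 < x \<Longrightarrow> X k \<le> x \<longleftrightarrow> U x \<le> lev k"
  using less_X_iff[of x k] by (simp add: not_less[symmetric])

lemma X_mono: "j \<le> k \<Longrightarrow> X j \<le> X k"
proof (rule ccontr)
  assume jk: "j \<le> k" and "\<not> X j \<le> X k"
  then have *: "X k < X j" by simp
  define m where "m = (X k + X j) / 2"
  have m: "0 < m" "X k \<le> m" "m < X j" using * X_nonneg[of k] by (auto simp: m_def simp del: X_nonneg)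
  then have "U m \<le> lev k" "lev j < U m" by (auto simp: X_le_iff less_X_iff)
  then show False using lev_antimono[OF jk] by auto
qed

lemma U_X: assumes "0 < X k" shows "U (X k) = lev k"
proof (rule antisym)
  show "U (X k) \<le> lev k" using assms by (simp add: X_le_iff[symmetric])
  show "lev k \<le> U (X k)"
  proof (rule ccontr)
    assume "\<not> lev k \<le> U (X k)"
    then have "eventually (\<lambda>y. U y < lev k) (at (X k))"
      using U_cont[OF assms] by (intro order_tendstoD) auto
    then obtain d where d: "0 < d" "\<And>y. y \<noteq> X k \<Longrightarrow> dist y (X k) < d \<Longrightarrow> U y < lev k"
      by (auto simp: eventually_at)
    define y where "y = X k - min d (X k) / 2"
    have y: "0 < y" "y < X k" "dist y (X k) < d" using d(1) assms by (auto simp: y_def dist_real_def)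
    then have "lev k < U y" by (simp add: less_X_iff[symmetric])
    moreover have "U y < lev k" using y d(2)[of y] by auto
    ultimately show False by auto
  qed
qed

lemma X_strict: assumes "0 < X k" shows "X k < X (k + 1)"
proof -
  have "lev (k + 1) < 2 * lev (k + 1)"
    using lev_pos[of "k + 1"] lev_fin[of "k + 1"]
    by (cases "lev (k + 1)") (auto simp: numeral_mult_ennreal ennreal_less_iff simp del: lev_pos lev_fin)
  then show ?thesis using assms by (simp add: less_X_iff U_X lev_Suc[symmetric])
qed

lemma in_blk:
  assumes "0 < x"
  obtains k where "x \<in> blk k"
proof -
  obtain c where c: "U x = ennreal c" "0 < c"
    using tail_pos[OF assms] tail_fin[OF assms] by (cases "U x") auto
  \<comment> \<open>The solution of \<open>lam * 2 powr (- t) = c\<close>; its floor is the index of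
    the block containing x.\<close>
  define t where "t = log 2 (lam / c)"
  have Ux: "c = lam * 2 powr (- t)"
    using c lam_pos by (simp add: t_def powr_minus)
  have "X \<lfloor>t\<rfloor> \<le> x"
    unfolding X_le_iff[OF assms] c lev_def using lam_pos
    by (intro ennreal_leI) (auto simp: Ux)
  moreover have "- of_int \<lfloor>t\<rfloor> - 1 < - t" by linarith
  then have "x < X (\<lfloor>t\<rfloor> + 1)"
    unfolding less_X_iff[OF assms] c lev_def using lam_pos
    by (intro ennreal_lessI) (auto simp: Ux)
  ultimately show ?thesis using assms by (intro that[of "\<lfloor>t\<rfloor>"]) (auto simp: blk_def)
qed

lemma blk_unique: "x \<in> blk j \<Longrightarrow> x \<in> blk k \<Longrightarrow> j = k"
proof (rule ccontr)
  assume *: "x \<in> blk j" "x \<in> blk k" "j \<noteq> k"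
  have False if "j < k" "x \<in> blk j" "x \<in> blk k" for j k
    using that X_mono[of "j + 1" k] by (auto simp: blk_def)
  then show False using * by (metis linorder_neqE)
qed

lemma X_to_0:
  assumes "0 < y" obtains m where "X m \<le> y"
  using in_blk[OF assms] by (auto simp: blk_def)

lemma blk_U: assumes "x \<in> blk k" shows "U x \<le> lev k" "lev (k + 1) < U x"
  using assms by (auto simp: blk_def X_le_iff less_X_iff)

text \<open>Membership in a block depends on the value of U alone, and \<open>zeta\<close> halves
  that value; on flat pieces it is irrelevant which point the supremum selects.\<close>

lemma zeta_blk:
  assumes "x \<in> blk k" shows "zeta u x \<in> blk (k + 1)"
proof -
  have x: "0 < x" using assms by (simp add: blk_def)
  then have z: "0 < zeta u x" using le_zeta[OF x] by simp
  have "U x / 2 \<le> lev (k + 1)"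
    using blk_U(1)[OF assms] by (simp add: half_ennreal_le lev_Suc[symmetric])
  moreover have "lev (k + 2) < U x / 2"
    using blk_U(2)[OF assms] lev_Suc[of "k + 1"] by (simp add: less_half_ennreal add.commute)
  ultimately show ?thesis
    using z tail_zeta[OF x] by (simp add: blk_def X_le_iff less_X_iff add.assoc)
qed

text \<open>Doubling U lowers the block index by one. Where the tail cannot double, the default 0
  agrees with \<open>X (k - 1)\<close>, so the same bounds persist at the left end.\<close>

lemma zeta_inv_bounds:
  assumes "x \<in> blk k"
  shows "X (k - 1) \<le> zeta_inv u x" "zeta_inv u x \<le> X k" "0 < zeta_inv u x \<Longrightarrow> zeta_inv u x \<in> blk (k - 1)"
    "zeta_inv u x = 0 \<Longrightarrow> X (k - 1) = 0"
proof -
  have x: "0 < x" using assms by (simp add: blk_def)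
  have a: "2 * U x \<le> lev (k - 1)"
    using blk_U(1)[OF assms] lev_Suc[of "k - 1"] by (simp add: mult_left_mono)
  have b: "lev k < 2 * U x"
    using blk_U(2)[OF assms] lev_Suc[of k] by (simp add: ennreal_mult_strict_left_mono)
  have *: "(0 < zeta_inv u x \<and> zeta_inv u x \<in> blk (k - 1)) \<or> (zeta_inv u x = 0 \<and> X (k - 1) = 0)"
    using x
  proof (cases rule: zeta_inv_cases)
    case 1
    then show ?thesis using a b by (auto simp: blk_def X_le_iff less_X_iff)
  next
    case 2
    have "\<not> 0 < X (k - 1)"
    proof
      assume *: "0 < X (k - 1)"
      have "U (X (k - 1)) < lev (k - 1)" using 2(2)[OF *] a by (rule less_le_trans)
      then show False using U_X[OF *] by simp
    qed
    then show ?thesis using 2 X_nonneg[of "k - 1"] by auto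
  qed
  then show "X (k - 1) \<le> zeta_inv u x" "zeta_inv u x \<le> X k"
    "0 < zeta_inv u x \<Longrightarrow> zeta_inv u x \<in> blk (k - 1)" "zeta_inv u x = 0 \<Longrightarrow> X (k - 1) = 0"
    by (auto simp: blk_def)
qed

lemma zeta_inv2_bounds:
  assumes "x \<in> blk k"
  shows "X (k - 2) \<le> zeta_inv u (zeta_inv u x)" "zeta_inv u (zeta_inv u x) \<le> X (k - 1)"
proof -
  note z = zeta_inv_bounds[OF assms]
  have "X (k - 2) \<le> zeta_inv u (zeta_inv u x) \<and> zeta_inv u (zeta_inv u x) \<le> X (k - 1)"
  proof (cases "zeta_inv u x = 0")
    case True
    then show ?thesis using z(4) X_mono[of "k - 2" "k - 1"] by auto
  next
    case False
    then have "0 < zeta_inv u x" using z(1) X_nonneg[of "k - 1"] by linarith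
    from zeta_inv_bounds(1,2)[OF z(3)[OF this]] show ?thesis by simp
  qed
  then show "X (k - 2) \<le> zeta_inv u (zeta_inv u x)" "zeta_inv u (zeta_inv u x) \<le> X (k - 1)" by auto
qed

lemma blk_sets [measurable, simp]: "blk k \<in> sets lebesgue"
proof -
  have "blk k = {0<..} \<inter> {X k..<X (k + 1)}" by (auto simp: blk_def)
  then show ?thesis by simp
qed

lemma set_integral_Un:
  assumes [simp]: "A \<in> sets lebesgue" "B \<in> sets lebesgue" and "A \<inter> B = {}"
  shows "(\<integral>\<^sup>+z. u0 z * indicator (A \<union> B) z \<partial>lebesgue)
     = (\<integral>\<^sup>+z. u0 z * indicator A z \<partial>lebesgue) + (\<integral>\<^sup>+z. u0 z * indicator B z \<partial>lebesgue)"
proof -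
  have "(\<integral>\<^sup>+z. u0 z * indicator (A \<union> B) z \<partial>lebesgue)
      = (\<integral>\<^sup>+z. u0 z * indicator A z + u0 z * indicator B z \<partial>lebesgue)"
    using assms(3) by (intro nn_integral_cong) (auto split: split_indicator)
  then show ?thesis by (simp add: nn_integral_add set_integral_measurable)
qed

text \<open>Everything rests on \<open>U (X k) = lev k\<close>, as then the block carries the
  difference of two consecutive levels. The delicate case is \<open>X k = 0\<close>, the first
  non-degenerate block; there the scaling by \<open>lam\<close> is what makes the identity
  true.\<close>

lemma blk_mass:
  assumes "0 < X (k + 1)"
  shows "(\<integral>\<^sup>+z. u0 z * indicator (blk k) z \<partial>lebesgue) = lev (k + 1)"
proof -
  have top: "U (X k) = lev k"
  proof (cases "0 < X k")
    case True then show ?thesis by (rule U_X)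
  next
    case False
    then have X0: "X k = 0" using X_nonneg[of k] by linarith
    have Xk1: "lev (k + 1) < U (X (k + 1) / 2)" using assms by (simp add: less_X_iff[symmetric])
    have le: "U y \<le> lev k" if "0 < y" for y using X0 that by (simp add: X_le_iff[symmetric])
    have "(\<lambda>n. \<integral>\<^sup>+z. u0 z * indicator {inverse (real (Suc n))..} z \<partial>lebesgue)
      \<longlonglongrightarrow> (\<integral>\<^sup>+z. (SUP n. u0 z * indicator {inverse (real (Suc n))..} z) \<partial>lebesgue)"
    proof -
      have dec: "inverse (real (Suc n)) \<le> x" if "m \<le> n" "inverse (real (Suc m)) \<le> x" for m n x
        using that(1) by (intro order_trans[OF _ that(2)] le_imp_inverse_le) auto
      have inc: "u0 x * indicator {inverse (real (Suc m))..} x \<le> u0 x * indicator {inverse (real (Suc n))..} x"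
        if "m \<le> n" for m n x
        using dec[OF that, of x] by (intro mult_left_mono) (auto split: split_indicator)
      show ?thesis
        by (subst nn_integral_monotone_convergence_SUP)
          (auto simp: incseq_def le_fun_def simp del: of_nat_Suc
            intro!: LIMSEQ_SUP nn_integral_mono inc set_integral_measurable)
    qed
    moreover have "(\<integral>\<^sup>+z. (SUP n. u0 z * indicator {inverse (real (Suc n))..} z) \<partial>lebesgue) = U 0"
    proof -
      have "AE z in lebesgue. z \<noteq> (0::real)" by (rule AE_I[where N="{0}"]) auto
      then have "AE z in lebesgue. (SUP n. u0 z * indicator {inverse (real (Suc n))..} z) = u0 z * indicator {0..} z"
      proof eventually_elim
        case (elim z)
        have "(SUP n. u0 z * indicator {inverse (real (Suc n))..} z) = u0 z * (SUP n. indicator {inverse (real (Suc n))..} z)"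
          by (simp add: SUP_mult_left_ennreal)
        also have "(SUP n. indicator {inverse (real (Suc n))..} z) = (indicator {0..} z :: ennreal)"
        proof (cases "0 < z")
          case True
          then obtain n where "inverse (real (Suc n)) < z" using reals_Archimedean by auto
          then have "1 \<le> (SUP n. indicator {inverse (real (Suc n))..} z :: ennreal)"
            by (intro SUP_upper2[of n]) auto
          moreover have "(SUP n. indicator {inverse (real (Suc n))..} z :: ennreal) \<le> 1"
            by (intro SUP_least) (auto split: split_indicator)
          ultimately show ?thesis using True by simp
        next
          case False
          with elim have "z < 0" by simp
          then have "\<not> inverse (real (Suc n)) \<le> z" for n
            by (smt (verit) inverse_nonnegative_iff_nonnegative of_nat_0_le_iff)
          then show ?thesis using \<open>z < 0\<close> by (auto split: split_indicator)
        qed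
        finally show ?case .
      qed
      then have "(\<integral>\<^sup>+z. (SUP n. u0 z * indicator {inverse (real (Suc n))..} z) \<partial>lebesgue)
         = (\<integral>\<^sup>+z. u0 z * indicator {0..} z \<partial>lebesgue)" by (rule nn_integral_cong_AE)
      then show ?thesis using U_eq[of 0] by simp
    qed
    ultimately have "(\<lambda>n. U (inverse (real (Suc n)))) \<longlonglongrightarrow> U 0" by (simp add: U_eq)
    \<comment> \<open>Letting the left end point decrease to 0 carries the bound over to
      \<open>U 0\<close>, which is thereby finite.\<close>
    then have U0le: "U 0 \<le> lev k" using le by (intro LIMSEQ_le_const2[of _ "U 0"]) auto
    then have U0: "U 0 = ennreal lam" using lev_fin[of k] by (auto simp: lam_def simp del: lev_fin)
    \<comment> \<open>Now \<open>U 0 = lam\<close> lies between two consecutive levels, which leaves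
      only k = 0.\<close>
    have "lev (k + 1) < U 0" using Xk1 tail_antimono[of 0 "X (k + 1) / 2" u] assms by auto
    then have "2 powr (- of_int (k + 1)) < (1::real)"
      using lam_pos by (auto simp: U0 lev_def ennreal_less_iff)
    moreover have "1 \<le> 2 powr (- real_of_int (k + 1))" if "k + 1 \<le> 0"
      using that by (intro ge_one_powr_ge_zero) linarith+
    ultimately have "0 < k + 1" by (meson linorder_not_less)
    moreover have "1 \<le> 2 powr (- real_of_int k)"
      using U0le lam_pos by (auto simp: U0 lev_def)
    then have "k \<le> 0"
      using powr_less_mono[of "- real_of_int k" 0 2] by (cases "0 < k") auto
    ultimately have "k = 0" by simp
    then show ?thesis using X0 U0 by (simp add: lev_def)
  qed
  have Xle: "X k \<le> X (k + 1)" by (intro X_mono) simp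
  have eq: "{X k..} = {X k..<X (k + 1)} \<union> {X (k + 1)..}" using Xle by auto
  have "lev k = (\<integral>\<^sup>+z. u0 z * indicator {X k..<X (k + 1)} z \<partial>lebesgue) + lev (k + 1)"
    using top U_X[OF assms] unfolding U_eq[OF X_nonneg] eq
    by (subst (asm) set_integral_Un) auto
  moreover have "(\<integral>\<^sup>+z. u0 z * indicator {X k..<X (k + 1)} z \<partial>lebesgue) = (\<integral>\<^sup>+z. u0 z * indicator (blk k) z \<partial>lebesgue)"
  proof (rule nn_integral_cong_AE)
    have "AE z in lebesgue. z \<noteq> (0::real)" by (rule AE_I[where N="{0}"]) auto
    then show "AE z in lebesgue. u0 z * indicator {X k..<X (k + 1)} z = u0 z * indicator (blk k) z"
    proof eventually_elim
      case (elim z)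
      have "z < 0 \<Longrightarrow> \<not> X k \<le> z" using X_nonneg[of k] by linarith
      then show ?case using elim by (auto simp: blk_def split: split_indicator)
    qed
  qed
  ultimately have "(\<integral>\<^sup>+z. u0 z * indicator (blk k) z \<partial>lebesgue) + lev (k + 1) = lev (k + 1) + lev (k + 1)"
    using lev_Suc[of k] by (simp add: mult_2)
  then show ?thesis
    by (metis add.commute ennreal_add_left_cancel lev_ne(2) infinity_ennreal_def)
qed

end

subsection \<open>Sums over the integers\<close>

text \<open>Writing sums as integrals over the counting measure gives access to monotone convergence
  and to the interchange with integrals.\<close>

abbreviation zsum :: "(int \<Rightarrow> ennreal) \<Rightarrow> ennreal" where
  "zsum a \<equiv> (\<integral>\<^sup>+k. a k \<partial>count_space UNIV)"

lemma zsum_shift: "zsum (\<lambda>k. a (k + i)) = zsum a"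
proof -
  have "bij (\<lambda>k::int. k + i)" by (rule bij_plus_right)
  from nn_integral_bij_count_space[OF this, of a] show ?thesis .
qed

lemma zsum_mono: "(\<And>k. a k \<le> b k) \<Longrightarrow> zsum a \<le> zsum b"
  by (rule nn_integral_mono) simp

lemma zsum_cmult: "zsum (\<lambda>k. c * a k) = c * zsum a"
  by (rule nn_integral_cmult) simp

lemma zsum_add: "zsum (\<lambda>k. a k + b k) = zsum a + zsum b"
  by (rule nn_integral_add) simp_all

lemma sum_le_zsum: assumes "finite J" shows "sum a J \<le> zsum a"
proof -
  have "sum a J = zsum (\<lambda>k. a k * indicator J k)"
    using assms by (subst nn_integral_count_space'[of J]) auto
  also have "\<dots> \<le> zsum a" by (intro zsum_mono) (auto split: split_indicator)
  finally show ?thesis .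
qed

lemma le_zsum: "a k \<le> zsum a"
  using sum_le_zsum[of "{k}" a] by simp

lemma zsum_le:
  assumes "\<And>n::nat. sum a {- int n..int n} \<le> C"
  shows "zsum a \<le> C"
proof -
  have "a k = (SUP n::nat. a k * indicator {- int n..int n} k)" for k
  proof (rule antisym)
    have "k \<in> {- int (nat \<bar>k\<bar>)..int (nat \<bar>k\<bar>)}" by auto
    then show "a k \<le> (SUP n::nat. a k * indicator {- int n..int n} k)"
      by (intro SUP_upper2[of "nat \<bar>k\<bar>"]) auto
  qed (auto intro!: SUP_least split: split_indicator)
  then have "zsum a = zsum (\<lambda>k. SUP n::nat. a k * indicator {- int n..int n} k)" by simp
  also have "\<dots> = (SUP n::nat. zsum (\<lambda>k. a k * indicator {- int n..int n} k))"
    by (rule nn_integral_monotone_convergence_SUP)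
      (auto simp: incseq_def le_fun_def intro!: mult_left_mono split: split_indicator)
  also have "\<dots> \<le> C"
  proof (rule SUP_least)
    fix n :: nat
    have "zsum (\<lambda>k. a k * indicator {- int n..int n} k) = sum a {- int n..int n}"
      by (subst nn_integral_count_space'[of "{- int n..int n}"]) auto
    then show "zsum (\<lambda>k. a k * indicator {- int n..int n} k) \<le> C" using assms by simp
  qed
  finally show ?thesis .
qed

lemma zsum_single:
  assumes "\<And>k. k \<noteq> j \<Longrightarrow> a k = 0"
  shows "zsum a = a j"
  using assms by (subst nn_integral_count_space'[of "{j}"]) auto

lemma ennreal_absorb_half:
  fixes x y :: ennreal
  assumes "x \<le> x / 2 + y" "x < top"
  shows "x \<le> 2 * y"
proof (cases y)
  case (real b)
  then show ?thesis using assms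
    by (cases x) (auto simp: ennreal_divide_numeral numeral_mult_ennreal ennreal_plus[symmetric] simp del: ennreal_plus)
qed (simp add: ennreal_mult_top)

text \<open>Vanishing up to m yields by induction a bound for each single term, so each is finite.
  Cutting off above n makes the total finite as well; by shift invariance half of it can then be
  absorbed.\<close>

lemma zsum_absorb:
  fixes \<alpha> e :: "int \<Rightarrow> ennreal"
  assumes M: "0 < M" and zero: "\<And>k. k \<le> m \<Longrightarrow> \<alpha> k = 0"
    and rec: "\<And>k. \<alpha> k \<le> \<alpha> (k - M) / 2 + e k"
  shows "zsum \<alpha> \<le> 2 * zsum e"
proof (cases "zsum e = top")
  case True then show ?thesis by (simp add: ennreal_mult_top)
next
  case False
  have bound: "\<alpha> k \<le> 2 * zsum e" for k
  proof (induction "nat (k - m)" arbitrary: k rule: less_induct)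
    case less
    show ?case
    proof (cases "k \<le> m")
      case False
      then have "\<alpha> (k - M) \<le> 2 * zsum e" using M by (intro less) auto
      then have "\<alpha> k \<le> 2 * zsum e / 2 + zsum e"
        using rec[of k] le_zsum[of e k]
        by (meson add_mono divide_right_mono_ennreal order_trans)
      also have "2 * zsum e / 2 = zsum e"
        using ennreal_mult_divide_eq[of 2 "zsum e"] by (simp add: mult.commute)
      finally show ?thesis by (simp add: mult_2)
    qed (simp add: zero)
  qed
  show ?thesis
  proof (rule zsum_le)
    fix n :: nat
    \<comment> \<open>The cut-off respects the recursion: with k at most n also \<open>k - M\<close>
      is at most n.\<close>
    define \<beta> where "\<beta> k = (if k \<le> int n then \<alpha> k else 0)" for k
    have fin: "\<alpha> k < top" for k
      using bound[of k] False by (auto simp: less_top[symmetric] top_unique ennreal_mult_eq_top_iff)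
    have "zsum \<beta> = sum \<beta> {m..int n}"
      using zero by (intro nn_integral_count_space') (auto simp: \<beta>_def)
    also have "\<dots> < top" using fin by (auto simp: \<beta>_def)
    finally have \<beta>fin: "zsum \<beta> < top" .
    have "zsum \<beta> \<le> zsum (\<lambda>k. \<beta> (k + - M) / 2 + e k)"
      using rec M by (intro zsum_mono) (auto simp: \<beta>_def)
    also have "\<dots> = zsum \<beta> / 2 + zsum e"
      using zsum_shift[of "\<lambda>k. \<beta> k / 2" "- M"] by (simp add: zsum_add nn_integral_divide)
    finally have "zsum \<beta> \<le> 2 * zsum e" using \<beta>fin by (rule ennreal_absorb_half)
    moreover have "sum \<alpha> {- int n..int n} = sum \<beta> {- int n..int n}"
      by (intro sum.cong) (auto simp: \<beta>_def)
    ultimately show "sum \<alpha> {- int n..int n} \<le> 2 * zsum e"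
      using sum_le_zsum[of "{- int n..int n}" \<beta>] by simp
  qed
qed

text \<open>After normalising by both sums, the crude Young inequality leaves 1 + 1, whence the
  factor 2.\<close>

lemma zsum_Hoelder:
  assumes "0 < a" "0 < b" "a + b = 1"
  shows "zsum (\<lambda>k. x k powe a * y k powe b) \<le> 2 * (zsum x powe a * zsum y powe b)"
proof -
  let ?x = "zsum x" and ?y = "zsum y"
  consider "?x = 0" | "?y = 0" | "?x \<noteq> 0" "?y \<noteq> 0" "?x = top \<or> ?y = top"
    | "?x \<noteq> 0" "?y \<noteq> 0" "?x \<noteq> top" "?y \<noteq> top" by blast
  then show ?thesis
  proof cases
    case 1
    then have "x k = 0" for k using le_zsum[of x k] by simp
    then show ?thesis by simp
  next
    case 2
    then have "y k = 0" for k using le_zsum[of y k] by simp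
    then show ?thesis by simp
  next
    case 3
    then have "?x powe a * ?y powe b = top" by (auto simp: ennreal_mult_eq_top_iff)
    then show ?thesis by (simp add: ennreal_mult_top)
  next
    case 4
    have split: "z = c * (z / c)" if "c \<noteq> 0" "c \<noteq> top" for z c :: ennreal
      using that ennreal_mult_divide_eq[of c z] by (simp add: ennreal_times_divide mult.commute[of c])
    have "x k powe a * y k powe b \<le> ?x powe a * ?y powe b * (x k / ?x + y k / ?y)" for k
    proof -
      have "x k powe a * y k powe b = ?x powe a * ?y powe b * ((x k / ?x) powe a * (y k / ?y) powe b)"
      proof -
        have "x k powe a = (?x * (x k / ?x)) powe a"
          by (rule arg_cong[OF split]) (use 4 in auto)
        moreover have "y k powe b = (?y * (y k / ?y)) powe b"
          by (rule arg_cong[OF split]) (use 4 in auto)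
        ultimately show ?thesis by (simp only: powe_mult mult_ac)
      qed
      also have "\<dots> \<le> ?x powe a * ?y powe b * (x k / ?x + y k / ?y)"
        by (intro mult_left_mono powe_mult_le_add assms) auto
      finally show ?thesis .
    qed
    then have "zsum (\<lambda>k. x k powe a * y k powe b) \<le> zsum (\<lambda>k. ?x powe a * ?y powe b * (x k / ?x + y k / ?y))"
      by (rule zsum_mono)
    also have "\<dots> = ?x powe a * ?y powe b * (?x / ?x + ?y / ?y)"
      by (simp add: zsum_cmult zsum_add nn_integral_divide)
    also have "?x / ?x + ?y / ?y = 2"
      using 4 by (simp add: ennreal_divide_self less_top[symmetric])
    finally show ?thesis by (simp add: mult.commute)
  qed
qed

text \<open>Each term is at most the whole sum, so the factor with exponent a - 1 may be replaced by
  a power of the sum.\<close>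

lemma zsum_powe_le:
  assumes "1 \<le> a"
  shows "zsum (\<lambda>k. x k powe a) \<le> zsum x powe a"
proof (cases "a = 1")
  case False
  then have a: "0 < a - 1" using assms by simp
  have "zsum (\<lambda>k. x k powe a) \<le> zsum (\<lambda>k. zsum x powe (a - 1) * x k)"
  proof (rule zsum_mono)
    fix k
    have "x k powe a = x k powe (a - 1) * x k"
      using powe_add_exponent[of "x k" "a - 1" 1] by simp
    also have "\<dots> \<le> zsum x powe (a - 1) * x k"
      by (intro mult_right_mono powe_mono a le_zsum) auto
    finally show "x k powe a \<le> zsum x powe (a - 1) * x k" .
  qed
  also have "\<dots> = zsum x powe a"
    using powe_add_exponent[of "zsum x" "a - 1" 1] by (simp add: zsum_cmult)
  finally show ?thesis .
qed simp

section \<open>Step functions over the blocks\<close>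

context tail_weight begin

text \<open>Degenerate blocks are empty although \<open>lev (k + 1)\<close> is positive; the case
  distinction records this.\<close>

definition mass :: "int \<Rightarrow> ennreal" where
  "mass k = (if 0 < X (k + 1) then lev (k + 1) else 0)"

lemma integral_blk: "(\<integral>\<^sup>+z. u0 z * indicator (blk k) z \<partial>lebesgue) = mass k"
proof (cases "0 < X (k + 1)")
  case False
  then have "blk k = {}" by (auto simp: blk_def)
  then show ?thesis using False by (simp add: mass_def)
qed (simp add: mass_def blk_mass)

lemma zsum_blk: "x \<in> blk j \<Longrightarrow> zsum (\<lambda>k. indicator (blk k) x * c k) = c j"
  by (subst zsum_single[of j]) (auto dest: blk_unique split: split_indicator)

lemma integral_step:
  "(\<integral>\<^sup>+x. u0 x * zsum (\<lambda>k. indicator (blk k) x * c k) \<partial>lebesgue) = zsum (\<lambda>k. mass k * c k)"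
proof -
  have "(\<integral>\<^sup>+x. u0 x * zsum (\<lambda>k. indicator (blk k) x * c k) \<partial>lebesgue)
     = (\<integral>\<^sup>+x. zsum (\<lambda>k. (u0 x * indicator (blk k) x) * c k) \<partial>lebesgue)"
    by (simp add: zsum_cmult[symmetric] mult.assoc)
  also have "\<dots> = zsum (\<lambda>k. \<integral>\<^sup>+x. (u0 x * indicator (blk k) x) * c k \<partial>lebesgue)"
    by (intro nn_integral_count_space_nn_integral borel_measurable_times_ennreal set_integral_measurable) auto
  also have "\<dots> = zsum (\<lambda>k. mass k * c k)"
    by (simp add: nn_integral_multc set_integral_measurable integral_blk)
  finally show ?thesis .
qed

lemma integral_le_step:
  assumes "\<And>k x. x \<in> blk k \<Longrightarrow> g x \<le> u x * c k"
  shows "(\<integral>\<^sup>+x\<in>{0..}. g x \<partial>lebesgue) \<le> zsum (\<lambda>k. mass k * c k)"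
proof -
  have "(\<integral>\<^sup>+x\<in>{0..}. g x \<partial>lebesgue) \<le> (\<integral>\<^sup>+x. u0 x * zsum (\<lambda>k. indicator (blk k) x * c k) \<partial>lebesgue)"
  proof (rule nn_integral_mono_AE)
    show "AE x in lebesgue. g x * indicator {0..} x \<le> u0 x * zsum (\<lambda>k. indicator (blk k) x * c k)"
      using AE_neq_0
    proof eventually_elim
      case (elim x)
      show ?case
      proof (cases "0 < x")
        case True
        then obtain k where "x \<in> blk k" by (rule in_blk)
        then show ?thesis using assms[of x k] True by (simp add: zsum_blk u0_def)
      qed (use elim in auto)
    qed
  qed
  then show ?thesis by (simp add: integral_step)
qed

lemma step_le_integral:
  assumes "\<And>k x. x \<in> blk k \<Longrightarrow> u x * c k \<le> g x"
  shows "zsum (\<lambda>k. mass k * c k) \<le> (\<integral>\<^sup>+x\<in>{0..}. g x \<partial>lebesgue)"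
proof -
  have "(\<integral>\<^sup>+x. u0 x * zsum (\<lambda>k. indicator (blk k) x * c k) \<partial>lebesgue) \<le> (\<integral>\<^sup>+x\<in>{0..}. g x \<partial>lebesgue)"
  proof (rule nn_integral_mono_AE)
    show "AE x in lebesgue. u0 x * zsum (\<lambda>k. indicator (blk k) x * c k) \<le> g x * indicator {0..} x"
      using AE_neq_0
    proof eventually_elim
      case (elim x)
      show ?case
      proof (cases "0 < x")
        case True
        then obtain k where "x \<in> blk k" by (rule in_blk)
        then show ?thesis using assms[of x k] True by (simp add: zsum_blk u0_def)
      qed (use elim in \<open>auto simp: u0_def\<close>)
    qed
  qed
  then show ?thesis by (simp add: integral_step)
qed

lemma zsum_unit_intervals: "zsum (\<lambda>k. indicator {X k<..X (k + 1)} z) \<le> 1"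
proof (cases "\<exists>j. z \<in> {X j<..X (j + 1)}")
  case True
  then obtain j where j: "z \<in> {X j<..X (j + 1)}" by auto
  have False if "a < b" "z \<in> {X a<..X (a + 1)}" "z \<in> {X b<..X (b + 1)}" for a b
    using that X_mono[of "a + 1" b] by auto
  then have "z \<notin> {X k<..X (k + 1)}" if "k \<noteq> j" for k
    using that j by (metis linorder_neqE)
  then show ?thesis using j by (subst zsum_single[of j]) auto
next
  case False
  then have "indicator {X k<..X (k + 1)} z = (0::ennreal)" for k by (auto split: split_indicator)
  then show ?thesis by simp
qed

text \<open>Overlap bound for the supports of the localised functions \<open>cut\<close>, each of
  which spans three consecutive intervals.\<close>

lemma zsum_triple_intervals: "zsum (\<lambda>k. indicator {X (k - 2)<..X (k + 1)} z) \<le> 3"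
proof -
  let ?I = "\<lambda>k. indicator {X k<..X (k + 1)} z :: ennreal"
  have "zsum (\<lambda>k. indicator {X (k - 2)<..X (k + 1)} z) \<le> zsum (\<lambda>k. ?I (k + - 2) + (?I (k + - 1) + ?I k))"
    by (intro zsum_mono) (auto split: split_indicator)
  also have "\<dots> = zsum ?I + (zsum ?I + zsum ?I)"
    using zsum_shift[of ?I "-1"] zsum_shift[of ?I "-2"] by (simp add: zsum_add)
  also have "\<dots> \<le> 1 + (1 + 1)" by (intro add_mono zsum_unit_intervals)
  finally show ?thesis by simp
qed

end

section \<open>Discretisable Hardy operators with a rooted kernel and weight\<close>

locale hardy_setting = tail_weight u for u +
  fixes p r DK :: real and q :: ennreal and v W :: "real \<Rightarrow> ennreal" and K :: "real \<Rightarrow> real \<Rightarrow> ennreal"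
  assumes p: "1 \<le> p" and r: "0 < r" and q: "0 < q" and DK: "1 \<le> DK"
    and v_Mplus: "v \<in> Mplus"
    and W_measurable [measurable]: "W \<in> borel_measurable lebesgue"
    and K_measurable: "\<And>x. 0 \<le> x \<Longrightarrow> K x \<in> borel_measurable lebesgue"
    and K_split: "\<And>x y z. 0 \<le> y \<Longrightarrow> y \<le> z \<Longrightarrow> z \<le> x \<Longrightarrow> K x y \<le> ennreal DK * (K x z + K z y)"
    and K_left: "\<And>x y z. 0 \<le> y \<Longrightarrow> y \<le> z \<Longrightarrow> z \<le> x \<Longrightarrow> K x z \<le> ennreal DK * K x y"
    and K_right: "\<And>x y z. 0 \<le> y \<Longrightarrow> y \<le> z \<Longrightarrow> z \<le> x \<Longrightarrow> K z y \<le> ennreal DK * K x y"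
begin

abbreviation "CN \<equiv> quasi_const q"

text \<open>\<open>K\<close> and \<open>W\<close> play the role of q-th roots of kernel and weight
  and hence stand inside the norm. Freezing the first kernel variable at b separates it from the
  variable of integration.\<close>

definition Q :: "real set \<Rightarrow> real \<Rightarrow> (real \<Rightarrow> ennreal) \<Rightarrow> ennreal" where
  "Q A b g = Lq q (\<lambda>y. indicator A y * (K b y * W y * g y))"

definition R :: "real set \<Rightarrow> (real \<Rightarrow> ennreal) \<Rightarrow> ennreal" where
  "R A g = Lq q (\<lambda>y. indicator A y * (W y * g y))"

text \<open>The p-th power of the norm is kept because it, unlike the norm, adds up over disjoint
  pieces.\<close>

definition V :: "(real \<Rightarrow> ennreal) \<Rightarrow> ennreal" where
  "V f = (\<integral>\<^sup>+x\<in>{0..}. f x powe p * v x \<partial>lebesgue)"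

lemma wnorm_V: "wnorm (ennreal p) v f = V f powe (1 / p)"
  using p by (simp add: wnorm_def V_def)

lemma Q_measurable:
  assumes "A \<in> sets lebesgue" "0 \<le> b" "g \<in> borel_measurable lebesgue"
  shows "(\<lambda>y. indicator A y * (K b y * W y * g y)) \<in> borel_measurable lebesgue"
  using assms K_measurable[of b]
  by (intro borel_measurable_times_ennreal borel_measurable_indicator) auto

lemma R_measurable:
  assumes "A \<in> sets lebesgue" "g \<in> borel_measurable lebesgue"
  shows "(\<lambda>y. indicator A y * (W y * g y)) \<in> borel_measurable lebesgue"
  using assms by (intro borel_measurable_times_ennreal borel_measurable_indicator) auto

text \<open>Inclusion up to a null set allows half-open intervals between cut points to be exchanged
  with the open intervals of the operators.\<close>

lemma Q_mono_AE:
  assumes "A \<in> sets lebesgue" "0 \<le> b" "g \<in> borel_measurable lebesgue"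
    and "AE y in lebesgue. y \<in> A \<longrightarrow> y \<in> B" "\<And>y. y \<in> A \<Longrightarrow> g y \<le> h y"
  shows "Q A b g \<le> Q B b h"
  unfolding Q_def
proof (rule Lq_mono_AE[OF q])
  show "AE y in lebesgue. indicator A y * (K b y * W y * g y) \<le> indicator B y * (K b y * W y * h y)"
    using assms(4) by eventually_elim (auto split: split_indicator intro!: mult_left_mono assms(5))
qed (rule Q_measurable[OF assms(1-3)])

lemma Q_mono:
  assumes "A \<in> sets lebesgue" "0 \<le> b" "g \<in> borel_measurable lebesgue"
    and "A \<subseteq> B" "\<And>y. y \<in> A \<Longrightarrow> g y \<le> h y"
  shows "Q A b g \<le> Q B b h"
  using assms by (intro Q_mono_AE) auto

lemma Q_kernel_mono:
  assumes A: "A \<in> sets lebesgue" and b: "0 \<le> b" "b \<le> b'" and g: "g \<in> borel_measurable lebesgue"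
    and "A \<subseteq> {0..b}"
  shows "Q A b g \<le> ennreal DK * Q A b' g"
proof -
  have "Q A b g \<le> Lq q (\<lambda>y. ennreal DK * (indicator A y * (K b' y * W y * g y)))"
    unfolding Q_def
  proof (rule Lq_mono[OF q Q_measurable[OF A b(1) g]])
    fix y
    show "indicator A y * (K b y * W y * g y) \<le> ennreal DK * (indicator A y * (K b' y * W y * g y))"
    proof (cases "y \<in> A")
      case True
      then have "K b y * (W y * g y) \<le> ennreal DK * K b' y * (W y * g y)"
        using assms by (intro mult_right_mono K_right) auto
      then show ?thesis using True by (simp add: mult_ac)
    qed simp
  qed
  also have "\<dots> = ennreal DK * Q A b' g"
    unfolding Q_def using b by (intro Lq_cmult[OF q] Q_measurable[OF A _ g]) auto
  finally show ?thesis .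
qed

lemma Q_le:
  assumes A: "A \<in> sets lebesgue" "B \<in> sets lebesgue" and b: "0 \<le> b" "b \<le> b'"
    and g: "g \<in> borel_measurable lebesgue" and AB: "AE y in lebesgue. y \<in> A \<longrightarrow> y \<in> B" "A \<subseteq> {0..b}"
    and gh: "\<And>y. y \<in> A \<Longrightarrow> g y \<le> h y"
  shows "Q A b g \<le> ennreal DK * Q B b' h"
proof -
  have "Q A b g \<le> ennreal DK * Q A b' g" by (rule Q_kernel_mono[OF A(1) b g AB(2)])
  also have "\<dots> \<le> ennreal DK * Q B b' h"
    using b by (intro mult_left_mono Q_mono_AE A AB g gh) auto
  finally show ?thesis .
qed

lemma Q_union:
  assumes A: "A \<in> sets lebesgue" "B \<in> sets lebesgue" "C \<in> sets lebesgue" and b: "0 \<le> b"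
    and g: "g \<in> borel_measurable lebesgue" and sub: "A \<subseteq> B \<union> C"
  shows "Q A b g \<le> ennreal CN * (Q B b g + Q C b g)"
proof -
  have "Q A b g \<le> Lq q (\<lambda>y. indicator B y * (K b y * W y * g y) + indicator C y * (K b y * W y * g y))"
    unfolding Q_def using sub
    by (intro Lq_mono[OF q Q_measurable[OF A(1) b g]]) (auto split: split_indicator)
  also have "\<dots> \<le> ennreal CN * (Q B b g + Q C b g)"
    unfolding Q_def by (intro Lq_add q Q_measurable A b g)
  finally show ?thesis .
qed

lemma Q_add:
  assumes A: "A \<in> sets lebesgue" and b: "0 \<le> b" and f: "f \<in> borel_measurable lebesgue"
    and g: "g \<in> borel_measurable lebesgue" and h: "h \<in> borel_measurable lebesgue"
    and le: "\<And>y. y \<in> A \<Longrightarrow> f y \<le> g y + h y"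
  shows "Q A b f \<le> ennreal CN * (Q A b g + Q A b h)"
proof -
  have "Q A b f \<le> Lq q (\<lambda>y. indicator A y * (K b y * W y * g y) + indicator A y * (K b y * W y * h y))"
    unfolding Q_def
  proof (rule Lq_mono[OF q Q_measurable[OF A b f]])
    fix y
    show "indicator A y * (K b y * W y * f y)
       \<le> indicator A y * (K b y * W y * g y) + indicator A y * (K b y * W y * h y)"
      by (auto simp: distrib_left[symmetric] split: split_indicator intro!: mult_left_mono le)
  qed
  also have "\<dots> \<le> ennreal CN * (Q A b g + Q A b h)"
    unfolding Q_def by (intro Lq_add q Q_measurable A b g h)
  finally show ?thesis .
qed

lemma Q_cmult:
  assumes "A \<in> sets lebesgue" "0 \<le> b" "g \<in> borel_measurable lebesgue"
  shows "Q A b (\<lambda>y. c * g y) = c * Q A b g"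
  unfolding Q_def Lq_cmult[OF q Q_measurable[OF assms], symmetric] by (simp add: mult_ac)

lemma R_mono_AE:
  assumes "A \<in> sets lebesgue" "g \<in> borel_measurable lebesgue"
    and "AE y in lebesgue. y \<in> A \<longrightarrow> y \<in> B"
  shows "R A g \<le> R B g"
  unfolding R_def
proof (rule Lq_mono_AE[OF q R_measurable[OF assms(1,2)]])
  show "AE y in lebesgue. indicator A y * (W y * g y) \<le> indicator B y * (W y * g y)"
    using assms(3) by eventually_elim (auto split: split_indicator)
qed

lemma R_union:
  assumes A: "A \<in> sets lebesgue" "B \<in> sets lebesgue" "C \<in> sets lebesgue"
    and g: "g \<in> borel_measurable lebesgue" and sub: "A \<subseteq> B \<union> C"
  shows "R A g \<le> ennreal CN * (R B g + R C g)"
proof -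
  have "R A g \<le> Lq q (\<lambda>y. indicator B y * (W y * g y) + indicator C y * (W y * g y))"
    unfolding R_def using sub
    by (intro Lq_mono[OF q R_measurable[OF A(1) g]]) (auto split: split_indicator)
  also have "\<dots> \<le> ennreal CN * (R B g + R C g)"
    unfolding R_def by (intro Lq_add q R_measurable A g)
  finally show ?thesis .
qed

text \<open>For y at most z, \<open>K_left\<close> bounds \<open>K b z\<close> by \<open>DK\<close>
  times \<open>K b y\<close>, so the factor can be moved into the norm.\<close>

lemma K_R_le_Q:
  assumes A: "A \<in> sets lebesgue" and z: "0 \<le> z" "z \<le> b" and g: "g \<in> borel_measurable lebesgue"
    and sub: "A \<subseteq> {0..z}"
  shows "K b z * R A g \<le> ennreal DK * Q A b g"
proof -
  have "K b z * R A g = Lq q (\<lambda>y. K b z * (indicator A y * (W y * g y)))"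
    unfolding R_def by (rule Lq_cmult[OF q R_measurable[OF A g], symmetric])
  also have "\<dots> \<le> Lq q (\<lambda>y. ennreal DK * (indicator A y * (K b y * W y * g y)))"
  proof (rule Lq_mono[OF q])
    fix y
    show "K b z * (indicator A y * (W y * g y)) \<le> ennreal DK * (indicator A y * (K b y * W y * g y))"
    proof (cases "y \<in> A")
      case True
      then have "K b z * (W y * g y) \<le> ennreal DK * K b y * (W y * g y)"
        using sub z by (intro mult_right_mono K_left) auto
      then show ?thesis using True by (simp add: mult_ac)
    qed simp
  qed (intro borel_measurable_times_ennreal R_measurable A g borel_measurable_const)
  also have "\<dots> = ennreal DK * Q A b g"
    unfolding Q_def using z by (intro Lq_cmult[OF q] Q_measurable[OF A _ g]) auto
  finally show ?thesis .
qed

text \<open>The Oinarov condition at z isolates the dependence on b in the single factor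
  \<open>K b z\<close>; what remains is the same functional with b replaced by z, as a recursion
  requires.\<close>

lemma Q_split_le:
  assumes A: "A \<in> sets lebesgue" and z: "0 \<le> z" "z \<le> b" and g: "g \<in> borel_measurable lebesgue"
    and sub: "A \<subseteq> {0..z}"
  shows "Q A b g \<le> ennreal (CN * DK) * (K b z * R A g + Q A z g)"
proof -
  let ?k = "\<lambda>y. K b z * (indicator A y * (W y * g y))" and ?l = "\<lambda>y. indicator A y * (K z y * W y * g y)"
  have b: "0 \<le> b" using z by simp
  have m: "?k \<in> borel_measurable lebesgue" "?l \<in> borel_measurable lebesgue"
    by (intro borel_measurable_times_ennreal[OF borel_measurable_const] R_measurable Q_measurable A g z(1))+
  have "Q A b g \<le> Lq q (\<lambda>y. ennreal DK * (?k y + ?l y))"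
    unfolding Q_def
  proof (rule Lq_mono[OF q Q_measurable[OF A b g]])
    fix y
    show "indicator A y * (K b y * W y * g y) \<le> ennreal DK * (?k y + ?l y)"
    proof (cases "y \<in> A")
      case True
      then have "K b y * (W y * g y) \<le> ennreal DK * (K b z + K z y) * (W y * g y)"
        using sub z by (intro mult_right_mono K_split) auto
      then show ?thesis using True by (simp add: mult_ac distrib_left distrib_right)
    qed simp
  qed
  also have "\<dots> = ennreal DK * Lq q (\<lambda>y. ?k y + ?l y)"
    using m by (intro Lq_cmult[OF q]) auto
  also have "\<dots> \<le> ennreal DK * (ennreal CN * (Lq q ?k + Lq q ?l))"
    using m by (intro mult_left_mono Lq_add q) auto
  also have "Lq q ?k = K b z * R A g"
    unfolding R_def by (rule Lq_cmult[OF q R_measurable[OF A g]])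
  finally show ?thesis
    using DK quasi_const_ge_1[of q] by (simp add: Q_def ennreal_mult mult_ac)
qed

definition Th :: "(real \<Rightarrow> ennreal) \<Rightarrow> real \<Rightarrow> ennreal" where
  "Th f x = Q {0<..<x} x (tail f)"

definition NT :: "(real \<Rightarrow> ennreal) \<Rightarrow> ennreal" where
  "NT f = (\<integral>\<^sup>+x\<in>{0..}. Th f x powe r * u x \<partial>lebesgue) powe (1 / r)"

definition NB0 :: "(real \<Rightarrow> ennreal) \<Rightarrow> ennreal" where
  "NB0 f = (\<integral>\<^sup>+x\<in>{0..}. u x * (Q {0<..<x} x (\<lambda>_. 1) powe r) * (tail f x powe r) \<partial>lebesgue) powe (1 / r)"

definition NB1 :: "(real \<Rightarrow> ennreal) \<Rightarrow> ennreal" where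
  "NB1 f = (\<integral>\<^sup>+x\<in>{0..}. u x * (K x (zeta_inv u (zeta_inv u x)) powe r)
      * (R {0<..<zeta_inv u (zeta_inv u x)} (tail f) powe r) \<partial>lebesgue) powe (1 / r)"

text \<open>The block operator has \<open>c = zeta u b\<close>; leaving c free permits comparison
  with blocks bounded by cut points.\<close>

definition bn :: "real \<Rightarrow> real \<Rightarrow> real \<Rightarrow> ennreal" where
  "bn a b c = least_const (\<lambda>f. Q {a<..b} b (tail (\<lambda>z. f z * indicator {..c} z))) (ennreal p) v"

definition ht :: "real \<Rightarrow> ennreal" where
  "ht t = least_const (\<lambda>f. Q {0<..t} t (tail f)) (ennreal p) v"

definition "CT = least_const NT (ennreal p) v"
definition "b0 = least_const NB0 (ennreal p) v"
definition "b1 = least_const NB1 (ennreal p) v"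

definition s :: real where "s = 1 / (1 / r - 1 / p)"

definition b2 :: ennreal where
  "b2 = (if p \<le> r then (SUP t\<in>{0<..}. (U t powe (1 / r)) * ht t)
     else (\<integral>\<^sup>+x\<in>{0..}. u x * (U x powe (s / p))
       * (bn (zeta_inv u x) (zeta u (zeta u x)) (zeta u (zeta u (zeta u x))) powe s) \<partial>lebesgue) powe (1 / s))"

subsection \<open>The necessary conditions\<close>

lemma b0_le: "b0 \<le> CT"
proof -
  have "NB0 f \<le> ennreal 1 * NT f" for f
  proof -
    have "NB0 f \<le> NT f"
      unfolding NB0_def NT_def
    proof (intro powe_mono nn_integral_mono)
      fix x :: real
      show "u x * (Q {0<..<x} x (\<lambda>_. 1) powe r) * (tail f x powe r) * indicator {0..} x
         \<le> Th f x powe r * u x * indicator {0..} x"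
      proof (cases "0 \<le> x")
        case True
        \<comment> \<open>On (0, x) the tail of f is at least its value at x, which as a constant
          can be drawn into the norm.\<close>
        have "tail f x * Q {0<..<x} x (\<lambda>_. 1) = Q {0<..<x} x (\<lambda>y. tail f x * 1)"
          using True by (intro Q_cmult[symmetric]) auto
        also have "\<dots> \<le> Th f x"
          unfolding Th_def using True by (intro Q_mono) (auto intro: tail_antimono)
        finally have "(tail f x * Q {0<..<x} x (\<lambda>_. 1)) powe r * u x \<le> Th f x powe r * u x"
          by (intro mult_right_mono powe_mono r) auto
        then show ?thesis using True by (simp add: powe_mult mult_ac)
      qed simp
    qed (use r in auto)
    then show ?thesis by simp
  qed
  from least_const_mono[of NB0 1 NT, OF this] show ?thesis by (simp add: b0_def CT_def)
qed

lemma powe_DK: "ennreal DK powe a = ennreal (DK powr a)"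
  using DK by (intro powe_ennreal) auto

text \<open>The constant is extracted from an integrand that may fail to be measurable. This works
  because the integral is a supremum over simple functions below the integrand, and scaling by a
  positive constant maps such functions to such functions.\<close>

lemma integral_powe_cmult_le:
  assumes "\<And>x. 0 < x \<Longrightarrow> g x \<le> (ennreal DK * h x) powe r * u x"
  shows "(\<integral>\<^sup>+x\<in>{0..}. g x \<partial>lebesgue) powe (1 / r)
     \<le> ennreal DK * (\<integral>\<^sup>+x\<in>{0..}. h x powe r * u x \<partial>lebesgue) powe (1 / r)"
proof -
  define H where "H x = ennreal DK powe r * (h x powe r * u x * indicator {0..} x)" for x
  have "(\<integral>\<^sup>+x\<in>{0..}. g x \<partial>lebesgue) \<le> (\<integral>\<^sup>+x. H x \<partial>lebesgue)"
  proof (rule nn_integral_mono_AE)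
    show "AE x in lebesgue. g x * indicator {0..} x \<le> H x"
      using AE_neq_0
    proof eventually_elim
      case (elim x)
      then show ?case using assms[of x]
        by (cases "0 < x") (auto simp: H_def powe_mult mult_ac)
    qed
  qed
  also have "(\<integral>\<^sup>+x. H x \<partial>lebesgue) \<le> ennreal DK powe r * (\<integral>\<^sup>+x\<in>{0..}. h x powe r * u x \<partial>lebesgue)"
  proof -
    define c where "c = DK powr r"
    have c: "0 < c" using DK by (simp add: c_def)
    have ic: "ennreal c * ennreal (1 / c) = 1" using c by (simp add: ennreal_mult[symmetric])
    have "(\<integral>\<^sup>+x. H x \<partial>lebesgue) \<le> ennreal c * (\<integral>\<^sup>+x. ennreal (1 / c) * H x \<partial>lebesgue)"
      unfolding nn_integral_def SUP_mult_left_ennreal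
    proof (rule SUP_least)
      fix g assume g: "g \<in> {g. simple_function lebesgue g \<and> g \<le> H}"
      have g': "(\<lambda>x. ennreal (1 / c) * g x) \<in> {g. simple_function lebesgue g \<and> g \<le> (\<lambda>x. ennreal (1 / c) * H x)}"
        using g by (auto simp: le_fun_def intro!: mult_left_mono)
      have "integral\<^sup>S lebesgue g = ennreal c * (ennreal (1 / c) * integral\<^sup>S lebesgue g)"
        using ic by (simp add: mult.assoc[symmetric])
      also have "ennreal (1 / c) * integral\<^sup>S lebesgue g = integral\<^sup>S lebesgue (\<lambda>x. ennreal (1 / c) * g x)"
        using g by (simp add: simple_integral_mult)
      finally show "integral\<^sup>S lebesgue g \<le> (SUP g\<in>{g. simple_function lebesgue g \<and> g \<le> (\<lambda>x. ennreal (1 / c) * H x)}. ennreal c * integral\<^sup>S lebesgue g)"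
        using g' by (intro SUP_upper2[OF g']) auto
    qed
    also have "(\<lambda>x. ennreal (1 / c) * H x) = (\<lambda>x. h x powe r * u x * indicator {0..} x)"
      using ic by (auto simp: H_def powe_DK c_def[symmetric] mult.assoc[symmetric] mult.commute[of "ennreal (1 / c)"])
    finally show ?thesis by (simp add: powe_DK c_def)
  qed
  finally have "(\<integral>\<^sup>+x\<in>{0..}. g x \<partial>lebesgue) powe (1 / r)
     \<le> (ennreal DK powe r * (\<integral>\<^sup>+x\<in>{0..}. h x powe r * u x \<partial>lebesgue)) powe (1 / r)"
    using r by (intro powe_mono) auto
  then show ?thesis using r by (simp add: powe_mult)
qed

lemma b1_le: "b1 \<le> ennreal DK * CT"
proof -
  have "NB1 f \<le> ennreal DK * NT f" for f
    unfolding NB1_def NT_def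
  proof (rule integral_powe_cmult_le)
    fix x :: real assume x: "0 < x"
    then obtain k where k: "x \<in> blk k" by (rule in_blk)
    define z where "z = zeta_inv u (zeta_inv u x)"
    have "z \<le> X (k - 1)" "X (k - 2) \<le> z" using zeta_inv2_bounds[OF k] by (auto simp: z_def)
    moreover have "X (k - 1) \<le> X k" by (rule X_mono) simp
    ultimately have z: "0 \<le> z" "z \<le> x"
      using k X_nonneg[of "k - 2"] by (auto simp: blk_def simp del: X_nonneg)
    have "K x z * R {0<..<z} (tail f) \<le> ennreal DK * Q {0<..<z} x (tail f)"
      using z by (intro K_R_le_Q) auto
    also have "\<dots> \<le> ennreal DK * Th f x"
      unfolding Th_def using z by (intro mult_left_mono Q_mono) auto
    finally have "(K x z * R {0<..<z} (tail f)) powe r * u x \<le> (ennreal DK * Th f x) powe r * u x"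
      by (intro mult_right_mono powe_mono r) auto
    then show "u x * (K x (zeta_inv u (zeta_inv u x)) powe r) * (R {0<..<zeta_inv u (zeta_inv u x)} (tail f) powe r)
       \<le> (ennreal DK * Th f x) powe r * u x"
      by (simp add: powe_mult mult_ac z_def)
  qed
  from least_const_mono[of NB1 DK NT, OF this] show ?thesis using DK by (simp add: b1_def CT_def)
qed

text \<open>Only x at least t are kept in the outer integral. There the kernel at x dominates the
  kernel at t up to \<open>DK\<close>, and u contributes its mass \<open>U t\<close>.\<close>

lemma tail_Q_le_NT:
  assumes t: "0 < t"
  shows "U t powe (1 / r) * Q {0<..t} t (tail f) \<le> ennreal DK * NT f"
proof -
  let ?c = "Q {0<..t} t (tail f)"
  have "U t * ?c powe r = (\<integral>\<^sup>+x. (u0 x * indicator {t..} x) * ?c powe r \<partial>lebesgue)"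
    using t by (simp add: nn_integral_multc set_integral_measurable U_eq)
  also have "\<dots> = (\<integral>\<^sup>+x\<in>{0..}. ?c powe r * u x * indicator {t..} x \<partial>lebesgue)"
    by (intro nn_integral_cong) (auto simp: u0_def mult_ac split: split_indicator)
  finally have "U t powe (1 / r) * ?c = (\<integral>\<^sup>+x\<in>{0..}. ?c powe r * u x * indicator {t..} x \<partial>lebesgue) powe (1 / r)"
    using r by (metis powe_inverse_cancel powe_mult)
  also have "\<dots> \<le> ennreal DK * NT f"
    unfolding NT_def
  proof (rule integral_powe_cmult_le)
    fix x :: real assume x: "0 < x"
    show "?c powe r * u x * indicator {t..} x \<le> (ennreal DK * Th f x) powe r * u x"
    proof (cases "t \<le> x")
      case True
      have "AE y in lebesgue. y \<noteq> t" by (rule AE_I[where N="{t}"]) auto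
      then have "?c \<le> ennreal DK * Th f x"
        unfolding Th_def using t True by (intro Q_le) (auto elim!: eventually_mono)
      then have "?c powe r * u x \<le> (ennreal DK * Th f x) powe r * u x"
        by (intro mult_right_mono powe_mono r) auto
      then show ?thesis using True by simp
    qed simp
  qed
  finally show ?thesis .
qed

lemma tail_ht_le:
  assumes t: "0 < t"
  shows "U t powe (1 / r) * ht t \<le> ennreal DK * CT"
proof -
  have "U t powe (1 / r) \<noteq> 0" "U t powe (1 / r) < top"
    using tail_pos[OF t] tail_fin[OF t] by auto
  then obtain c where c: "U t powe (1 / r) = ennreal c" "0 < c"
    by (cases "U t powe (1 / r)") (auto simp: ennreal_eq_0_iff not_le)
  have cinv: "x = ennreal (1 / c) * (ennreal c * x)" for x
    using c by (simp add: mult.assoc[symmetric] ennreal_mult[symmetric])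
  have "ht t \<le> ennreal (DK / c) * CT"
    unfolding ht_def CT_def
  proof (rule least_const_mono)
    fix f
    have "Q {0<..t} t (tail f) \<le> ennreal (1 / c) * (ennreal DK * NT f)"
      using tail_Q_le_NT[OF t, of f] unfolding c
      by (subst cinv) (intro mult_left_mono, auto)
    then show "Q {0<..t} t (tail f) \<le> ennreal (DK / c) * NT f"
      using c DK by (simp add: mult.assoc[symmetric] ennreal_mult[symmetric])
  qed (use c DK in auto)
  then have "ennreal c * ht t \<le> ennreal c * (ennreal (DK / c) * CT)"
    by (intro mult_left_mono) auto
  also have "\<dots> = ennreal DK * CT"
    using c DK by (simp add: mult.assoc[symmetric] ennreal_mult[symmetric])
  finally show ?thesis using c by simp
qed

lemma b2_le_case1:
  assumes "p \<le> r"
  shows "b2 \<le> ennreal DK * CT"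
  using assms tail_ht_le by (auto simp: b2_def intro!: SUP_least)

section \<open>Necessity of the block condition for r < p\<close>

lemma Mplus_measurable: "f \<in> Mplus \<Longrightarrow> (\<lambda>x. indicator {0..} x * f x) \<in> borel_measurable lebesgue"
  by (simp add: Mplus_iff)

lemma V_measurable:
  assumes "f \<in> Mplus"
  shows "(\<lambda>x. f x powe p * v x * indicator {0..} x) \<in> borel_measurable lebesgue"
proof -
  have "(\<lambda>x. f x powe p * v x) \<in> borel_measurable (lebesgue_on {0..})"
    using assms v_Mplus unfolding Mplus_def by measurable
  then show ?thesis by (simp add: borel_measurable_restrict_space_iff_ennreal)
qed

lemma V_cmult: "f \<in> Mplus \<Longrightarrow> V (\<lambda>z. c * f z) = c powe p * V f"
  unfolding V_def by (subst nn_integral_cmult[symmetric, OF V_measurable]) (auto simp: powe_mult mult_ac)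

lemma V_mono: "(\<And>z. f z \<le> g z) \<Longrightarrow> V f \<le> V g"
  unfolding V_def using p by (intro nn_integral_mono mult_right_mono powe_mono) auto

lemma tail_cmult:
  assumes "f \<in> Mplus" "0 \<le> x"
  shows "tail (\<lambda>z. c * f z) x = c * tail f x"
proof -
  have "tail g x = (\<integral>\<^sup>+z. (indicator {0..} z * g z) * indicator {x..} z \<partial>lebesgue)" for g
    unfolding tail_def using assms(2) by (intro nn_integral_cong) (auto split: split_indicator)
  note eq = this
  have "(\<lambda>z. (indicator {0..} z * f z) * indicator {x..} z) \<in> borel_measurable lebesgue"
    by (intro borel_measurable_times_ennreal[OF Mplus_measurable[OF assms(1)]]
        borel_measurable_indicator) auto
  then show ?thesis
    unfolding eq by (subst nn_integral_cmult[symmetric]) (auto simp: mult_ac)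
qed

lemma Mplus_mult_indicator:
  assumes "f \<in> Mplus" "A \<in> sets lebesgue"
  shows "(\<lambda>z. f z * indicator A z) \<in> Mplus"
proof -
  have "(\<lambda>x. (indicator {0..} x * f x) * indicator A x) \<in> borel_measurable lebesgue"
    using assms(2) by (intro borel_measurable_times_ennreal[OF Mplus_measurable[OF assms(1)]]
        borel_measurable_indicator) auto
  then show ?thesis by (simp add: Mplus_iff mult.assoc)
qed

lemma Mplus_cmult: "f \<in> Mplus \<Longrightarrow> (\<lambda>z. c * f z) \<in> Mplus"
  unfolding Mplus_def by measurable

definition Qb :: "real \<Rightarrow> real \<Rightarrow> real \<Rightarrow> (real \<Rightarrow> ennreal) \<Rightarrow> ennreal" where
  "Qb a b c f = Q {a<..b} b (tail (\<lambda>z. f z * indicator {..c} z))"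

lemma bn_Qb: "bn a b c = least_const (Qb a b c) (ennreal p) v"
  by (simp add: bn_def Qb_def[abs_def])

text \<open>The factor \<open>DK\<close> is the price of moving the right end point, at which the
  kernel is evaluated.\<close>

lemma Qb_mono:
  assumes "0 \<le> a'" "a' \<le> a" "0 \<le> b" "b \<le> b'" "c \<le> c'" "\<And>z. f z \<le> g z"
  shows "Qb a b c f \<le> ennreal DK * Qb a' b' c' g"
  unfolding Qb_def using assms
  by (intro Q_le tail_mono mult_mono) (auto split: split_indicator)

lemma Qb_mono_fun:
  assumes "0 \<le> b" "\<And>z. f z \<le> g z"
  shows "Qb a b c f \<le> Qb a b c g"
  unfolding Qb_def using assms
  by (intro Q_mono tail_mono mult_mono) (auto split: split_indicator)

lemma bn_mono:
  assumes "0 \<le> a'" "a' \<le> a" "0 \<le> b" "b \<le> b'" "c \<le> c'"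
  shows "bn a b c \<le> ennreal DK * bn a' b' c'"
  unfolding bn_Qb using assms DK by (intro least_const_mono Qb_mono) auto

lemma Qb_cmult:
  assumes "f \<in> Mplus" "0 \<le> a" "0 \<le> b"
  shows "Qb a b c (\<lambda>z. d * f z) = d * Qb a b c f"
proof -
  have "Qb a b c (\<lambda>z. d * f z) = Q {a<..b} b (\<lambda>y. d * tail (\<lambda>z. f z * indicator {..c} z) y)"
    unfolding Qb_def Q_def
  proof (rule arg_cong[where f = "Lq q"], rule ext)
    fix y
    have "tail (\<lambda>z. d * f z * indicator {..c} z) y = d * tail (\<lambda>z. f z * indicator {..c} z) y" if "a < y"
      using tail_cmult[OF Mplus_mult_indicator[OF assms(1), of "{..c}"], of y d] that assms(2)
      by (simp add: mult.assoc)
    then show "indicator {a<..b} y * (K b y * W y * tail (\<lambda>z. d * f z * indicator {..c} z) y) =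
         indicator {a<..b} y * (K b y * W y * (d * tail (\<lambda>z. f z * indicator {..c} z) y))"
      by (auto split: split_indicator)
  qed
  also have "\<dots> = d * Qb a b c f"
    unfolding Qb_def using assms(3) by (intro Q_cmult) auto
  finally show ?thesis .
qed

lemma bn_near_extremal:
  assumes "0 < bn a b c" "bn a b c < top" "0 \<le> a" "0 \<le> b"
  obtains f where "f \<in> Mplus" "V f \<le> 1" "bn a b c / 2 \<le> Qb a b c f"
proof -
  obtain f where f: "f \<in> Mplus" "0 < wnorm (ennreal p) v f" "wnorm (ennreal p) v f < top"
    "bn a b c / 2 * wnorm (ennreal p) v f \<le> Qb a b c f"
    using least_const_near_extremal[of "Qb a b c" "ennreal p" v] assms(1,2) unfolding bn_Qb by metis
  define n where "n = wnorm (ennreal p) v f"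
  have n: "n \<noteq> 0" "n \<noteq> top" using f by (auto simp: n_def)
  have inv: "inverse n * n = 1"
    using n by (simp add: mult.commute divide_ennreal_def[symmetric] ennreal_divide_self less_top)
  have "V f = n powe p" using p by (simp add: n_def wnorm_V powe_powe)
  then have "V (\<lambda>z. inverse n * f z) = (inverse n * n) powe p"
    using f(1) by (simp add: V_cmult powe_mult)
  then have 1: "V (\<lambda>z. inverse n * f z) \<le> 1" by (simp add: inv)
  have "bn a b c / 2 = inverse n * (bn a b c / 2 * n)"
    using inv by (metis mult.left_commute mult.right_neutral mult.commute)
  also have "\<dots> \<le> inverse n * Qb a b c f"
    using f(4) by (intro mult_left_mono) (auto simp: n_def)
  also have "\<dots> = Qb a b c (\<lambda>z. inverse n * f z)"
    using Qb_cmult[OF f(1) assms(3,4)] by simp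
  finally have "bn a b c / 2 \<le> Qb a b c (\<lambda>z. inverse n * f z)" .
  then show ?thesis using f(1) 1 by (intro that[of "\<lambda>z. inverse n * f z"] Mplus_cmult)
qed

lemma NT_powe: "NT f powe r = (\<integral>\<^sup>+x\<in>{0..}. Th f x powe r * u x \<partial>lebesgue)"
  using r by (simp add: NT_def powe_powe)

lemma bounded_operator:
  assumes "CT < top" "f \<in> Mplus" "V f < top"
  shows "NT f powe r \<le> CT powe r * V f powe (r / p)"
proof -
  have "NT f \<le> CT * V f powe (1 / p)"
    using least_const_bound[of NT "ennreal p" v f] assms by (simp add: CT_def wnorm_V)
  then have "NT f powe r \<le> (CT * V f powe (1 / p)) powe r" by (rule powe_mono[OF r])
  then show ?thesis by (simp add: powe_mult powe_powe)
qed

text \<open>Positivity of \<open>X k\<close> puts it strictly below \<open>X (k + 1)\<close> and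
  hence below x, so the closed right end of the block fits into the open range of
  \<open>Th\<close>.\<close>

lemma Qb_le_Th:
  assumes "0 < X k" "x \<in> blk (k + 1)"
  shows "Qb (X j) (X k) c f \<le> ennreal DK * Th f x"
proof -
  have x: "X k < x" using X_strict[OF assms(1)] assms(2) by (auto simp: blk_def)
  show ?thesis
    unfolding Qb_def Th_def using x assms(1) X_nonneg[of j]
    by (intro Q_le tail_mono) (auto split: split_indicator simp del: X_nonneg)
qed

lemma s_pos: "r < p \<Longrightarrow> 0 < s"
  using r p by (simp add: s_def frac_less2)

text \<open>The first identity matches the weight in \<open>b2\<close> with the levels, the second
  is the conjugacy of p / r and s / r, and the third makes the coefficients
  \<open>b k powe (1 / p)\<close> reproduce \<open>b k\<close> in the duality argument.\<close>

lemma s_exponents: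
  assumes "r < p"
  shows "s / r = 1 + s / p" "r / p + r / s = 1" "s * (r / p) + r = s"
proof -
  have *: "s = p * r / (p - r)" using assms r p by (simp add: s_def field_simps)
  show "s / r = 1 + s / p" "r / p + r / s = 1" "s * (r / p) + r = s"
    using assms r p by (auto simp: * field_simps)
qed

text \<open>
  Near-extremal functions of finitely many blocks are superposed by a weighted maximum, whose norm is
  controlled without any condition on their supports.
\<close>

lemma block_sum_le:
  fixes J :: "int set"
  defines "h \<equiv> \<lambda>k. bn (X (k - 1)) (X (k + 3)) (X (k + 4))"
  defines "b \<equiv> \<lambda>k. (lev k powe (1 / r) * h k) powe s"
  assumes rp: "r < p" and fin: "CT < top" and J: "finite J" "\<And>k. k \<in> J \<Longrightarrow> 0 < X (k + 1) \<and> 0 < h k"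
  shows "sum b J \<le> (ennreal (32 * (2 * DK) powr r) * CT powe r) powe (s / r)"
proof (cases "J = {}")
  case False
  have Xpos: "0 < X (k + int i)" if "k \<in> J" "1 \<le> i" for k i
    using J(2)[OF that(1)] X_mono[of "k + 1" "k + int i"] that(2) by auto
  \<comment> \<open>\<open>tail_ht_le\<close> holds for all p and r; shortening the interval and
    truncating f can only decrease the functional.\<close>
  have hfin: "h k < top" if k: "k \<in> J" for k
  proof -
    have X3: "0 < X (k + 3)" using Xpos[OF k, of 3] by simp
    have "U (X (k + 3)) powe (1 / r) * ht (X (k + 3)) < top"
      using fin by (intro le_less_trans[OF tail_ht_le[OF X3]]) (auto simp: ennreal_mult_less_top)
    then have "ht (X (k + 3)) < top"
      using U_X[OF X3] by (auto simp: less_top[symmetric] ennreal_mult_eq_top_iff)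
    moreover have "h k \<le> ennreal 1 * ht (X (k + 3))"
      unfolding h_def bn_Qb ht_def
    proof (rule least_const_mono)
      fix f
      show "Qb (X (k - 1)) (X (k + 3)) (X (k + 4)) f \<le> ennreal 1 * Q {0<..X (k + 3)} (X (k + 3)) (tail f)"
        using X_nonneg[of "k - 1"] X_nonneg[of "k + 3"] unfolding Qb_def ennreal_1 mult_1
        by (intro Q_mono tail_mono) (auto split: split_indicator simp del: X_nonneg)
    qed simp
    ultimately show ?thesis by auto
  qed
  have "\<forall>k\<in>J. \<exists>f. f \<in> Mplus \<and> V f \<le> 1 \<and> h k / 2 \<le> Qb (X (k - 1)) (X (k + 3)) (X (k + 4)) f"
  proof
    fix k assume k: "k \<in> J"
    show "\<exists>f. f \<in> Mplus \<and> V f \<le> 1 \<and> h k / 2 \<le> Qb (X (k - 1)) (X (k + 3)) (X (k + 4)) f"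
      using J(2)[OF k] hfin[OF k] unfolding h_def by (meson X_nonneg bn_near_extremal)
  qed
  then obtain f where f: "\<And>k. k \<in> J \<Longrightarrow> f k \<in> Mplus" "\<And>k. k \<in> J \<Longrightarrow> V (f k) \<le> 1"
    "\<And>k. k \<in> J \<Longrightarrow> h k / 2 \<le> Qb (X (k - 1)) (X (k + 3)) (X (k + 4)) (f k)" by metis
  \<comment> \<open>The exponent 1 / p turns each coefficient into \<open>b k\<close> after taking
    p-th powers. The maximum of the powers is at most their sum, which bounds \<open>V g\<close> by
    the sum of the \<open>b k\<close>.\<close>
  define g where "g z = (SUP k\<in>J. b k powe (1 / p) * f k z)" for z
  have g: "g \<in> Mplus"
    using f(1) J(1) unfolding g_def[abs_def] Mplus_def
    by (intro borel_measurable_SUP countable_finite borel_measurable_times_ennreal borel_measurable_const) auto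
  have "V g \<le> (\<integral>\<^sup>+x. (\<Sum>k\<in>J. b k * (f k x powe p * v x * indicator {0..} x)) \<partial>lebesgue)"
    unfolding V_def
  proof (rule nn_integral_mono)
    fix x :: real
    have "g x powe p = (SUP k\<in>J. (b k powe (1 / p) * f k x) powe p)"
      unfolding g_def using p False by (intro powe_SUP) auto
    also have "\<dots> \<le> (\<Sum>k\<in>J. b k * f k x powe p)"
    proof (rule SUP_least)
      fix k assume "k \<in> J"
      then show "(b k powe (1 / p) * f k x) powe p \<le> (\<Sum>k\<in>J. b k * f k x powe p)"
        using J(1) p member_le_sum[of k J "\<lambda>k. b k * f k x powe p"] by (simp add: powe_mult powe_powe)
    qed
    finally have "g x powe p * (v x * indicator {0..} x) \<le> (\<Sum>k\<in>J. b k * f k x powe p) * (v x * indicator {0..} x)"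
      by (rule mult_right_mono) simp
    then show "g x powe p * v x * indicator {0..} x \<le> (\<Sum>k\<in>J. b k * (f k x powe p * v x * indicator {0..} x))"
      by (simp add: sum_distrib_right mult.assoc)
  qed
  also have "\<dots> = (\<Sum>k\<in>J. b k * V (f k))"
    using f(1) V_measurable unfolding V_def by (subst nn_integral_sum) (auto simp: nn_integral_cmult)
  also have "\<dots> \<le> (\<Sum>k\<in>J. b k * 1)"
    using f(2) by (intro sum_mono mult_left_mono) auto
  finally have Vg: "V g \<le> sum b J" by simp
  define \<beta> where "\<beta> = sum b J"
  have bfin: "b k < top" "b k \<noteq> 0" if "k \<in> J" for k
    using hfin[OF that] J(2)[OF that] by (auto simp: b_def ennreal_mult_less_top)
  have \<beta>: "\<beta> < top" "\<beta> \<noteq> 0"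
    using bfin J(1) False by (auto simp: \<beta>_def)
  \<comment> \<open>The k-th function is tested on block k + 4, all of whose points lie beyond
    \<open>X (k + 3)\<close>. The factor 1 / DK compensates \<open>Qb_le_Th\<close>, and the half
    stems from near-extremality.\<close>
  define c where "c j = (if j - 4 \<in> J then (ennreal (1 / DK) * (b (j - 4) powe (1 / p) * (h (j - 4) / 2))) powe r else 0)" for j
  have "zsum (\<lambda>j. mass j * c j) \<le> (\<integral>\<^sup>+x\<in>{0..}. Th g x powe r * u x \<partial>lebesgue)"
  proof (rule step_le_integral)
    fix j x assume x: "x \<in> blk j"
    show "u x * c j \<le> Th g x powe r * u x"
    proof (cases "j - 4 \<in> J")
      case True
      define k where "k = j - 4"
      have k: "k \<in> J" "x \<in> blk ((k + 3) + 1)" using True x by (auto simp: k_def)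
      have "b k powe (1 / p) * (h k / 2) \<le> b k powe (1 / p) * Qb (X (k - 1)) (X (k + 3)) (X (k + 4)) (f k)"
        using f(3)[OF k(1)] by (intro mult_left_mono) auto
      also have "\<dots> = Qb (X (k - 1)) (X (k + 3)) (X (k + 4)) (\<lambda>z. b k powe (1 / p) * f k z)"
        using f(1)[OF k(1)] by (intro Qb_cmult[symmetric]) auto
      also have "\<dots> \<le> Qb (X (k - 1)) (X (k + 3)) (X (k + 4)) g"
        using k(1) by (intro Qb_mono_fun) (auto simp: g_def intro: SUP_upper2)
      also have "\<dots> \<le> ennreal DK * Th g x"
        using Xpos[OF k(1), of 3] k(2) by (intro Qb_le_Th) auto
      finally have "ennreal (1 / DK) * (b k powe (1 / p) * (h k / 2)) \<le> ennreal (1 / DK) * (ennreal DK * Th g x)"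
        by (rule mult_left_mono) simp
      also have "\<dots> = Th g x"
        using DK by (simp add: mult.assoc[symmetric] ennreal_mult[symmetric])
      finally have "c j \<le> Th g x powe r"
        using k(1) r by (simp add: c_def k_def powe_mono)
      then show ?thesis
        using mult_right_mono[of "c j" "Th g x powe r" "u x"] by (simp add: mult.commute)
    qed (simp add: c_def)
  qed
  also have "\<dots> \<le> CT powe r * \<beta> powe (r / p)"
  proof -
    have "(\<integral>\<^sup>+x\<in>{0..}. Th g x powe r * u x \<partial>lebesgue) \<le> CT powe r * V g powe (r / p)"
      using bounded_operator[OF fin g] Vg \<beta> unfolding NT_powe \<beta>_def by (auto intro: le_less_trans)
    also have "\<dots> \<le> CT powe r * \<beta> powe (r / p)"
      using Vg r p unfolding \<beta>_def by (intro mult_left_mono powe_mono) auto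
    finally show ?thesis .
  qed
  finally have 1: "zsum (\<lambda>j. mass j * c j) \<le> CT powe r * \<beta> powe (r / p)" .
  let ?E = "ennreal (32 * (2 * DK) powr r)"
  \<comment> \<open>The factor 32 is 2^5, relating \<open>lev k\<close> to the mass
    \<open>lev (k + 5)\<close> of block k + 4; \<open>2 * DK\<close> undoes the factors built into
    \<open>c\<close>.\<close>
  have bk: "b k = ?E * (mass (k + 4) * c (k + 4))" if k: "k \<in> J" for k
  proof -
    define y where "y = lev k powe (1 / r) * h k"
    have m: "mass (k + 4) = lev (k + 5)" using Xpos[OF k, of 5] by (simp add: mass_def add.assoc)
    have "lev k = ennreal 32 * lev (k + 5)" using lev_shift[of "k + 5" 5] by simp
    moreover have "ennreal (2 * DK) * (ennreal (1 / DK) * (b k powe (1 / p) * (h k / 2))) = b k powe (1 / p) * h k"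
    proof -
      have "ennreal (2 * DK) * ennreal (1 / DK) = 2" using DK by (simp add: ennreal_mult[symmetric])
      moreover have "2 * (h k / 2) = h k" using ennreal_mult_divide_eq[of 2 "h k"] by (simp add: ennreal_times_divide mult.commute)
      ultimately show ?thesis by (metis mult.assoc mult.left_commute)
    qed
    ultimately have "?E * (mass (k + 4) * c (k + 4)) = lev k * (b k powe (1 / p) * h k) powe r"
    proof -
      assume l: "lev k = ennreal 32 * lev (k + 5)"
        and e: "ennreal (2 * DK) * (ennreal (1 / DK) * (b k powe (1 / p) * (h k / 2))) = b k powe (1 / p) * h k"
      have "?E = ennreal 32 * ennreal (2 * DK) powe r"
        using DK powe_ennreal[of "2 * DK" r] ennreal_mult[of 32 "(2 * DK) powr r"] by simp
      then have "?E * (mass (k + 4) * c (k + 4)) = (ennreal 32 * lev (k + 5)) *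
          (ennreal (2 * DK) * (ennreal (1 / DK) * (b k powe (1 / p) * (h k / 2)))) powe r"
        using k by (simp add: m c_def powe_mult mult_ac)
      then show ?thesis unfolding l[symmetric] e .
    qed
    also have "\<dots> = b k powe (r / p) * y powe r"
      using r by (simp add: y_def powe_mult powe_powe mult_ac)
    also have "\<dots> = y powe (s * (r / p) + r)"
      by (simp add: b_def y_def[symmetric] powe_powe powe_add_exponent)
    also have "\<dots> = b k" by (simp only: s_exponents[OF rp] b_def y_def)
    finally show ?thesis by simp
  qed
  have "\<beta> = ?E * (\<Sum>k\<in>J. mass (k + 4) * c (k + 4))"
    unfolding \<beta>_def sum_distrib_left by (intro sum.cong bk refl)
  also have "(\<Sum>k\<in>J. mass (k + 4) * c (k + 4)) \<le> zsum (\<lambda>j. mass j * c j)"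
    using sum_le_zsum[OF J(1), of "\<lambda>k. mass (k + 4) * c (k + 4)"] zsum_shift[of "\<lambda>j. mass j * c j" 4] by simp
  also note 1
  finally have "\<beta> \<le> ?E * CT powe r * \<beta> powe (r / p)" by (simp add: mult_left_mono mult.assoc)
  moreover have "\<beta> = \<beta> powe (r / s) * \<beta> powe (r / p)"
    by (simp add: powe_add_exponent[symmetric] add.commute s_exponents[OF rp])
  \<comment> \<open>The common power of \<beta> can be cancelled because \<beta> is finite and
    positive; this is why J is finite and consists of indices with positive norm.\<close>
  ultimately have "\<beta> powe (r / p) * \<beta> powe (r / s) \<le> \<beta> powe (r / p) * (?E * CT powe r)"
    by (simp add: mult.commute)
  then have "\<beta> powe (r / s) \<le> ?E * CT powe r"
    using \<beta> by (subst (asm) ennreal_mult_le_mult_iff) auto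
  then have "\<beta> \<le> (?E * CT powe r) powe (1 / (r / s))"
    using r s_pos[OF rp] by (intro powe_le_of_le_powe) auto
  then show ?thesis by (simp add: \<beta>_def)
qed simp

text \<open>The leading \<open>DK\<close> pays for replacing the points given by \<open>zeta\<close>
  and \<open>zeta_inv\<close> by cut points; the rest comes from
  \<open>block_sum_le\<close>.\<close>

definition nec_const :: real where
  "nec_const = DK * (32 * (2 * DK) powr r) powr (1 / r)"

lemma b2_le_case2:
  assumes rp: "r < p"
  shows "b2 \<le> ennreal nec_const * CT"
proof (cases "CT = top")
  case True
  have "nec_const > 0" using DK by (simp add: nec_const_def)
  with True show ?thesis by (simp add: ennreal_mult_top)
next
  case False
  then have fin: "CT < top" by (simp add: less_top)
  note s = s_pos[OF rp]
  \<comment> \<open>For x in block k, \<open>zeta_inv u x\<close> is at least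
    \<open>X (k - 1)\<close>, while the second and third iterates of \<open>zeta\<close> stay below
    \<open>X (k + 3)\<close> and \<open>X (k + 4)\<close>.\<close>
  define h where "h k = bn (X (k - 1)) (X (k + 3)) (X (k + 4))" for k
  define b where "b k = (lev k powe (1 / r) * h k) powe s" for k
  define e where "e = 32 * (2 * DK) powr r"
  have e: "0 < e" using DK by (simp add: e_def)
  have "(\<integral>\<^sup>+x\<in>{0..}. u x * (U x powe (s / p))
       * (bn (zeta_inv u x) (zeta u (zeta u x)) (zeta u (zeta u (zeta u x))) powe s) \<partial>lebesgue)
     \<le> zsum (\<lambda>k. mass k * (lev k powe (s / p) * (ennreal DK * h k) powe s))"
  proof (rule integral_le_step)
    fix k x assume x: "x \<in> blk k"
    note z1 = zeta_blk[OF x]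
    note z2 = zeta_blk[OF z1]
    note z3 = zeta_blk[OF z2]
    have "bn (zeta_inv u x) (zeta u (zeta u x)) (zeta u (zeta u (zeta u x))) \<le> ennreal DK * h k"
      unfolding h_def using zeta_inv_bounds(1)[OF x] z2 z3
      by (intro bn_mono) (auto simp: blk_def add.assoc)
    moreover have "U x \<le> lev k" by (rule blk_U(1)[OF x])
    ultimately have "(U x powe (s / p)) * (bn (zeta_inv u x) (zeta u (zeta u x)) (zeta u (zeta u (zeta u x))) powe s)
       \<le> lev k powe (s / p) * (ennreal DK * h k) powe s"
      using s p by (intro mult_mono powe_mono) auto
    then show "u x * (U x powe (s / p)) * (bn (zeta_inv u x) (zeta u (zeta u x)) (zeta u (zeta u (zeta u x))) powe s)
       \<le> u x * (lev k powe (s / p) * (ennreal DK * h k) powe s)"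
      unfolding mult.assoc by (rule mult_left_mono) simp
  qed
  \<comment> \<open>Indices with an empty block or a vanishing norm contribute nothing; on the
    others \<open>block_sum_le\<close> applies to every finite window.\<close>
  also have "\<dots> \<le> zsum (\<lambda>k. ennreal DK powe s * (if 0 < X (k + 1) \<and> 0 < h k then b k else 0))"
  proof (rule zsum_mono)
    fix k
    show "mass k * (lev k powe (s / p) * (ennreal DK * h k) powe s)
       \<le> ennreal DK powe s * (if 0 < X (k + 1) \<and> 0 < h k then b k else 0)"
    proof (cases "0 < X (k + 1) \<and> 0 < h k")
      case True
      have "mass k * lev k powe (s / p) \<le> lev k powe 1 * lev k powe (s / p)"
        using lev_antimono[of k "k + 1"] by (intro mult_right_mono) (auto simp: mass_def)
      also have "\<dots> = lev k powe (s / r)"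
        by (simp only: powe_add_exponent[symmetric] s_exponents(1)[OF rp])
      finally have "mass k * lev k powe (s / p) * (ennreal DK powe s * h k powe s)
         \<le> lev k powe (s / r) * (ennreal DK powe s * h k powe s)"
        by (rule mult_right_mono) simp
      then show ?thesis using True by (simp add: b_def powe_mult powe_powe mult_ac)
    next
      case False
      then show ?thesis using s by (auto simp: mass_def)
    qed
  qed
  also have "\<dots> \<le> ennreal DK powe s * (ennreal e * CT powe r) powe (s / r)"
    unfolding zsum_cmult
  proof (intro mult_left_mono zsum_le)
    fix n :: nat
    let ?J = "{- int n..int n} \<inter> {k. 0 < X (k + 1) \<and> 0 < h k}"
    have "(\<Sum>k\<in>{- int n..int n}. if 0 < X (k + 1) \<and> 0 < h k then b k else 0) = sum b ?J"
      by (subst sum.inter_restrict) auto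
    also have "\<dots> \<le> (ennreal e * CT powe r) powe (s / r)"
      unfolding b_def h_def e_def by (intro block_sum_le rp fin) auto
    finally show "(\<Sum>k = - int n..int n. if 0 < X (k + 1) \<and> 0 < h k then b k else 0)
       \<le> (ennreal e * CT powe r) powe (s / r)" .
  qed simp
  finally have "b2 \<le> (ennreal DK powe s * (ennreal e * CT powe r) powe (s / r)) powe (1 / s)"
    using rp s unfolding b2_def by (simp add: powe_mono)
  also have "\<dots> = ennreal nec_const * CT"
  proof -
    have "nec_const = DK * e powr (1 / r)" by (simp add: nec_const_def e_def)
    then show ?thesis
      using s r DK e by (simp add: powe_mult powe_powe powe_ennreal powr_powr ennreal_mult mult_ac)
  qed
  finally show ?thesis .
qed

subsection \<open>The sufficient conditions\<close>

text \<open>The r-th power of the discretised outer norm: \<open>lev k\<close> bounds the mass of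
  block k - 1, which ends at \<open>X k\<close>.\<close>

definition Zr :: "(int \<Rightarrow> ennreal) \<Rightarrow> ennreal" where
  "Zr e = zsum (\<lambda>k. lev k * e k powe r)"

lemma Zr_mono: "(\<And>k. a k \<le> b k) \<Longrightarrow> Zr a \<le> Zr b"
  unfolding Zr_def by (intro zsum_mono mult_left_mono powe_mono r) auto

lemma Zr_cmult: "Zr (\<lambda>k. c * a k) = c powe r * Zr a"
  unfolding Zr_def zsum_cmult[symmetric] by (simp add: powe_mult mult_ac)

lemma Zr_add: "Zr (\<lambda>k. a k + b k) \<le> ennreal (2 powr r) * (Zr a + Zr b)"
proof -
  have "Zr (\<lambda>k. a k + b k) \<le> zsum (\<lambda>k. ennreal (2 powr r) * (lev k * a k powe r + lev k * b k powe r))"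
    unfolding Zr_def
  proof (rule zsum_mono)
    fix k
    show "lev k * (a k + b k) powe r \<le> ennreal (2 powr r) * (lev k * a k powe r + lev k * b k powe r)"
      using mult_left_mono[OF powe_add_le[OF r, of "a k" "b k"], of "lev k"]
      by (simp add: distrib_left mult_ac)
  qed
  then show ?thesis by (simp add: zsum_cmult zsum_add Zr_def)
qed

lemma Zr_shift_le: "Zr (\<lambda>k. a (k - 1)) \<le> Zr a"
proof -
  have "Zr (\<lambda>k. a (k - 1)) \<le> zsum (\<lambda>k. lev (k + - 1) * a (k + - 1) powe r)"
    unfolding Zr_def using lev_antimono by (intro zsum_mono mult_mono) auto
  also have "\<dots> = Zr a" unfolding Zr_def by (rule zsum_shift)
  finally show ?thesis .
qed

abbreviation "d \<equiv> ennreal DK"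
abbreviation "c \<equiv> ennreal CN"

text \<open>The offset between \<open>X (k - 1)\<close> in the kernel and \<open>X (k - 2)\<close>
  in the range is deliberate: for x in block k, applying \<open>zeta_inv\<close> twice gives a point
  between these two, so both factors are controlled by the integrand of \<open>b1\<close>.\<close>

definition E :: "(real \<Rightarrow> ennreal) \<Rightarrow> int \<Rightarrow> ennreal" where
  "E f k = K (X k) (X (k - 1)) * R {0<..X (k - 2)} (tail f) + Q {X (k - 2)<..X k} (X k) (tail f)"

text \<open>The inhomogeneous term of a recursion over M blocks; kernel and range use the same cut
  point here, as the Oinarov splitting produces it.\<close>

definition G :: "(real \<Rightarrow> ennreal) \<Rightarrow> nat \<Rightarrow> int \<Rightarrow> ennreal" where
  "G f M k = K (X k) (X (k - int M)) * R {0<..X (k - int M)} (tail f)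
     + Q {X (k - int M)<..X k} (X k) (tail f)"

text \<open>The truncation at \<open>X m\<close> makes this vanish for k at most m, which gives
  \<open>zsum_absorb\<close> its starting point.\<close>

definition S :: "(real \<Rightarrow> ennreal) \<Rightarrow> int \<Rightarrow> int \<Rightarrow> ennreal" where
  "S f m k = Q {X m<..X k} (X k) (tail f)"

lemma R_mono: "A \<in> sets lebesgue \<Longrightarrow> A \<subseteq> B \<Longrightarrow> R A (tail f) \<le> R B (tail f)"
  by (intro R_mono_AE) auto

text \<open>The range of \<open>R\<close> is one block longer than in \<open>E\<close>. On that
  additional block \<open>K_R_le_Q\<close> converts the product into a local term.\<close>

lemma G_base: "G f 1 k \<le> (c * (1 + d) + 1) * E f k"
proof -
  have X1: "X (k - 1) \<le> X k" "X (k - 2) \<le> X (k - 1)" by (auto intro: X_mono)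
  let ?K = "K (X k) (X (k - 1))" and ?A = "{X (k - 2)<..X (k - 1)}"
  have sub: "?A \<subseteq> {0..X (k - 1)}" using X_nonneg[of "k - 2"] by (auto simp del: X_nonneg)
  have "?K * R {0<..X (k - 1)} (tail f) \<le> ?K * (c * (R {0<..X (k - 2)} (tail f) + R ?A (tail f)))"
    by (intro mult_left_mono R_union) auto
  also have "\<dots> = c * (?K * R {0<..X (k - 2)} (tail f) + ?K * R ?A (tail f))"
    by (simp add: distrib_left mult_ac)
  also have "\<dots> \<le> c * (E f k + d * E f k)"
  proof (intro mult_left_mono add_mono)
    show "?K * R {0<..X (k - 2)} (tail f) \<le> E f k" by (simp add: E_def)
    have "?K * R ?A (tail f) \<le> d * Q ?A (X k) (tail f)"
      using X1 sub by (intro K_R_le_Q) auto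
    also have "Q ?A (X k) (tail f) \<le> Q {X (k - 2)<..X k} (X k) (tail f)"
      using X1 by (intro Q_mono) auto
    also have "\<dots> \<le> E f k" by (simp add: E_def)
    finally show "?K * R ?A (tail f) \<le> d * E f k" by (simp add: mult_left_mono)
  qed simp
  finally have 1: "?K * R {0<..X (k - 1)} (tail f) \<le> c * (E f k + d * E f k)" .
  have "Q {X (k - 1)<..X k} (X k) (tail f) \<le> Q {X (k - 2)<..X k} (X k) (tail f)"
    using X1 by (intro Q_mono) auto
  also have "\<dots> \<le> E f k" by (simp add: E_def)
  finally have "G f 1 k \<le> c * (E f k + d * E f k) + E f k"
    unfolding G_def using 1 by (simp add: add_mono)
  then show ?thesis by (simp add: distrib_left distrib_right mult.assoc)
qed

lemma Q_far_le:
  assumes "j \<le> k" and "0 \<le> a"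
  shows "Q {a<..X j} (X k) (tail f) \<le> c * d * (K (X k) (X j) * R {0<..X j} (tail f) + Q {a<..X j} (X j) (tail f))"
proof -
  have "Q {a<..X j} (X k) (tail f) \<le> ennreal (CN * DK) * (K (X k) (X j) * R {a<..X j} (tail f) + Q {a<..X j} (X j) (tail f))"
    using X_mono[OF assms(1)] assms(2) by (intro Q_split_le) auto
  also have "\<dots> \<le> ennreal (CN * DK) * (K (X k) (X j) * R {0<..X j} (tail f) + Q {a<..X j} (X j) (tail f))"
    using assms(2) by (intro mult_left_mono add_mono R_mono) auto
  finally show ?thesis using DK quasi_const_ge_1[of q] by (simp add: ennreal_mult)
qed

text \<open>Both the far kernel factor and the part of the norm to the left of
  \<open>X (k - 2)\<close> are split at \<open>X (k - 1)\<close>. For M at least 1 the range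
  concerned ends at \<open>X (k - 2)\<close> or earlier, where \<open>E\<close> controls
  \<open>R\<close>.\<close>

lemma G_step:
  assumes "1 \<le> M"
  shows "G f (Suc M) k \<le> (d + c * (c * d + 1)) * (E f k + G f M (k - 1))"
proof -
  let ?T = "E f k + G f M (k - 1)" and ?j = "k - int (Suc M)"
  have j: "k - 1 - int M = ?j" by simp
  have X1: "X (k - 1) \<le> X k" "X (k - 2) \<le> X (k - 1)" "X ?j \<le> X (k - 2)"
    using assms by (auto intro: X_mono)
  have "K (X k) (X ?j) * R {0<..X ?j} (tail f)
     \<le> d * (K (X k) (X (k - 1)) + K (X (k - 1)) (X ?j)) * R {0<..X ?j} (tail f)"
    using X1 by (intro mult_right_mono K_split) auto
  also have "\<dots> = d * (K (X k) (X (k - 1)) * R {0<..X ?j} (tail f) + K (X (k - 1)) (X ?j) * R {0<..X ?j} (tail f))"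
    by (simp add: distrib_left distrib_right mult_ac)
  also have "\<dots> \<le> d * ?T"
  proof (intro mult_left_mono add_mono)
    have "K (X k) (X (k - 1)) * R {0<..X ?j} (tail f) \<le> K (X k) (X (k - 1)) * R {0<..X (k - 2)} (tail f)"
      using X1 by (intro mult_left_mono R_mono) auto
    then show "K (X k) (X (k - 1)) * R {0<..X ?j} (tail f) \<le> E f k"
      unfolding E_def by (rule order_trans) simp
    show "K (X (k - 1)) (X ?j) * R {0<..X ?j} (tail f) \<le> G f M (k - 1)"
      unfolding G_def j by simp
  qed simp
  finally have 1: "K (X k) (X ?j) * R {0<..X ?j} (tail f) \<le> d * ?T" .
  have "Q {X ?j<..X k} (X k) (tail f) \<le> c * (Q {X ?j<..X (k - 2)} (X k) (tail f) + Q {X (k - 2)<..X k} (X k) (tail f))"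
    using X1 by (intro Q_union) auto
  also have "\<dots> \<le> c * (c * d * ?T + ?T)"
  proof (intro mult_left_mono add_mono)
    let ?A = "{X ?j<..X (k - 2)}"
    have A: "?A \<subseteq> {0<..X (k - 2)}" "?A \<subseteq> {0..X (k - 1)}"
      using X_nonneg[of ?j] X1 by (auto simp del: X_nonneg)
    have "Q ?A (X k) (tail f) \<le> ennreal (CN * DK) * (K (X k) (X (k - 1)) * R ?A (tail f) + Q ?A (X (k - 1)) (tail f))"
      using X1 A by (intro Q_split_le) auto
    also have "\<dots> \<le> ennreal (CN * DK) * ?T"
    proof (intro mult_left_mono add_mono)
      have "K (X k) (X (k - 1)) * R ?A (tail f) \<le> K (X k) (X (k - 1)) * R {0<..X (k - 2)} (tail f)"
        using A by (intro mult_left_mono R_mono) auto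
      then show "K (X k) (X (k - 1)) * R ?A (tail f) \<le> E f k"
        unfolding E_def by (rule order_trans) simp
      have "Q ?A (X (k - 1)) (tail f) \<le> Q {X ?j<..X (k - 1)} (X (k - 1)) (tail f)"
        using X1 by (intro Q_mono) auto
      then show "Q ?A (X (k - 1)) (tail f) \<le> G f M (k - 1)"
        unfolding G_def j by (rule order_trans) simp
    qed simp
    finally show "Q ?A (X k) (tail f) \<le> c * d * ?T"
      using DK quasi_const_ge_1[of q] by (simp add: ennreal_mult)
    have "Q {X (k - 2)<..X k} (X k) (tail f) \<le> E f k" by (simp add: E_def)
    also have "\<dots> \<le> ?T" by simp
    finally show "Q {X (k - 2)<..X k} (X k) (tail f) \<le> ?T" .
  qed simp
  finally have "G f (Suc M) k \<le> d * ?T + c * (c * d * ?T + ?T)"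
    unfolding G_def[of f "Suc M"] using 1 by (rule add_mono[rotated])
  then show ?thesis by (simp add: distrib_left distrib_right mult.assoc add_ac)
qed

primrec step_const :: "nat \<Rightarrow> ennreal" where
  "step_const 0 = (c * (1 + d) + 1) powe r"
| "step_const (Suc n) = (d + c * (c * d + 1)) powe r * (ennreal (2 powr r) * (1 + step_const n))"

lemma step_const_fin: "step_const n < top"
  by (induction n) (auto simp: ennreal_mult_less_top)

text \<open>Induction on the number of blocks; the shifted term costs nothing because the levels
  decrease.\<close>

lemma Zr_G: "Zr (G f (Suc n)) \<le> step_const n * Zr (E f)"
proof (induction n)
  case 0
  have "Zr (G f 1) \<le> Zr (\<lambda>k. (c * (1 + d) + 1) * E f k)" by (intro Zr_mono G_base)
  then show ?case by (simp add: Zr_cmult)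
next
  case (Suc n)
  have "Zr (G f (Suc (Suc n))) \<le> Zr (\<lambda>k. (d + c * (c * d + 1)) * (E f k + G f (Suc n) (k - 1)))"
    by (intro Zr_mono G_step) simp
  also have "\<dots> \<le> (d + c * (c * d + 1)) powe r * (ennreal (2 powr r) * (Zr (E f) + Zr (\<lambda>k. G f (Suc n) (k - 1))))"
    unfolding Zr_cmult by (intro mult_left_mono Zr_add) simp
  also have "\<dots> \<le> (d + c * (c * d + 1)) powe r * (ennreal (2 powr r) * (Zr (E f) + step_const n * Zr (E f)))"
    using Suc Zr_shift_le[of "G f (Suc n)"] by (intro mult_left_mono add_left_mono) auto
  finally show ?case by (simp add: distrib_right mult.assoc)
qed

section \<open>Recursion over many blocks and its absorption\<close>

lemma S_rec: "S f m k \<le> c * (c * d) * S f m (k - int M) + c * (c * d + 1) * G f M k"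
proof -
  let ?j = "k - int M"
  have X1: "X ?j \<le> X k" by (rule X_mono) simp
  have "S f m k \<le> c * (Q {X m<..X ?j} (X k) (tail f) + Q {X ?j<..X k} (X k) (tail f))"
    unfolding S_def by (intro Q_union) auto
  \<comment> \<open>The part more than M blocks below returns \<open>S\<close> at
    \<open>k - int M\<close> with the factor \<open>c * (c * d)\<close>, in which M does not
    occur.\<close>
  also have "\<dots> \<le> c * (c * d * (G f M k + S f m ?j) + G f M k)"
  proof (intro mult_left_mono add_mono)
    have "Q {X m<..X ?j} (X k) (tail f)
       \<le> c * d * (K (X k) (X ?j) * R {0<..X ?j} (tail f) + Q {X m<..X ?j} (X ?j) (tail f))"
      by (rule Q_far_le) auto
    also have "\<dots> \<le> c * d * (G f M k + S f m ?j)"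
      unfolding G_def S_def by (intro mult_left_mono add_right_mono) auto
    finally show "Q {X m<..X ?j} (X k) (tail f) \<le> c * d * (G f M k + S f m ?j)" .
  qed (auto simp: G_def)
  also have "\<dots> = c * (c * d) * S f m ?j + c * (c * d + 1) * G f M k"
    by (simp add: distrib_left distrib_right mult_ac add_ac)
  finally show ?thesis .
qed

text \<open>
  Over \<open>M\<close> dyadic levels the weight gains \<open>2\<^sup>-\<^sup>M\<close>, whereas the kernel loses a constant independent
  of \<open>M\<close>; this makes the recursion for \<open>S\<close> contractive.
\<close>

definition gap :: nat where
  "gap = (SOME n. 2 * (2 powr r * (CN * (CN * DK)) powr r) \<le> 2 ^ Suc n)"

lemma gap: "2 * (2 powr r * (CN * (CN * DK)) powr r) \<le> 2 ^ Suc gap"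
  unfolding gap_def
proof (rule someI_ex)
  obtain n where "2 * (2 powr r * (CN * (CN * DK)) powr r) < 2 ^ n"
    using real_arch_pow[of 2] by auto
  moreover have "(2::real) ^ n \<le> 2 ^ Suc n" by simp
  ultimately have "2 * (2 powr r * (CN * (CN * DK)) powr r) \<le> 2 ^ Suc n" by linarith
  then show "\<exists>n. 2 * (2 powr r * (CN * (CN * DK)) powr r) \<le> 2 ^ Suc n" ..
qed

text \<open>The outer 2 comes from \<open>zsum_absorb\<close>, the power of 2 from separating the
  two summands of \<open>S_rec\<close>, and \<open>step_const\<close> from unwinding
  \<open>G\<close>.\<close>

definition absorb_const :: ennreal where
  "absorb_const = 2 * (ennreal (2 powr r) * (c * (c * d + 1)) powe r * step_const gap)"

lemma absorb_const_fin: "absorb_const < top"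
  using step_const_fin by (auto simp: absorb_const_def ennreal_mult_less_top)

lemma Zr_S: "Zr (S f m) \<le> absorb_const * Zr (E f)"
proof -
  let ?M = "Suc gap"
  let ?a = "c * (c * d)" and ?b = "c * (c * d + 1)"
  let ?e = "\<lambda>k. ennreal (2 powr r) * ?b powe r * (lev k * G f ?M k powe r)"
  have "Zr (S f m) \<le> 2 * zsum ?e"
    unfolding Zr_def
  proof (rule zsum_absorb[where M = "int ?M" and m = m])
    show "0 < int ?M" by simp
    show "lev k * S f m k powe r = 0" if "k \<le> m" for k
      using X_mono[OF that] q by (simp add: S_def Q_def)
    fix k
    let ?S = "S f m (k - int ?M)"
    have a: "?a powe r = ennreal ((CN * (CN * DK)) powr r)"
      using DK quasi_const_ge_1[of q] by (simp add: ennreal_mult[symmetric] powe_ennreal)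
    have "2 * (ennreal (2 powr r) * ?a powe r) \<le> 2 ^ ?M"
    proof -
      have "2 * (ennreal (2 powr r) * ?a powe r) = ennreal (2 * (2 powr r * (CN * (CN * DK)) powr r))"
        unfolding a by (simp add: ennreal_mult)
      also have "\<dots> \<le> ennreal (2 ^ ?M)" by (intro ennreal_leI gap)
      also have "\<dots> = 2 ^ ?M" by (metis ennreal_numeral ennreal_power zero_le_numeral)
      finally show ?thesis .
    qed
    then have "2 * (ennreal (2 powr r) * ?a powe r) * lev k \<le> lev (k - int ?M)"
      unfolding lev_shift by (rule mult_right_mono) simp
    then have half: "ennreal (2 powr r) * ?a powe r * lev k \<le> lev (k - int ?M) / 2"
      using divide_right_mono_ennreal[of "2 * (ennreal (2 powr r) * ?a powe r) * lev k" "lev (k - int ?M)" 2]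
        ennreal_mult_divide_eq[of 2 "ennreal (2 powr r) * ?a powe r * lev k"]
      by (simp add: mult_ac)
    have "S f m k powe r \<le> (?a * ?S + ?b * G f ?M k) powe r"
      by (intro powe_mono r S_rec)
    also have "\<dots> \<le> ennreal (2 powr r) * ((?a * ?S) powe r + (?b * G f ?M k) powe r)"
      by (intro powe_add_le r)
    finally have "lev k * S f m k powe r \<le> lev k * (ennreal (2 powr r) * ((?a * ?S) powe r + (?b * G f ?M k) powe r))"
      by (intro mult_left_mono) auto
    also have "\<dots> = ennreal (2 powr r) * ?a powe r * lev k * ?S powe r + ?e k"
    proof -
      have "L * (t * ((a * x) powe r + (b * y) powe r)) = t * a powe r * L * x powe r + t * b powe r * (L * y powe r)"
        for L t a b x y by (simp add: powe_mult distrib_left mult_ac)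
      then show ?thesis .
    qed
    also have "\<dots> \<le> lev (k - int ?M) / 2 * ?S powe r + ?e k"
      by (intro add_right_mono mult_right_mono half) simp
    also have "lev (k - int ?M) / 2 * ?S powe r = lev (k - int ?M) * ?S powe r / 2"
      by (simp add: ennreal_divide_times ennreal_times_divide mult.commute)
    finally show "lev k * S f m k powe r \<le> lev (k - int ?M) * ?S powe r / 2 + ?e k" .
  qed
  also have "zsum ?e = ennreal (2 powr r) * ?b powe r * Zr (G f ?M)"
    by (simp add: zsum_cmult Zr_def)
  also have "\<dots> \<le> ennreal (2 powr r) * ?b powe r * (step_const gap * Zr (E f))"
    by (intro mult_left_mono Zr_G) simp
  finally show ?thesis by (simp add: absorb_const_def mult_left_mono mult.assoc)
qed

text \<open>Every positive y has a cut point strictly to its left, so the truncated intervals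
  exhaust (0, X k].\<close>

lemma S_limit: "Q {0<..X k} (X k) (tail f) \<le> (SUP n::nat. S f (- int n) k)"
proof -
  let ?h = "\<lambda>n y. indicator {X (- int n)<..X k} y * (K (X k) y * W y * tail f y)"
  have "Q {0<..X k} (X k) (tail f) = Lq q (\<lambda>y. SUP n. ?h n y)"
    unfolding Q_def
  proof (rule arg_cong[where f = "Lq q"], rule ext)
    fix y
    have "indicator {0<..X k} y = (SUP n::nat. indicator {X (- int n)<..X k} y :: ennreal)"
    proof (cases "y \<in> {0<..X k}")
      case True
      then obtain m where m: "X m \<le> y / 2" using X_to_0[of "y / 2"] by auto
      have "X (- int (nat (- m))) \<le> X m" by (rule X_mono) simp
      then have "1 \<le> (SUP n::nat. indicator {X (- int n)<..X k} y :: ennreal)"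
        using True m by (intro SUP_upper2[of "nat (- m)"]) auto
      moreover have "(SUP n::nat. indicator {X (- int n)<..X k} y :: ennreal) \<le> 1"
        by (intro SUP_least) (auto split: split_indicator)
      ultimately show ?thesis using True by simp
    next
      case False
      then have "y \<notin> {X (- int n)<..X k}" for n using X_nonneg[of "- int n"] by (auto simp del: X_nonneg)
      then show ?thesis using False by simp
    qed
    then show "indicator {0<..X k} y * (K (X k) y * W y * tail f y) = (SUP n. ?h n y)"
      by (simp add: SUP_mult_right_ennreal)
  qed
  also have "\<dots> \<le> (SUP n. Lq q (?h n))"
  proof (rule Lq_SUP_le[OF q])
    show "incseq ?h"
    proof (rule incseq_SucI, rule le_funI)
      fix n y
      have "X (- int (Suc n)) \<le> X (- int n)" by (rule X_mono) simp
      then show "?h n y \<le> ?h (Suc n) y" by (auto split: split_indicator)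
    qed
  qed (auto intro!: Q_measurable)
  finally show ?thesis by (simp add: S_def Q_def)
qed

lemma Zr_S_limit: "Zr (\<lambda>k. Q {0<..X k} (X k) (tail f)) \<le> absorb_const * Zr (E f)"
proof -
  have inc: "incseq (\<lambda>n k. lev k * S f (- int n) k powe r)"
  proof (rule incseq_SucI, rule le_funI)
    fix n k
    have "X (- int (Suc n)) \<le> X (- int n)" by (rule X_mono) simp
    then show "lev k * S f (- int n) k powe r \<le> lev k * S f (- int (Suc n)) k powe r"
      unfolding S_def by (intro mult_left_mono powe_mono r Q_mono) auto
  qed
  have "Zr (\<lambda>k. Q {0<..X k} (X k) (tail f)) \<le> Zr (\<lambda>k. SUP n::nat. S f (- int n) k)"
    by (intro Zr_mono S_limit)
  also have "\<dots> = zsum (\<lambda>k. SUP n::nat. lev k * S f (- int n) k powe r)"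
    unfolding Zr_def using r by (simp add: powe_SUP SUP_mult_left_ennreal)
  also have "\<dots> = (SUP n::nat. Zr (S f (- int n)))"
    unfolding Zr_def by (intro nn_integral_monotone_convergence_SUP inc) auto
  also have "\<dots> \<le> absorb_const * Zr (E f)" by (intro SUP_least Zr_S)
  finally show ?thesis .
qed

text \<open>On block k the operator is compared with its value at the right end
  \<open>X (k + 1)\<close>, and the mass of that block is at most \<open>lev (k + 1)\<close>; after
  a shift this is a sum of the form \<open>Zr\<close>.\<close>

lemma NT_le: "NT f powe r \<le> d powe r * (absorb_const * Zr (E f))"
proof -
  let ?S = "\<lambda>k. Q {0<..X k} (X k) (tail f)"
  have "NT f powe r \<le> zsum (\<lambda>k. mass k * (d * ?S (k + 1)) powe r)"
    unfolding NT_powe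
  proof (rule integral_le_step)
    fix k x assume "x \<in> blk k"
    then have "Th f x \<le> d * ?S (k + 1)"
      unfolding Th_def by (intro Q_le) (auto simp: blk_def)
    then have "u x * Th f x powe r \<le> u x * (d * ?S (k + 1)) powe r"
      by (intro mult_left_mono powe_mono r) auto
    then show "Th f x powe r * u x \<le> u x * (d * ?S (k + 1)) powe r" by (simp add: mult.commute)
  qed
  also have "\<dots> \<le> zsum (\<lambda>k. lev (k + 1) * (d * ?S (k + 1)) powe r)"
    by (intro zsum_mono mult_right_mono) (auto simp: mass_def)
  also have "\<dots> = Zr (\<lambda>k. d * ?S k)"
    unfolding Zr_def by (rule zsum_shift)
  also have "\<dots> \<le> d powe r * (absorb_const * Zr (E f))"
    unfolding Zr_cmult by (intro mult_left_mono Zr_S_limit) simp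
  finally show ?thesis .
qed

section \<open>The one-step terms against the three conditions\<close>

lemma Zr_le_integral:
  assumes A: "0 < (A::real)" and le: "\<And>k x. x \<in> blk k \<Longrightarrow> e k powe r * u x \<le> ennreal A * g x"
    and zero: "\<And>k. X (k + 1) = 0 \<Longrightarrow> e k = 0"
  shows "Zr e \<le> ennreal (2 * A) * (\<integral>\<^sup>+x\<in>{0..}. g x \<partial>lebesgue)"
proof -
  let ?c = "\<lambda>k. ennreal (1 / A) * e k powe r"
  have AA: "ennreal (1 / A) * ennreal A = 1" "ennreal (2 * A) * ennreal (1 / A) = 2"
    using A by (simp_all add: ennreal_mult[symmetric])
  have "Zr e \<le> zsum (\<lambda>k. ennreal (2 * A) * (mass k * ?c k))"
    unfolding Zr_def
  proof (rule zsum_mono)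
    fix k
    show "lev k * e k powe r \<le> ennreal (2 * A) * (mass k * ?c k)"
    proof (cases "X (k + 1) = 0")
      case False
      \<comment> \<open>A non-degenerate block carries half of \<open>lev k\<close>, hence the 2 in
        the constant; on degenerate blocks \<open>e k\<close> must vanish for lack of mass.\<close>
      then have m: "mass k = lev (k + 1)" using X_nonneg[of "k + 1"] by (auto simp: mass_def simp del: X_nonneg)
      have "ennreal (2 * A) * (mass k * ?c k) = (ennreal (2 * A) * ennreal (1 / A)) * (lev (k + 1) * e k powe r)"
        unfolding m by (simp only: mult_ac)
      then show ?thesis unfolding AA using lev_Suc[of k] by (simp add: mult.assoc)
    qed (simp add: zero)
  qed
  also have "\<dots> = ennreal (2 * A) * zsum (\<lambda>k. mass k * ?c k)" by (rule zsum_cmult)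
  also have "\<dots> \<le> ennreal (2 * A) * (\<integral>\<^sup>+x\<in>{0..}. g x \<partial>lebesgue)"
  proof (intro mult_left_mono step_le_integral)
    fix k x assume x: "x \<in> blk k"
    have "u x * ?c k = ennreal (1 / A) * (e k powe r * u x)" by (simp only: mult_ac)
    also have "\<dots> \<le> ennreal (1 / A) * (ennreal A * g x)" by (intro mult_left_mono le x) simp
    also have "\<dots> = g x" using AA by (simp add: mult.assoc[symmetric])
    finally show "u x * ?c k \<le> g x" .
  qed simp
  finally show ?thesis .
qed

text \<open>With z the image of x under two applications of \<open>zeta_inv\<close>,
  \<open>K (X k) (X (k - 1))\<close> is moved to \<open>K x z\<close> in two kernel steps, which
  accounts for \<open>DK * DK\<close>, and the range up to \<open>X (k - 2)\<close> is enlarged to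
  z.\<close>

lemma Zr_E1: "Zr (\<lambda>k. K (X k) (X (k - 1)) * R {0<..X (k - 2)} (tail f))
   \<le> ennreal (2 * (DK * DK) powr r) * NB1 f powe r"
proof -
  let ?e = "\<lambda>k. K (X k) (X (k - 1)) * R {0<..X (k - 2)} (tail f)"
  have NB1: "NB1 f powe r = (\<integral>\<^sup>+x\<in>{0..}. u x * (K x (zeta_inv u (zeta_inv u x)) powe r)
      * (R {0<..<zeta_inv u (zeta_inv u x)} (tail f) powe r) \<partial>lebesgue)"
    using r by (simp add: NB1_def powe_powe)
  show ?thesis
    unfolding NB1
  proof (rule Zr_le_integral)
    show "0 < (DK * DK) powr r" using DK by simp
    show "?e k = 0" if "X (k + 1) = 0" for k
    proof -
      have "X (k - 2) = 0" using X_mono[of "k - 2" "k + 1"] that X_nonneg[of "k - 2"] by (simp del: X_nonneg)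
      then show ?thesis using q by (simp add: R_def)
    qed
    fix k x assume x: "x \<in> blk k"
    define z where "z = zeta_inv u (zeta_inv u x)"
    have z: "X (k - 2) \<le> z" "z \<le> X (k - 1)" using zeta_inv2_bounds[OF x] by (auto simp: z_def)
    have X1: "X (k - 1) \<le> X k" "X k \<le> x" "0 \<le> z"
      using x z X_nonneg[of "k - 2"] by (auto simp: blk_def intro: X_mono simp del: X_nonneg)
    have "K (X k) (X (k - 1)) \<le> d * K x (X (k - 1))"
      using X1 by (intro K_right) auto
    also have "\<dots> \<le> d * (d * K x z)"
      using X1 z by (intro mult_left_mono K_left) auto
    finally have K: "K (X k) (X (k - 1)) \<le> d * (d * K x z)" .
    have "AE y in lebesgue. y \<noteq> X (k - 2)" by (rule AE_I[where N="{X (k - 2)}"]) auto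
    then have "AE y in lebesgue. y \<in> {0<..X (k - 2)} \<longrightarrow> y \<in> {0<..<z}"
      by eventually_elim (use z in auto)
    then have "R {0<..X (k - 2)} (tail f) \<le> R {0<..<z} (tail f)"
      by (intro R_mono_AE) auto
    with K have "?e k \<le> d * (d * K x z) * R {0<..<z} (tail f)" by (intro mult_mono) auto
    then have "?e k powe r * u x \<le> (d * (d * K x z) * R {0<..<z} (tail f)) powe r * u x"
      by (intro mult_right_mono powe_mono r) auto
    also have "\<dots> = (d powe r * d powe r) * (u x * K x z powe r * R {0<..<z} (tail f) powe r)"
      by (simp add: powe_mult mult_ac)
    also have "d powe r * d powe r = ennreal ((DK * DK) powr r)"
      using DK by (simp add: powe_DK powr_mult ennreal_mult)
    finally show "?e k powe r * u x \<le> ennreal ((DK * DK) powr r) *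
        (u x * (K x (zeta_inv u (zeta_inv u x)) powe r) * (R {0<..<zeta_inv u (zeta_inv u x)} (tail f) powe r))"
      by (simp add: z_def)
  qed
qed

text \<open>The tail is taken at the right end of block k and is therefore at most its value at
  every x of the block.\<close>

lemma Zr_E3: "Zr (\<lambda>k. tail f (X (k + 1)) * Q {X (k - 2)<..X k} (X k) (\<lambda>_. 1))
   \<le> ennreal (2 * DK powr r) * NB0 f powe r"
proof -
  let ?e = "\<lambda>k. tail f (X (k + 1)) * Q {X (k - 2)<..X k} (X k) (\<lambda>_. 1)"
  have NB0: "NB0 f powe r = (\<integral>\<^sup>+x\<in>{0..}. u x * (Q {0<..<x} x (\<lambda>_. 1) powe r) * (tail f x powe r) \<partial>lebesgue)"
    using r by (simp add: NB0_def powe_powe)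
  show ?thesis
    unfolding NB0
  proof (rule Zr_le_integral)
    show "0 < DK powr r" using DK by simp
    show "?e k = 0" if "X (k + 1) = 0" for k
    proof -
      have "X (k - 2) = 0" "X k = 0"
        using X_mono[of "k - 2" "k + 1"] X_mono[of k "k + 1"] that X_nonneg[of "k - 2"] X_nonneg[of k]
        by (simp_all del: X_nonneg)
      then show ?thesis using q by (simp add: Q_def)
    qed
    fix k x assume x: "x \<in> blk k"
    have X1: "X k \<le> x" "x \<le> X (k + 1)" using x by (auto simp: blk_def)
    have "AE y in lebesgue. y \<noteq> X k" by (rule AE_I[where N="{X k}"]) auto
    then have "AE y in lebesgue. y \<in> {X (k - 2)<..X k} \<longrightarrow> y \<in> {0<..<x}"
      by eventually_elim (use X1 X_nonneg[of "k - 2"] in \<open>auto simp del: X_nonneg\<close>)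
    then have "Q {X (k - 2)<..X k} (X k) (\<lambda>_. 1) \<le> d * Q {0<..<x} x (\<lambda>_. 1)"
      using X1 X_nonneg[of "k - 2"] by (intro Q_le) (auto simp del: X_nonneg intro: X_nonneg)
    moreover have "tail f (X (k + 1)) \<le> tail f x" using X1 by (intro tail_antimono)
    ultimately have "?e k powe r * u x \<le> (tail f x * (d * Q {0<..<x} x (\<lambda>_. 1))) powe r * u x"
      by (intro mult_right_mono powe_mono r mult_mono) auto
    also have "\<dots> = ennreal (DK powr r) * (u x * (Q {0<..<x} x (\<lambda>_. 1) powe r) * (tail f x powe r))"
      by (simp add: powe_mult powe_DK mult_ac)
    finally show "?e k powe r * u x \<le> ennreal (DK powr r) * (u x * (Q {0<..<x} x (\<lambda>_. 1) powe r) * (tail f x powe r))" .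
  qed
qed

text \<open>The cut at \<open>X (k + 1)\<close> serves both summands: the constant part is dominated
  throughout block k, and the truncated part fits into a block norm.\<close>

lemma local_split:
  assumes f: "f \<in> Mplus"
  shows "Q {X (k - 2)<..X k} (X k) (tail f) \<le> c * (Qb (X (k - 2)) (X k) (X (k + 1)) f
     + tail f (X (k + 1)) * Q {X (k - 2)<..X k} (X k) (\<lambda>_. 1))"
proof -
  have "Q {X (k - 2)<..X k} (X k) (tail f) \<le> c * (Q {X (k - 2)<..X k} (X k) (tail (\<lambda>z. f z * indicator {..X (k + 1)} z))
     + Q {X (k - 2)<..X k} (X k) (\<lambda>_. tail f (X (k + 1)) * 1))"
  proof (rule Q_add)
    fix y assume "y \<in> {X (k - 2)<..X k}"
    moreover have "X k \<le> X (k + 1)" by (rule X_mono) simp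
    ultimately have "0 \<le> y" "y \<le> X (k + 1)" using X_nonneg[of "k - 2"] by (auto simp del: X_nonneg)
    then show "tail f y \<le> tail (\<lambda>z. f z * indicator {..X (k + 1)} z) y + tail f (X (k + 1)) * 1"
      using tail_split_le[OF f, of y "X (k + 1)"] by simp
  qed auto
  then show ?thesis by (subst (asm) Q_cmult) (auto simp: Qb_def)
qed

text \<open>Tails are taken only at points to the right of a and f is already cut at e; hence f may
  be localised to pieces of bounded overlap.\<close>

lemma Qb_truncate: "Qb a b e (\<lambda>z. f z * indicator {a<..e} z) = Qb a b e f"
proof -
  have 1: "(\<lambda>z. f z * indicator {a<..e} z * indicator {..e} z) = (\<lambda>z. f z * indicator {a<..e} z)"
    by (auto simp: fun_eq_iff split: split_indicator)
  show ?thesis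
    unfolding Qb_def Q_def 1
    by (rule arg_cong[where f = "Lq q"], rule ext) (auto simp: tail_truncate split: split_indicator)
qed

definition cut :: "(real \<Rightarrow> ennreal) \<Rightarrow> int \<Rightarrow> real \<Rightarrow> ennreal" where
  "cut f k z = f z * indicator {X (k - 2)<..X (k + 1)} z"

lemma cut_Mplus: "f \<in> Mplus \<Longrightarrow> cut f k \<in> Mplus"
  unfolding cut_def[abs_def] by (rule Mplus_mult_indicator) auto

lemma zsum_V_cut:
  assumes f: "f \<in> Mplus"
  shows "zsum (\<lambda>k. V (cut f k)) \<le> 3 * V f"
proof -
  let ?g = "\<lambda>x. f x powe p * v x * indicator {0..} x"
  have "zsum (\<lambda>k. V (cut f k)) = zsum (\<lambda>k. \<integral>\<^sup>+x. ?g x * indicator {X (k - 2)<..X (k + 1)} x \<partial>lebesgue)"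
    unfolding V_def cut_def by (intro nn_integral_cong) (auto split: split_indicator)
  also have "\<dots> = (\<integral>\<^sup>+x. zsum (\<lambda>k. ?g x * indicator {X (k - 2)<..X (k + 1)} x) \<partial>lebesgue)"
    by (intro nn_integral_count_space_nn_integral[symmetric] borel_measurable_times_ennreal[OF V_measurable[OF f]]
        borel_measurable_indicator) auto
  also have "\<dots> \<le> (\<integral>\<^sup>+x. 3 * ?g x \<partial>lebesgue)"
  proof (rule nn_integral_mono)
    fix x :: real
    show "zsum (\<lambda>k. ?g x * indicator {X (k - 2)<..X (k + 1)} x) \<le> 3 * ?g x"
      using mult_left_mono[OF zsum_triple_intervals[of x], of "?g x"] unfolding zsum_cmult by (simp add: mult.commute)
  qed
  also have "\<dots> = 3 * V f"
    unfolding V_def by (intro nn_integral_cmult V_measurable f)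
  finally show ?thesis .
qed

lemma V_cut_le: "V (cut f k) \<le> V f"
  by (rule V_mono) (auto simp: cut_def split: split_indicator)

text \<open>\<open>b2\<close> is used at t = \<open>X k\<close> and applied to
  \<open>cut f k\<close> instead of f; without this localisation the blockwise bounds could not be
  summed.\<close>

lemma Zr_E4_case1:
  assumes pr: "p \<le> r" and f: "f \<in> Mplus" "V f < top" and b2: "b2 < top"
  shows "Zr (\<lambda>k. Qb (X (k - 2)) (X k) (X (k + 1)) f) \<le> ennreal (3 powr (r / p)) * (b2 powe r * V f powe (r / p))"
proof -
  have rp: "1 \<le> r / p" using pr p by simp
  have "lev k * Qb (X (k - 2)) (X k) (X (k + 1)) f powe r \<le> b2 powe r * V (cut f k) powe (r / p)" for k
  proof (cases "0 < X k")
    case False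
    then have "{X (k - 2)<..X k} = {}"
      using X_mono[of "k - 2" k] X_nonneg[of "k - 2"] X_nonneg[of k] by (auto simp del: X_nonneg)
    then show ?thesis using q by (simp add: Qb_def Q_def)
  next
    case True
    have "U (X k) powe (1 / r) * ht (X k) \<le> (SUP t\<in>{0<..}. U t powe (1 / r) * ht t)"
      using True by (intro SUP_upper) simp
    then have hb: "lev k powe (1 / r) * ht (X k) \<le> b2" using pr U_X[OF True] by (simp add: b2_def)
    then have "lev k powe (1 / r) * ht (X k) < top" using b2 by (rule le_less_trans)
    then have ht: "ht (X k) < top" by (auto simp: less_top[symmetric] ennreal_mult_eq_top_iff)
    have "Qb (X (k - 2)) (X k) (X (k + 1)) f = Qb (X (k - 2)) (X k) (X (k + 1)) (cut f k)"
      unfolding cut_def[abs_def] by (rule Qb_truncate[symmetric])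
    also have "\<dots> \<le> Q {0<..X k} (X k) (tail (cut f k))"
      unfolding Qb_def using X_nonneg[of "k - 2"] X_nonneg[of k]
      by (intro Q_mono tail_mono) (auto split: split_indicator simp del: X_nonneg)
    also have "\<dots> \<le> ht (X k) * V (cut f k) powe (1 / p)"
      unfolding wnorm_V[symmetric] ht_def
      using ht cut_Mplus[OF f(1), of k] le_less_trans[OF V_cut_le f(2), of k]
      by (intro least_const_bound) (auto simp: ht_def wnorm_V)
    finally have "(lev k powe (1 / r) * Qb (X (k - 2)) (X k) (X (k + 1)) f) powe r
        \<le> (lev k powe (1 / r) * (ht (X k) * V (cut f k) powe (1 / p))) powe r"
      by (intro powe_mono r mult_left_mono) auto
    also have "\<dots> \<le> (b2 * V (cut f k) powe (1 / p)) powe r"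
      unfolding mult.assoc[symmetric] by (intro powe_mono r mult_right_mono hb) simp
    finally show ?thesis using r by (simp add: powe_mult powe_powe)
  qed
  then have "Zr (\<lambda>k. Qb (X (k - 2)) (X k) (X (k + 1)) f) \<le> zsum (\<lambda>k. b2 powe r * V (cut f k) powe (r / p))"
    unfolding Zr_def by (rule zsum_mono)
  also have "\<dots> = b2 powe r * zsum (\<lambda>k. V (cut f k) powe (r / p))" by (rule zsum_cmult)
  also have "\<dots> \<le> b2 powe r * (3 * V f) powe (r / p)"
    using p r by (intro mult_left_mono order_trans[OF zsum_powe_le[OF rp]] powe_mono zsum_V_cut f) auto
  also have "\<dots> = ennreal (3 powr (r / p)) * (b2 powe r * V f powe (r / p))"
    using powe_ennreal[of 3 "r / p"] by (simp add: powe_mult mult_ac)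
  finally show ?thesis .
qed

text \<open>
  The interval of the \<open>k\<close>-th local term lies in that of the block norm at any \<open>x\<close> of block
  \<open>k - 2\<close>. The first non-degenerate blocks have no such predecessor; there block \<open>k - 1\<close> serves, because
  \<open>\<zeta>\<^sup>-\<^sup>1\<close> vanishes on it.
\<close>

lemma zsum_block_norms:
  fixes \<beta> :: "int \<Rightarrow> ennreal"
  defines "\<beta> \<equiv> \<lambda>k. bn (X (k - 2)) (X k) (X (k + 1))"
  assumes rp: "r < p"
  shows "zsum (\<lambda>k. if 0 < X k then (lev k powe (1 / r) * \<beta> k) powe s else 0) \<le> ennreal (2 * DK powr s) * b2 powe s"
proof -
  note s = s_pos[OF rp]
  \<comment> \<open>\<open>lev (j + 1)\<close> bounds U from below on block j, and 1 / DK offsets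
    the comparison of block norms in \<open>bn_mono\<close>.\<close>
  let ?w = "\<lambda>j k. lev (j + 1) powe (s / p) * (ennreal (1 / DK) * \<beta> k) powe s"
  define c1 where "c1 j = ?w j (j + 2)" for j
  define c2 where "c2 j = (if X j = 0 then ?w j (j + 1) else 0)" for j
  define g where "g x = u x * (U x powe (s / p))
       * (bn (zeta_inv u x) (zeta u (zeta u x)) (zeta u (zeta u (zeta u x))) powe s)" for x
  have b2s: "b2 powe s = (\<integral>\<^sup>+x\<in>{0..}. g x \<partial>lebesgue)"
    using rp s by (simp add: b2_def g_def powe_powe)
  have d1: "ennreal (1 / DK) * d = 1" "d * ennreal (1 / DK) = 1"
    using DK by (simp_all add: ennreal_mult[symmetric])
  have step: "u x * ?w j k \<le> g x"
    if x: "x \<in> blk j" and k: "zeta_inv u x \<le> X (k - 2)" "k \<le> j + 2" for x j k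
  proof -
    note z1 = zeta_blk[OF x]
    note z2 = zeta_blk[OF z1]
    note z3 = zeta_blk[OF z2]
    have "X k \<le> zeta u (zeta u x)" "X (k + 1) \<le> zeta u (zeta u (zeta u x))"
      using z2 z3 X_mono[OF k(2)] X_mono[of "k + 1" "j + 3"] k(2) by (auto simp: blk_def add.assoc)
    moreover have "0 \<le> zeta_inv u x"
      using zeta_inv_bounds(1)[OF x] X_nonneg[of "j - 1"] by (simp del: X_nonneg)
    ultimately have "\<beta> k \<le> d * bn (zeta_inv u x) (zeta u (zeta u x)) (zeta u (zeta u (zeta u x)))"
      unfolding \<beta>_def using k(1) by (intro bn_mono) auto
    then have "ennreal (1 / DK) * \<beta> k \<le> ennreal (1 / DK) * (d * bn (zeta_inv u x) (zeta u (zeta u x)) (zeta u (zeta u (zeta u x))))"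
      by (rule mult_left_mono) simp
    also have "\<dots> = bn (zeta_inv u x) (zeta u (zeta u x)) (zeta u (zeta u (zeta u x)))"
      unfolding mult.assoc[symmetric] d1 by simp
    finally have "?w j k \<le> U x powe (s / p) * bn (zeta_inv u x) (zeta u (zeta u x)) (zeta u (zeta u (zeta u x))) powe s"
      using blk_U(2)[OF x] s p by (intro mult_mono powe_mono) auto
    then show ?thesis unfolding g_def mult.assoc by (rule mult_left_mono) simp
  qed
  have 1: "zsum (\<lambda>j. mass j * c1 j) \<le> b2 powe s"
    unfolding b2s
  proof (rule step_le_integral)
    fix j x assume "x \<in> blk j"
    then show "u x * c1 j \<le> g x"
      unfolding c1_def using zeta_inv_bounds(2) by (intro step) auto
  qed
  have 2: "zsum (\<lambda>j. mass j * c2 j) \<le> b2 powe s"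
    unfolding b2s
  proof (rule step_le_integral)
    fix j x assume x: "x \<in> blk j"
    show "u x * c2 j \<le> g x"
    proof (cases "X j = 0")
      case True
      then have "zeta_inv u x \<le> X (j - 1)"
        using zeta_inv_bounds(2)[OF x] X_nonneg[of "j - 1"] by (simp del: X_nonneg)
      then show ?thesis unfolding c2_def using True x by (auto intro!: step)
    qed (simp add: c2_def)
  qed
  have lev_s: "lev k powe (s / r) = lev k * lev k powe (s / p)" for k
    using powe_add_exponent[of "lev k" 1 "s / p"] by (simp add: s_exponents(1)[OF rp])
  have dw: "d powe s * ?w j k = lev (j + 1) powe (s / p) * \<beta> k powe s" for j k
  proof -
    have "d powe s * ?w j k = lev (j + 1) powe (s / p) * ((d * ennreal (1 / DK)) powe s * \<beta> k powe s)"
      by (simp only: powe_mult mult_ac)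
    then show ?thesis unfolding d1 by simp
  qed
  have "zsum (\<lambda>k. if 0 < X k then (lev k powe (1 / r) * \<beta> k) powe s else 0)
     \<le> zsum (\<lambda>k. d powe s * (mass (k + - 2) * c1 (k + - 2) + mass (k + - 1) * c2 (k + - 1)))"
  proof (rule zsum_mono)
    fix k
    show "(if 0 < X k then (lev k powe (1 / r) * \<beta> k) powe s else 0)
       \<le> d powe s * (mass (k + - 2) * c1 (k + - 2) + mass (k + - 1) * c2 (k + - 1))"
    proof (cases "0 < X k")
      case True
      have y: "(lev k powe (1 / r) * \<beta> k) powe s = lev k * (lev k powe (s / p) * \<beta> k powe s)"
        by (simp add: powe_mult powe_powe lev_s mult.assoc)
      consider "0 < X (k - 1)" | "\<not> 0 < X (k - 1)" by blast
      then have "(lev k powe (1 / r) * \<beta> k) powe s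
         \<le> mass (k - 2) * (d powe s * c1 (k - 2)) + mass (k - 1) * (d powe s * c2 (k - 1))"
      proof cases
        case 1
        then have m: "mass (k - 2) = lev (k - 1)" by (simp add: mass_def)
        have l: "lev k \<le> lev (k - 1)" by (rule lev_antimono) simp
        have "lev k * (lev k powe (s / p) * \<beta> k powe s) \<le> lev (k - 1) * (lev (k - 1) powe (s / p) * \<beta> k powe s)"
          using l s p by (intro mult_mono powe_mono) auto
        also have "\<dots> = mass (k - 2) * (d powe s * c1 (k - 2))"
          unfolding c1_def dw by (simp add: m)
        finally show ?thesis unfolding y by (rule order_trans) simp
      next
        case 2
        then have "X (k - 1) = 0" using X_nonneg[of "k - 1"] by linarith
        then have "mass (k - 1) * (d powe s * c2 (k - 1)) = lev k * (lev k powe (s / p) * \<beta> k powe s)"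
          using dw[of "k - 1" k] True by (simp add: c2_def mass_def)
        then show ?thesis unfolding y by simp
      qed
      then show ?thesis using True by (simp add: distrib_left mult.left_commute)
    qed simp
  qed
  also have "\<dots> = d powe s * (zsum (\<lambda>j. mass j * c1 j) + zsum (\<lambda>j. mass j * c2 j))"
    unfolding zsum_cmult zsum_add
    using zsum_shift[of "\<lambda>j. mass j * c1 j" "- 2"] zsum_shift[of "\<lambda>j. mass j * c2 j" "- 1"] by simp
  also have "\<dots> \<le> d powe s * (b2 powe s + b2 powe s)"
    by (intro mult_left_mono add_mono 1 2) simp
  also have "\<dots> = ennreal (2 * DK powr s) * b2 powe s"
    by (simp add: powe_DK ennreal_mult mult_2[symmetric] mult_ac)
  finally show ?thesis .
qed

text \<open>The power r / s of \<open>y k\<close> is \<open>lev k * \<beta> k powe r\<close>, so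
  Hoelder's inequality meets the sum of \<open>zsum_block_norms\<close>. The same lemma makes each
  block norm finite, as \<open>least_const_bound\<close> requires.\<close>

lemma Zr_E4_case2:
  assumes rp: "r < p" and f: "f \<in> Mplus" "V f < top" and b2: "b2 < top"
  shows "Zr (\<lambda>k. Qb (X (k - 2)) (X k) (X (k + 1)) f)
    \<le> ennreal (2 * (2 * DK powr s) powr (r / s) * 3 powr (r / p)) * (b2 powe r * V f powe (r / p))"
proof -
  note s = s_pos[OF rp]
  define \<beta> where "\<beta> k = bn (X (k - 2)) (X k) (X (k + 1))" for k
  define y where "y k = (if 0 < X k then (lev k powe (1 / r) * \<beta> k) powe s else 0)" for k
  have ysum: "zsum y \<le> ennreal (2 * DK powr s) * b2 powe s"
    unfolding y_def \<beta>_def by (rule zsum_block_norms[OF rp])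
  also have "\<dots> < top" using b2 by (simp add: ennreal_mult_less_top)
  finally have yfin: "y k < top" for k using le_zsum[of y k] by (rule le_less_trans[rotated])
  have "lev k * Qb (X (k - 2)) (X k) (X (k + 1)) f powe r \<le> y k powe (r / s) * V (cut f k) powe (r / p)" for k
  proof (cases "0 < X k")
    case False
    then have "{X (k - 2)<..X k} = {}"
      using X_mono[of "k - 2" k] X_nonneg[of "k - 2"] X_nonneg[of k] by (auto simp del: X_nonneg)
    then show ?thesis using q by (simp add: Qb_def Q_def)
  next
    case True
    then have \<beta>: "\<beta> k < top"
      using yfin[of k] by (auto simp: y_def less_top[symmetric] ennreal_mult_eq_top_iff)
    have "Qb (X (k - 2)) (X k) (X (k + 1)) f = Qb (X (k - 2)) (X k) (X (k + 1)) (cut f k)"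
      unfolding cut_def[abs_def] by (rule Qb_truncate[symmetric])
    also have "\<dots> \<le> \<beta> k * V (cut f k) powe (1 / p)"
      unfolding wnorm_V[symmetric] \<beta>_def bn_Qb
      using \<beta> cut_Mplus[OF f(1), of k] le_less_trans[OF V_cut_le f(2), of k]
      by (intro least_const_bound) (auto simp: \<beta>_def bn_Qb wnorm_V)
    finally have "lev k * Qb (X (k - 2)) (X k) (X (k + 1)) f powe r
        \<le> lev k * (\<beta> k * V (cut f k) powe (1 / p)) powe r"
      by (intro powe_mono r mult_left_mono) auto
    also have "\<dots> = y k powe (r / s) * V (cut f k) powe (r / p)"
      using True r s by (simp add: y_def powe_mult powe_powe mult.assoc)
    finally show ?thesis .
  qed
  then have "Zr (\<lambda>k. Qb (X (k - 2)) (X k) (X (k + 1)) f) \<le> zsum (\<lambda>k. y k powe (r / s) * V (cut f k) powe (r / p))"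
    unfolding Zr_def by (rule zsum_mono)
  also have "\<dots> \<le> 2 * (zsum y powe (r / s) * zsum (\<lambda>k. V (cut f k)) powe (r / p))"
    using r s p s_exponents(2)[OF rp] by (intro zsum_Hoelder) (auto simp: add.commute)
  also have "\<dots> \<le> 2 * ((ennreal (2 * DK powr s) * b2 powe s) powe (r / s) * (3 * V f) powe (r / p))"
    using r s p by (intro mult_left_mono mult_mono powe_mono ysum zsum_V_cut f) auto
  also have "\<dots> = ennreal (2 * (2 * DK powr s) powr (r / s) * 3 powr (r / p)) * (b2 powe r * V f powe (r / p))"
  proof -
    define e where "e = 2 * DK powr s"
    have "0 \<le> e" by (simp add: e_def)
    then show ?thesis
      using powe_ennreal[of 3 "r / p"] s unfolding e_def[symmetric]
      by (simp add: powe_mult powe_powe powe_ennreal ennreal_mult mult_ac)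
  qed
  finally show ?thesis .
qed

definition block_const :: real where
  "block_const = (if p \<le> r then 3 powr (r / p) else 2 * (2 * DK powr s) powr (r / s) * 3 powr (r / p))"

definition remainder_const :: ennreal where
  "remainder_const = ennreal (2 powr r) * (ennreal (2 * (DK * DK) powr r)
     + c powe r * (ennreal (2 powr r) * (ennreal block_const + ennreal (2 * DK powr r))))"

lemma Zr_E:
  assumes f: "f \<in> Mplus" "V f < top" and fin: "b0 < top" "b1 < top" "b2 < top"
  shows "Zr (E f) \<le> remainder_const * ((b0 + b1 + b2) * V f powe (1 / p)) powe r"
proof -
  define m where "m = ((b0 + b1 + b2) * V f powe (1 / p)) powe r"
  have wf: "wnorm (ennreal p) v f < top" using f by (simp add: wnorm_V)
  have "NB0 f \<le> b0 * V f powe (1 / p)" "NB1 f \<le> b1 * V f powe (1 / p)"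
    using fin least_const_bound[of NB0 "ennreal p" v f] least_const_bound[of NB1 "ennreal p" v f] f(1) wf
    by (simp_all add: b0_def b1_def wnorm_V)
  moreover have "b0 \<le> b0 + (b1 + b2)" "b1 \<le> b1 + (b0 + b2)" by simp_all
  then have "b0 \<le> b0 + b1 + b2" "b1 \<le> b0 + b1 + b2" by (simp_all add: add_ac)
  then have "b0 * V f powe (1 / p) \<le> (b0 + b1 + b2) * V f powe (1 / p)"
    "b1 * V f powe (1 / p) \<le> (b0 + b1 + b2) * V f powe (1 / p)"
    by (simp_all only: mult_right_mono zero_le)
  ultimately have "NB0 f \<le> (b0 + b1 + b2) * V f powe (1 / p)" "NB1 f \<le> (b0 + b1 + b2) * V f powe (1 / p)"
    by (simp_all only: order_trans)
  then have NB: "NB0 f powe r \<le> m" "NB1 f powe r \<le> m"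
    unfolding m_def by (simp_all only: powe_mono r)
  have "b2 powe r * V f powe (r / p) = (b2 * V f powe (1 / p)) powe r"
    by (simp add: powe_mult powe_powe)
  also have "\<dots> \<le> m" unfolding m_def by (intro powe_mono r mult_right_mono) auto
  finally have b2m: "b2 powe r * V f powe (r / p) \<le> m" .
  let ?e1 = "\<lambda>k. K (X k) (X (k - 1)) * R {0<..X (k - 2)} (tail f)"
  let ?e2 = "\<lambda>k. Q {X (k - 2)<..X k} (X k) (tail f)"
  let ?e3 = "\<lambda>k. tail f (X (k + 1)) * Q {X (k - 2)<..X k} (X k) (\<lambda>_. 1)"
  let ?e4 = "\<lambda>k. Qb (X (k - 2)) (X k) (X (k + 1)) f"
  have e4: "Zr ?e4 \<le> ennreal block_const * m"
    using Zr_E4_case1[OF _ f fin(3)] Zr_E4_case2[OF _ f fin(3)]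
    by (cases "p \<le> r") (auto simp: block_const_def intro: order_trans[OF _ mult_left_mono[OF b2m]])
  have e3: "Zr ?e3 \<le> ennreal (2 * DK powr r) * m"
    by (rule order_trans[OF Zr_E3 mult_left_mono[OF NB(1)]]) simp
  have e1: "Zr ?e1 \<le> ennreal (2 * (DK * DK) powr r) * m"
    by (rule order_trans[OF Zr_E1 mult_left_mono[OF NB(2)]]) simp
  have "Zr ?e2 \<le> Zr (\<lambda>k. c * (?e4 k + ?e3 k))" by (intro Zr_mono local_split f)
  also have "\<dots> \<le> c powe r * (ennreal (2 powr r) * (Zr ?e4 + Zr ?e3))"
    unfolding Zr_cmult by (intro mult_left_mono Zr_add) simp
  also have "\<dots> \<le> c powe r * (ennreal (2 powr r) * (ennreal block_const * m + ennreal (2 * DK powr r) * m))"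
    by (intro mult_left_mono add_mono e3 e4) auto
  finally have e2: "Zr ?e2 \<le> c powe r * (ennreal (2 powr r) * (ennreal block_const * m + ennreal (2 * DK powr r) * m))" .
  have "Zr (E f) \<le> ennreal (2 powr r) * (Zr ?e1 + Zr ?e2)"
    unfolding E_def[abs_def] by (rule Zr_add)
  also have "\<dots> \<le> ennreal (2 powr r) * (ennreal (2 * (DK * DK) powr r) * m
      + c powe r * (ennreal (2 powr r) * (ennreal block_const * m + ennreal (2 * DK powr r) * m)))"
    by (intro mult_left_mono add_mono e1 e2) auto
  also have "\<dots> = remainder_const * m"
    by (simp only: remainder_const_def distrib_left distrib_right mult.assoc)
  finally show ?thesis by (simp add: m_def)
qed

text \<open>The summand 1 guarantees positivity, without which the bound would fail for an infinite
  right side because 0 * top = 0.\<close>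

definition suff_const :: real where
  "suff_const = enn2real ((d powe r * (absorb_const * remainder_const)) powe (1 / r)) + 1"

lemma remainder_const_fin: "remainder_const < top"
  by (simp add: remainder_const_def ennreal_mult_less_top)

lemma CT_le: "CT \<le> ennreal suff_const * (b0 + b1 + b2)"
proof (cases "b0 + b1 + b2 = top")
  case True
  have "0 < suff_const" by (simp add: suff_const_def add_nonneg_pos)
  then have "ennreal suff_const * (b0 + b1 + b2) = top" unfolding True by (simp add: ennreal_mult_top)
  then show ?thesis by simp
next
  case False
  then have fin: "b0 < top" "b1 < top" "b2 < top" by (auto simp: less_top[symmetric])
  let ?A = "d powe r * (absorb_const * remainder_const)"
  have A: "?A < top" using absorb_const_fin remainder_const_fin by (simp add: ennreal_mult_less_top)
  then have "?A powe (1 / r) = ennreal (enn2real (?A powe (1 / r)))" by simp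
  also have "\<dots> \<le> ennreal suff_const" unfolding suff_const_def by (intro ennreal_leI) simp
  finally have Ale: "?A powe (1 / r) \<le> ennreal suff_const" .
  show ?thesis
    unfolding CT_def
  proof (rule least_const_le)
    fix f assume f: "f \<in> Mplus" "wnorm (ennreal p) v f < top"
    then have Vf: "V f < top" by (simp add: wnorm_V)
    let ?n = "(b0 + b1 + b2) * V f powe (1 / p)"
    have "NT f powe r \<le> d powe r * (absorb_const * (remainder_const * ?n powe r))"
      by (rule order_trans[OF NT_le]) (intro mult_left_mono Zr_E f Vf fin, auto)
    then have "NT f \<le> (?A * ?n powe r) powe (1 / r)"
      by (intro powe_le_of_le_powe r) (simp add: mult.assoc)
    also have "\<dots> = ?A powe (1 / r) * ?n" using r by (simp add: powe_mult powe_powe mult_ac)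
    also have "\<dots> \<le> ennreal suff_const * ?n" by (intro mult_right_mono Ale) simp
    finally show "NT f \<le> ennreal suff_const * (b0 + b1 + b2) * wnorm (ennreal p) v f"
      by (simp add: wnorm_V mult.assoc)
  qed
qed

end

subsection \<open>Transfer to the original operators\<close>

text \<open>
  Taking \<open>q\<close>-th roots of kernel and weight (for finite \<open>q\<close>) turns all expressions into values of
  \<^const>\<open>Lq\<close>, and preserves the Oinarov condition up to the constant.
\<close>

definition kroot :: "ennreal \<Rightarrow> (real \<Rightarrow> real \<Rightarrow> real) \<Rightarrow> real \<Rightarrow> real \<Rightarrow> ennreal" where
  "kroot q k x y = (if 0 \<le> x \<and> 0 \<le> y then qroot q (ennreal (k x y)) else 0)"

definition wroot :: "ennreal \<Rightarrow> (real \<Rightarrow> ennreal) \<Rightarrow> real \<Rightarrow> ennreal" where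
  "wroot q w y = (if 0 \<le> y then qroot q (w y) else 0)"

text \<open>The 2 under the root is the constant of \<open>powe_add_le\<close> at exponent 1 / q,
  incurred when the root is distributed over the two kernel terms.\<close>

definition root_const :: "ennreal \<Rightarrow> real \<Rightarrow> real" where
  "root_const q D = (if q = top then D else (2 * D) powr (1 / enn2real q))"

lemma qroot_0 [simp]: "qroot q 0 = 0"
  by (simp add: qroot_def)

lemma root_const_ge_1: "1 \<le> D \<Longrightarrow> 1 \<le> root_const q D"
  by (auto simp: root_const_def intro!: ge_one_powr_ge_zero)

lemma qroot_le_of_le_sum:
  assumes q: "0 < q" and D: "1 \<le> D" and le: "x \<le> ennreal D * (y + z)"
  shows "qroot q x \<le> ennreal (root_const q D) * (qroot q y + qroot q z)"
proof (cases "q = top")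
  case False
  let ?a = "1 / enn2real q"
  have a: "0 < ?a" using enn2real_pos[OF q False] by simp
  have "qroot q x \<le> qroot q (ennreal D * (y + z))" by (rule qroot_mono[OF q le])
  also have "\<dots> = ennreal (D powr ?a) * (y + z) powe ?a"
    using False D by (simp add: qroot_def powe_mult powe_ennreal)
  also have "\<dots> \<le> ennreal (D powr ?a) * (ennreal (2 powr ?a) * (y powe ?a + z powe ?a))"
    by (intro mult_left_mono powe_add_le a) simp
  also have "\<dots> = ennreal (root_const q D) * (qroot q y + qroot q z)"
    using False D by (simp add: qroot_def root_const_def powr_mult ennreal_mult mult_ac)
  finally show ?thesis .
qed (use le in \<open>simp add: qroot_def root_const_def\<close>)

lemma oinarov_kernelD:
  assumes "oinarov_kernel D k" "0 < D" "0 \<le> y" "y \<le> z" "z \<le> x"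
  shows "k x y \<le> D * (k x z + k z y)" "k x z \<le> D * k x y" "k z y \<le> D * k x y"
    "0 \<le> k x y" "0 \<le> k x z" "0 \<le> k z y"
proof -
  have "\<forall>x\<ge>0. \<forall>y\<ge>0. 0 \<le> k x y" using assms(1) by (simp add: oinarov_kernel_def)
  then show nn: "0 \<le> k x y" "0 \<le> k x z" "0 \<le> k z y" using assms by auto
  have *: "1 / D * (k x z + k z y) \<le> k x y \<and> k x y \<le> D * (k x z + k z y)"
    using assms unfolding oinarov_kernel_def by blast
  then show "k x y \<le> D * (k x z + k z y)" by simp
  have "k x z + k z y \<le> D * k x y" using * assms(2) by (simp add: field_simps)
  then show "k x z \<le> D * k x y" "k z y \<le> D * k x y" using nn by linarith+
qed

text \<open>A section of the jointly Borel kernel, composed with the root and extended by 0 to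
  negative arguments.\<close>

lemma kroot_measurable:
  assumes k: "oinarov_kernel D k" and x: "0 \<le> x"
  shows "kroot q k x \<in> borel_measurable lebesgue"
proof -
  have [measurable]: "(\<lambda>(x, y). k x y) \<in> borel_measurable (restrict_space borel ({0..} \<times> {0..}))"
    using k by (simp add: oinarov_kernel_def)
  have "(\<lambda>y::real. (x, y)) \<in> borel_measurable borel"
    by (intro borel_measurable_continuous_onI continuous_intros)
  then have "(Pair x :: real \<Rightarrow> real \<times> real) \<in> restrict_space borel {0..} \<rightarrow>\<^sub>M restrict_space borel ({0..} \<times> {0..})"
    by (rule measurable_restrict_space3) (use x in auto)
  then have "(\<lambda>y. case (x, y) of (x, y) \<Rightarrow> k x y) \<in> borel_measurable (restrict_space borel {0..})"
    by (rule measurable_compose) measurable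
  then have "(\<lambda>y. qroot q (ennreal (k x y))) \<in> borel_measurable (restrict_space borel {0..})"
    by simp
  then have "(\<lambda>y. qroot q (ennreal (k x y)) * indicator {0..} y) \<in> borel_measurable borel"
    by (simp add: borel_measurable_restrict_space_iff_ennreal)
  also have "(\<lambda>y. qroot q (ennreal (k x y)) * indicator {0..} y) = kroot q k x"
    using x by (auto simp: kroot_def fun_eq_iff split: split_indicator)
  finally show ?thesis by (simp add: measurable_completion)
qed

lemma wroot_measurable:
  assumes "w \<in> Mplus"
  shows "wroot q w \<in> borel_measurable lebesgue"
proof -
  have "(\<lambda>y. qroot q (w y)) \<in> borel_measurable (lebesgue_on {0..})"
    using assms unfolding Mplus_def by measurable
  then have "(\<lambda>y. qroot q (w y) * indicator {0..} y) \<in> borel_measurable lebesgue"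
    by (simp add: borel_measurable_restrict_space_iff_ennreal)
  also have "(\<lambda>y. qroot q (w y) * indicator {0..} y) = wroot q w"
    by (auto simp: wroot_def fun_eq_iff split: split_indicator)
  finally show ?thesis .
qed

lemma hardy_setting_roots:
  assumes "1 \<le> p" "0 < r" "0 < q" "1 \<le> D" "u \<in> Mplus" "v \<in> Mplus" "w \<in> Mplus"
    "\<forall>t>0. 0 < tail u t \<and> tail u t < \<infinity>" "oinarov_kernel D k"
  shows "hardy_setting u p r (root_const q D) q v (wroot q w) (kroot q k)"
proof unfold_locales
  note kD = oinarov_kernelD[OF assms(9)]
  have D: "0 < D" using assms by simp
  show "kroot q k x \<in> borel_measurable lebesgue" if "0 \<le> x" for x
    by (rule kroot_measurable[OF assms(9) that])
  fix x y z :: real assume xyz: "0 \<le> y" "y \<le> z" "z \<le> x"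
  note k = kD[OF D xyz]
  have root: "kroot q k a b = qroot q (ennreal (k a b))" if "0 \<le> a" "0 \<le> b" for a b
    using that by (simp add: kroot_def)
  have "ennreal (k x y) \<le> ennreal (D * (k x z + k z y))" using k by (intro ennreal_leI) auto
  also have "\<dots> = ennreal D * (ennreal (k x z) + ennreal (k z y))"
    using k D by (simp add: ennreal_mult)
  finally show "kroot q k x y \<le> ennreal (root_const q D) * (kroot q k x z + kroot q k z y)"
    using xyz qroot_le_of_le_sum[OF assms(3,4)] by (simp add: root)
  have "ennreal (k x z) \<le> ennreal (D * k x y)" using k by (intro ennreal_leI) auto
  \<comment> \<open>Padding with 0 brings the one-term inequality into the form of
    \<open>qroot_le_of_le_sum\<close>.\<close>
  also have "\<dots> = ennreal D * (ennreal (k x y) + 0)" using k D by (simp add: ennreal_mult)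
  finally show "kroot q k x z \<le> ennreal (root_const q D) * kroot q k x y"
    using xyz qroot_le_of_le_sum[OF assms(3,4), of _ "ennreal (k x y)" 0] by (simp add: root)
  have "ennreal (k z y) \<le> ennreal (D * k x y)" using k by (intro ennreal_leI) auto
  also have "\<dots> = ennreal D * (ennreal (k x y) + 0)" using k D by (simp add: ennreal_mult)
  finally show "kroot q k z y \<le> ennreal (root_const q D) * kroot q k x y"
    using xyz qroot_le_of_le_sum[OF assms(3,4), of _ "ennreal (k x y)" 0] by (simp add: root)
qed (use assms root_const_ge_1 wroot_measurable in auto)

lemma (in tail_weight) zeta_inv_nonneg:
  assumes "0 \<le> x" shows "0 \<le> zeta_inv u x"
proof (cases "x = 0")
  case False
  with assms have "0 < x" by simp
  then show ?thesis by (cases rule: zeta_inv_cases) auto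
qed simp

lemma integral_roots:
  assumes q: "0 < q" "q \<noteq> top" and "A \<subseteq> {0..}" "0 \<le> x" and A: "A \<in> sets lebesgue"
    and g: "\<And>y. y \<in> A \<Longrightarrow> g y = ennreal (k x y) * w y * F y powe enn2real q"
  shows "(\<integral>\<^sup>+y\<in>A. g y \<partial>lebesgue) powe (1 / enn2real q)
    = Lq q (\<lambda>y. indicator A y * (kroot q k x y * wroot q w y * F y))"
  using assms
  by (intro qroot_integral_eq_Lq) (auto simp: powe_mult kroot_def wroot_def qroot_powe)

lemma ess_sup_roots:
  assumes "A \<subseteq> {0..}" "0 \<le> x" "A \<in> sets lebesgue"
    and "\<And>y. y \<in> A \<Longrightarrow> g y = ennreal (k x y) * w y * F y"
  shows "ess_sup_on A g = Lq top (\<lambda>y. indicator A y * (kroot top k x y * wroot top w y * F y))"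
  using assms
  by (intro ess_sup_on_eq_Lq) (auto simp: kroot_def wroot_def qroot_def)

lemma T_op_eq:
  assumes "0 < q" "0 \<le> x"
  shows "T_op q k w f x = Lq q (\<lambda>y. indicator {0<..<x} y * (kroot q k x y * wroot q w y * tail f y))"
  using assms unfolding T_op_def
  by (cases "q = top") (auto intro!: ess_sup_roots integral_roots)

lemma wnorm_eq_Lq:
  assumes q: "0 < q" and A: "A \<subseteq> {0..}" and t: "0 \<le> t"
  shows "wnorm q (\<lambda>y. w y * ennreal (k t y)) (\<lambda>y. indicator A y * F y)
    = Lq q (\<lambda>y. indicator A y * (kroot q k t y * wroot q w y * F y))"
proof (cases "q = top")
  case True
  then show ?thesis using A t unfolding wnorm_def
    by (simp, intro ess_sup_on_eq_Lq)
      (auto simp: kroot_def wroot_def qroot_def mult_ac split: split_indicator)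
next
  case False
  then show ?thesis using A t q unfolding wnorm_def
    by (simp, intro qroot_integral_eq_Lq)
      (auto simp: powe_mult kroot_def wroot_def qroot_powe mult_ac split: split_indicator)
qed

section \<open>Identification with the original constants\<close>

context
  fixes p r D :: real and q :: ennreal and u v w :: "real \<Rightarrow> ennreal" and k :: "real \<Rightarrow> real \<Rightarrow> real"
  assumes A: "1 \<le> p" "0 < r" "0 < q" "1 \<le> D" "u \<in> Mplus" "v \<in> Mplus" "w \<in> Mplus"
    "\<forall>t>0. 0 < tail u t \<and> tail u t < \<infinity>" "oinarov_kernel D k"
begin

interpretation hardy_setting u p r "root_const q D" q v "wroot q w" "kroot q k"
  by (rule hardy_setting_roots[OF A])

lemma C_T_eq: "C_T p q r u v w k = CT"
proof -
  have "wnorm (ennreal r) u (T_op q k w f) = NT f" for f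
    unfolding wnorm_def NT_def using A(2)
    by (auto simp: T_op_eq[OF A(3)] Th_def Q_def intro!: arg_cong[where f = "\<lambda>x. x powe (1 / r)"] nn_integral_cong
        split: split_indicator)
  then show ?thesis by (simp add: C_T_def CT_def)
qed

lemma B0_eq: "B0 p q r u v w k = b0"
proof (cases "q = top")
  case True
  have *: "ess_sup_on {0<..<x} (\<lambda>y. ennreal (k x y) * w y) = Q {0<..<x} x (\<lambda>_. 1)" if "0 \<le> x" for x
    unfolding Q_def unfolding True using that by (intro ess_sup_roots) auto
  have "(\<integral>\<^sup>+x\<in>{0..}. u x * (ess_sup_on {0<..<x} (\<lambda>y. ennreal (k x y) * w y) powe r)
                * (tail f x powe r) \<partial>lebesgue) powe (1 / r) = NB0 f" for f
    unfolding NB0_def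
    by (intro arg_cong[where f = "\<lambda>x. x powe (1 / r)"] nn_integral_cong) (auto simp: * split: split_indicator)
  then show ?thesis unfolding B0_def b0_def using True by simp
next
  case False
  have *: "(\<integral>\<^sup>+y\<in>{0<..<x}. ennreal (k x y) * w y \<partial>lebesgue) powe (r / enn2real q) = Q {0<..<x} x (\<lambda>_. 1) powe r"
    if "0 \<le> x" for x
  proof -
    have "(\<integral>\<^sup>+y\<in>{0<..<x}. ennreal (k x y) * w y \<partial>lebesgue) powe (1 / enn2real q) = Q {0<..<x} x (\<lambda>_. 1)"
      unfolding Q_def using that False A(3) by (intro integral_roots) auto
    then show ?thesis by (metis powe_powe times_divide_eq_left mult_1)
  qed
  have "(\<integral>\<^sup>+x\<in>{0..}. u x * ((\<integral>\<^sup>+y\<in>{0<..<x}. ennreal (k x y) * w y \<partial>lebesgue) powe (r / enn2real q))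
                * (tail f x powe r) \<partial>lebesgue) powe (1 / r) = NB0 f" for f
    unfolding NB0_def
    by (intro arg_cong[where f = "\<lambda>x. x powe (1 / r)"] nn_integral_cong) (auto simp: * split: split_indicator)
  then show ?thesis unfolding B0_def b0_def using False by simp
qed

lemma B1_eq: "B1 p q r u v w k = b1"
proof (cases "q = top")
  case True
  have R: "ess_sup_on {0<..<z} (\<lambda>y. w y * tail f y) = R {0<..<z} (tail f)" for z f
    unfolding R_def unfolding True
    by (intro ess_sup_on_eq_Lq) (auto simp: wroot_def qroot_def)
  have K: "ennreal (k x z) = kroot q k x z" if "0 \<le> x" "0 \<le> z" for x z
    using that True by (simp add: kroot_def qroot_def)
  have "(\<integral>\<^sup>+x\<in>{0..}. u x * (ennreal (k x (zeta_inv u (zeta_inv u x))) powe r)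
                * (ess_sup_on {0<..<zeta_inv u (zeta_inv u x)} (\<lambda>y. w y * tail f y) powe r) \<partial>lebesgue)
            powe (1 / r) = NB1 f" for f
    unfolding NB1_def R
    by (intro arg_cong[where f = "\<lambda>x. x powe (1 / r)"] nn_integral_cong)
      (auto simp: K zeta_inv_nonneg split: split_indicator)
  then show ?thesis unfolding B1_def b1_def using True by (simp add: Let_def)
next
  case False
  have R: "(\<integral>\<^sup>+y\<in>{0<..<z}. w y * (tail f y powe enn2real q) \<partial>lebesgue) powe (r / enn2real q)
     = R {0<..<z} (tail f) powe r" for z f
  proof -
    have "(\<integral>\<^sup>+y\<in>{0<..<z}. w y * (tail f y powe enn2real q) \<partial>lebesgue) powe (1 / enn2real q) = R {0<..<z} (tail f)"
      unfolding R_def using False A(3)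
      by (intro qroot_integral_eq_Lq) (auto simp: powe_mult wroot_def qroot_powe)
    then show ?thesis by (metis powe_powe times_divide_eq_left mult_1)
  qed
  have K: "ennreal (k x z) powe (r / enn2real q) = kroot q k x z powe r" if "0 \<le> x" "0 \<le> z" for x z
    using that False by (simp add: kroot_def qroot_def powe_powe)
  have "(\<integral>\<^sup>+x\<in>{0..}. u x * (ennreal (k x (zeta_inv u (zeta_inv u x))) powe (r / enn2real q))
                * ((\<integral>\<^sup>+y\<in>{0<..<zeta_inv u (zeta_inv u x)}. w y * (tail f y powe enn2real q) \<partial>lebesgue)
                     powe (r / enn2real q)) \<partial>lebesgue)
            powe (1 / r) = NB1 f" for f
    unfolding NB1_def R
    by (intro arg_cong[where f = "\<lambda>x. x powe (1 / r)"] nn_integral_cong)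
      (auto simp: K zeta_inv_nonneg split: split_indicator)
  then show ?thesis unfolding B1_def b1_def using False by (simp add: Let_def)
qed

lemma H_tail_eq:
  assumes "0 < t"
  shows "op_norm (ennreal p) v q (\<lambda>y. w y * ennreal (k t y)) (H_tail t) = ht t"
proof -
  have "wnorm q (\<lambda>y. w y * ennreal (k t y)) (H_tail t f) = Q {0<..t} t (tail f)" for f
    unfolding H_tail_def[abs_def] Q_def using assms A(3) by (intro wnorm_eq_Lq) auto
  then show ?thesis by (simp add: op_norm_def ht_def)
qed

lemma H_block_eq:
  assumes "0 \<le> a" "0 \<le> b"
  shows "op_norm (ennreal p) v q (\<lambda>y. w y * ennreal (k b y)) (H_block u a b) = bn a b (zeta u b)"
proof -
  have "wnorm q (\<lambda>y. w y * ennreal (k b y)) (H_block u a b f)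
      = Q {a<..b} b (tail (\<lambda>z. f z * indicator {..zeta u b} z))" for f
  proof -
    have "(\<integral>\<^sup>+z\<in>{x..zeta u b}. f z \<partial>lebesgue) = tail (\<lambda>z. f z * indicator {..zeta u b} z) x" for x
      unfolding tail_def by (intro nn_integral_cong) (auto split: split_indicator)
    then have "H_block u a b f = (\<lambda>x. indicator {a<..b} x * tail (\<lambda>z. f z * indicator {..zeta u b} z) x)"
      by (simp add: H_block_def fun_eq_iff)
    then show ?thesis unfolding Q_def using assms A(3) by (simp, intro wnorm_eq_Lq) auto
  qed
  then show ?thesis by (simp add: op_norm_def bn_def)
qed

lemma B2_eq: "B2 p q r u v w k = b2"
proof (cases "p \<le> r")
  case True
  then show ?thesis by (simp add: B2_def b2_def Let_def H_tail_eq cong: SUP_cong_simp)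
next
  case False
  then have "1 / p < 1 / r" using A by (intro divide_strict_left_mono) auto
  then have s: "1 / max (1 / r - 1 / p) 0 = s" by (simp add: s_def max_def)
  have "(\<integral>\<^sup>+x\<in>{0..}. u x * (tail u x powe (s / p))
            * (op_norm (ennreal p) v q (\<lambda>y. w y * ennreal (k (zeta u (zeta u x)) y))
                 (H_block u (zeta_inv u x) (zeta u (zeta u x))) powe s) \<partial>lebesgue)
     = (\<integral>\<^sup>+x\<in>{0..}. u x * (U x powe (s / p))
       * (bn (zeta_inv u x) (zeta u (zeta u x)) (zeta u (zeta u (zeta u x))) powe s) \<partial>lebesgue)"
  proof (rule nn_integral_cong_AE)
    \<comment> \<open>The point 0 is discarded as a null set, since the bounds on
      \<open>zeta\<close> are available at positive arguments.\<close>
    show "AE x in lebesgue. u x * (tail u x powe (s / p))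
            * (op_norm (ennreal p) v q (\<lambda>y. w y * ennreal (k (zeta u (zeta u x)) y))
                 (H_block u (zeta_inv u x) (zeta u (zeta u x))) powe s) * indicator {0..} x
        = u x * (U x powe (s / p))
       * (bn (zeta_inv u x) (zeta u (zeta u x)) (zeta u (zeta u (zeta u x))) powe s) * indicator {0..} x"
      using AE_neq_0
    proof eventually_elim
      case (elim x)
      show ?case
      proof (cases "0 < x")
        case True
        have "x \<le> zeta u x" by (rule le_zeta[OF True])
        moreover from this have "zeta u x \<le> zeta u (zeta u x)" using True by (intro le_zeta) simp
        ultimately have "0 \<le> zeta u (zeta u x)" using True by simp
        then show ?thesis using True by (simp add: H_block_eq zeta_inv_nonneg)
      qed (use elim in auto)
    qed
  qed
  then show ?thesis using False by (simp add: B2_def b2_def Let_def s)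
qed

text \<open>The exported \<open>suff_const\<close> takes only p, r, \<open>root_const q D\<close>
  and q as arguments; this is how independence of u, v, w and k is obtained.\<close>

lemma C_T_upper:
  "C_T p q r u v w k \<le> ennreal (hardy_setting.suff_const p r (root_const q D) q)
     * (B0 p q r u v w k + B1 p q r u v w k + B2 p q r u v w k)"
  using CT_le by (simp add: C_T_eq B0_eq B1_eq B2_eq)

lemma C_T_lower:
  "B0 p q r u v w k + B1 p q r u v w k + B2 p q r u v w k
    \<le> ennreal (1 + root_const q D + (root_const q D + hardy_setting.nec_const r (root_const q D))) * C_T p q r u v w k"
proof -
  have nec: "0 \<le> nec_const" using DK by (simp add: nec_const_def)
  \<comment> \<open>The sum of the two constants covers the cases p at most r and r < p at
    once.\<close>
  have "b2 \<le> ennreal (root_const q D + nec_const) * CT"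
  proof (cases "p \<le> r")
    case True
    show ?thesis
      by (rule order_trans[OF b2_le_case1[OF True]]) (use DK nec in \<open>auto intro!: mult_right_mono ennreal_leI\<close>)
  next
    case False
    show ?thesis
      by (rule order_trans[OF b2_le_case2]) (use DK nec False in \<open>auto intro!: mult_right_mono ennreal_leI\<close>)
  qed
  then have "b0 + b1 + b2 \<le> 1 * CT + ennreal (root_const q D) * CT + ennreal (root_const q D + nec_const) * CT"
    using b0_le b1_le by (intro add_mono) auto
  also have "\<dots> = ennreal (1 + root_const q D + (root_const q D + nec_const)) * CT"
  proof -
    have "ennreal (1 + root_const q D + (root_const q D + nec_const)) = 1 + ennreal (root_const q D) + ennreal (root_const q D + nec_const)"
      using DK nec ennreal_plus[of "1 + root_const q D" "root_const q D + nec_const"] ennreal_plus[of 1 "root_const q D"]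
      by (simp del: ennreal_plus)
    then show ?thesis by (simp only: distrib_right)
  qed
  finally show ?thesis by (simp add: C_T_eq B0_eq B1_eq B2_eq)
qed

end

theorem theorem5p1:
  fixes p r D :: real and q :: ennreal
  assumes "1 \<le> p" and "0 < r" and "0 < q" and "1 \<le> D"
  shows "\<exists>c1 c2 :: real. 0 < c1 \<and> 0 < c2 \<and>
    (\<forall>(u :: real \<Rightarrow> ennreal) (v :: real \<Rightarrow> ennreal) (w :: real \<Rightarrow> ennreal)
       (k :: real \<Rightarrow> real \<Rightarrow> real).
      u \<in> Mplus \<longrightarrow> v \<in> Mplus \<longrightarrow> w \<in> Mplus \<longrightarrow>
      (\<forall>t>0. 0 < tail u t \<and> tail u t < \<infinity>) \<longrightarrow>
      oinarov_kernel D k \<longrightarrow>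
      (C_T p q r u v w k < \<infinity> \<longleftrightarrow>
         B0 p q r u v w k < \<infinity> \<and> B1 p q r u v w k < \<infinity> \<and> B2 p q r u v w k < \<infinity>) \<and>
      C_T p q r u v w k
        \<le> ennreal c1 * (B0 p q r u v w k + B1 p q r u v w k + B2 p q r u v w k) \<and>
      B0 p q r u v w k + B1 p q r u v w k + B2 p q r u v w k
        \<le> ennreal c2 * C_T p q r u v w k)"
proof -
  \<comment> \<open>Both constants are fixed before u, v, w and k are introduced; the maximum with 1
    secures positivity.\<close>
  define a where "a = max 1 (hardy_setting.suff_const p r (root_const q D) q)"
  define b where "b = max 1 (1 + root_const q D + (root_const q D + hardy_setting.nec_const r (root_const q D)))"
  show ?thesis
  proof (intro exI conjI allI impI)
    show "0 < a" "0 < b" by (auto simp: a_def b_def)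
    fix u v w :: "real \<Rightarrow> ennreal" and k :: "real \<Rightarrow> real \<Rightarrow> real"
    assume hyps: "u \<in> Mplus" "v \<in> Mplus" "w \<in> Mplus"
      "\<forall>t>0. 0 < tail u t \<and> tail u t < \<infinity>" "oinarov_kernel D k"
    let ?C = "C_T p q r u v w k" and ?B = "B0 p q r u v w k + B1 p q r u v w k + B2 p q r u v w k"
    show up: "?C \<le> ennreal a * ?B"
      by (rule order_trans[OF C_T_upper[OF assms hyps]]) (auto simp: a_def intro!: mult_right_mono ennreal_leI)
    show low: "?B \<le> ennreal b * ?C"
      by (rule order_trans[OF C_T_lower[OF assms hyps]]) (auto simp: b_def intro!: mult_right_mono ennreal_leI)
    have "?B < top" if "?C < top"
      by (rule le_less_trans[OF low]) (use that in \<open>simp add: ennreal_mult_less_top\<close>)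
    moreover have "?C < top" if "?B < top"
      by (rule le_less_trans[OF up]) (use that in \<open>simp add: ennreal_mult_less_top\<close>)
    ultimately have "?C < top \<longleftrightarrow> ?B < top" by blast
    then show "?C < \<infinity> \<longleftrightarrow> B0 p q r u v w k < \<infinity> \<and> B1 p q r u v w k < \<infinity> \<and> B2 p q r u v w k < \<infinity>"
      by (simp add: conj_assoc)
  qed
qed

end
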